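(* Let $\mathcal C$ and $\mathcal D$ be Reedy categories and let $G\colon \mathcal C \to \mathcal D$ be a Reedy functor. Then the induced functor of diagram categories $G^{*}\colon \mathcal M^{\mathcal D} \to \mathcal M^{\mathcal C}$ is a right Quillen functor (for the Reedy model category structures) for every model category $\mathcal M$ if and only if $G$ is a fibering Reedy functor.
   Context: Model categories have all small limits and colimits. A Reedy category is a small category $\mathcal C$ together with two subcategories $\overrightarrow{\mathcal C}$ (the direct subcategory) and $\overleftarrow{\mathcal C}$ (the inverse subcategory), both containing all objects of $\mathcal C$, such that every object can be assigned a nonnegative integer (its degree) so that: every non-identity map of $\overrightarrow{\mathcal C}$ raises degree; every non-identity map of $\overleftarrow{\mathcal C}$ lowers degree; every map $g$ of $\mathcal C$ has a unique factorization $g = \overrightarrow g\,\overleftarrow g$ with $\overrightarrow g$ in $\overrightarrow{\mathcal C}$ and $\overleftarrow g$ in $\overleftarrow{\mathcal C}$. A Reedy functor $G\colon \mathcal C\to\mathcal D$ between Reedy categories is a functor taking $\overrightarrow{\mathcal C}$ into $\overrightarrow{\mathcal D}$ and $\overleftarrow{\mathcal C}$ into $\overleftarrow{\mathcal D}$ (it need not respect degrees, and may take non-identity maps to identity maps). Category of inverse $\mathcal C$-factorizations. Let $\alpha\in\mathrm{Ob}(\mathcal C)$, $\beta\in\mathrm{Ob}(\mathcal D)$ and let $\sigma\colon G\alpha\to\beta$ be a map in $\overleftarrow{\mathcal D}$. The category $\mathrm{Fact}_{\overleftarrow{\mathcal C}}(\alpha,\sigma)$ has as objects the pairs $\bigl((\nu\colon\alpha\to\gamma),(\mu\colon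 G\gamma\to\beta)\bigr)$ with $\nu$ a non-identity map in $\overleftarrow{\mathcal C}$, $\mu$ a map in $\overleftarrow{\mathcal D}$, and $\mu\circ G\nu=\sigma$; a map from $\bigl((\nu\colon\alpha\to\gamma),\mu\bigr)$ to $\bigl((\nu'\colon\alpha\to\gamma'),\mu'\bigr)$ is a map $\tau\colon\gamma\to\gamma'$ in $\overleftarrow{\mathcal C}$ with $\tau\nu=\nu'$ and $\mu'\circ G\tau=\mu$. $G$ is a fibering Reedy functor if for every $\alpha\in\mathrm{Ob}(\mathcal C)$, every $\beta\in\mathrm{Ob}(\mathcal D)$ and every map $\sigma\colon G\alpha\to\beta$ in $\overleftarrow{\mathcal D}$, the nerve of $\mathrm{Fact}_{\overleftarrow{\mathcal C}}(\alpha,\sigma)$ is either empty or connected. Diagrams. $\mathcal M^{\mathcal C}$ is the category of functors $\mathcal C\to\mathcal M$ and natural transformations. $G^{*}$ is precomposition with $G$. For a $\mathcal C$-diagram $X$ and $\alpha\in\mathrm{Ob}(\mathcal C)$, the latching category at $\alpha$ is the full subcategory of the overcategory $(\overrightarrow{\mathcal C}\downarrow\alpha)$ on all objects except $1_\alpha$, and the latching object $\mathrm L_\alpha X$ is the colimit of $X$ over it; the matching category at $\alpha$ is the full subcategory of the undercategory $(\alpha\downarrow\overleftarrow{\mathcal C})$ on all objects except $1_\alpha$, and the matching object $\mathrm M_\alpha X$ is the limit of $X$ over it. The Reedy model category structure on $\mathcal M^{\mathcal C}$: a map $X\to Y$ is a weak equivalence if every $X_\alpha\to Y_\alpha$ is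 a weak equivalence; a cofibration if every relative latching map $X_\alpha\amalg_{\mathrm L_\alpha X}\mathrm L_\alpha Y\to Y_\alpha$ is a cofibration; a fibration if every relative matching map $X_\alpha\to Y_\alpha\times_{\mathrm M_\alpha Y}\mathrm M_\alpha X$ is a fibration. A right Quillen functor between model categories is a functor that has a left adjoint and preserves fibrations and trivial fibrations. *)

theory Defs
  imports Main "HOL-Library.FuncSet"
begin

section \<open>Categories, functors, natural transformations\<close>

record ('o, 'a) cat =
  Obj :: "'o set"
  Arr :: "'a set"
  Dom :: "'a \<Rightarrow> 'o"
  Cod :: "'a \<Rightarrow> 'o"
  Ident :: "'o \<Rightarrow> 'a"
  Comp :: "'a \<Rightarrow> 'a \<Rightarrow> 'a"  (infixl "\<cdot>\<index>" 70)

text \<open>Composition is in the usual order: \<open>g \<cdot> f\<close> is \<open>f\<close> followed by \<open>g\<close>, and it is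
  meaningful only if \<open>Dom g = Cod f\<close>.\<close>

definition Hom :: "('o, 'a, 'z) cat_scheme \<Rightarrow> 'o \<Rightarrow> 'o \<Rightarrow> 'a set" where
  "Hom C a b = {f \<in> Arr C. Dom C f = a \<and> Cod C f = b}"

locale category =
  fixes C :: "('o, 'a, 'z) cat_scheme" (structure)
  assumes Dom_Obj: "f \<in> Arr C \<Longrightarrow> Dom C f \<in> Obj C"
    and Cod_Obj: "f \<in> Arr C \<Longrightarrow> Cod C f \<in> Obj C"
    and Ident_Hom: "a \<in> Obj C \<Longrightarrow> Ident C a \<in> Hom C a a"
    and Comp_Hom: "\<lbrakk>f \<in> Hom C a b; g \<in> Hom C b c\<rbrakk> \<Longrightarrow> g \<cdot> f \<in> Hom C a c"
    and Comp_Ident_right: "f \<in> Hom C a b \<Longrightarrow> f \<cdot> Ident C a = f"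
    and Comp_Ident_left: "f \<in> Hom C a b \<Longrightarrow> Ident C b \<cdot> f = f"
    and Comp_assoc: "\<lbrakk>f \<in> Hom C a b; g \<in> Hom C b c; h \<in> Hom C c d\<rbrakk> \<Longrightarrow> h \<cdot> (g \<cdot> f) = (h \<cdot> g) \<cdot> f"

text \<open>Smallness is relative to a type \<open>'u\<close>, which plays the role of the universe of small sets.
  As objects embed into arrows through their identities, it suffices to bound the arrows.\<close>

definition small_category :: "'u itself \<Rightarrow> ('o, 'a, 'z) cat_scheme \<Rightarrow> bool" where
  "small_category U C \<longleftrightarrow> category C \<and> (\<exists>e :: 'a \<Rightarrow> 'u. inj_on e (Arr C))"

record ('o1, 'a1, 'o2, 'a2) func =
  fobj :: "'o1 \<Rightarrow> 'o2"
  farr :: "'a1 \<Rightarrow> 'a2"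

definition is_functor ::
  "('o1, 'a1, 'y) cat_scheme \<Rightarrow> ('o2, 'a2, 'z) cat_scheme \<Rightarrow> ('o1, 'a1, 'o2, 'a2) func \<Rightarrow> bool" where
  "is_functor A B F \<longleftrightarrow> category A \<and> category B
     \<and> (\<forall>a\<in>Obj A. fobj F a \<in> Obj B)
     \<and> (\<forall>f\<in>Arr A. farr F f \<in> Hom B (fobj F (Dom A f)) (fobj F (Cod A f)))
     \<and> (\<forall>a\<in>Obj A. farr F (Ident A a) = Ident B (fobj F a))
     \<and> (\<forall>f\<in>Arr A. \<forall>g\<in>Arr A. Dom A g = Cod A f \<longrightarrow>
          farr F (g \<cdot>\<^bsub>A\<^esub> f) = farr F g \<cdot>\<^bsub>B\<^esub> farr F f)"

text \<open>Functors as elements of a set (objects of a functor category, simplices of a nerve) are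
  normalized outside their domain, so that equality of values is equality of functors.\<close>

definition functors ::
  "('o1, 'a1, 'y) cat_scheme \<Rightarrow> ('o2, 'a2, 'z) cat_scheme \<Rightarrow> ('o1, 'a1, 'o2, 'a2) func set" where
  "functors A B =
     {F. is_functor A B F \<and> fobj F \<in> extensional (Obj A) \<and> farr F \<in> extensional (Arr A)}"

text \<open>The composite \<open>F \<circ> G\<close>, where \<open>A\<close> is the domain of \<open>G\<close>.\<close>

definition comp_func ::
  "('o1, 'a1, 'z) cat_scheme \<Rightarrow> ('o2, 'a2, 'o3, 'a3) func \<Rightarrow> ('o1, 'a1, 'o2, 'a2) func
     \<Rightarrow> ('o1, 'a1, 'o3, 'a3) func" where
  "comp_func A F G = \<lparr>fobj = restrict (fobj F \<circ> fobj G) (Obj A),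
                      farr = restrict (farr F \<circ> farr G) (Arr A)\<rparr>"

record ('o1, 'a1, 'o2, 'a2) ntrans =
  nsrc :: "('o1, 'a1, 'o2, 'a2) func"
  ntgt :: "('o1, 'a1, 'o2, 'a2) func"
  nat_at :: "'o1 \<Rightarrow> 'a2"

definition nat_transformations ::
  "('o1, 'a1, 'y) cat_scheme \<Rightarrow> ('o2, 'a2, 'z) cat_scheme \<Rightarrow> ('o1, 'a1, 'o2, 'a2) ntrans set" where
  "nat_transformations A B =
     {t. nsrc t \<in> functors A B \<and> ntgt t \<in> functors A B
       \<and> nat_at t \<in> extensional (Obj A)
       \<and> (\<forall>a\<in>Obj A. nat_at t a \<in> Hom B (fobj (nsrc t) a) (fobj (ntgt t) a))
       \<and> (\<forall>f\<in>Arr A. nat_at t (Cod A f) \<cdot>\<^bsub>B\<^esub> farr (nsrc t) f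
                   = farr (ntgt t) f \<cdot>\<^bsub>B\<^esub> nat_at t (Dom A f))}"

definition functor_category ::
  "('o1, 'a1, 'y) cat_scheme \<Rightarrow> ('o2, 'a2, 'z) cat_scheme
     \<Rightarrow> (('o1, 'a1, 'o2, 'a2) func, ('o1, 'a1, 'o2, 'a2) ntrans) cat" where
  "functor_category A B =
     \<lparr>Obj = functors A B,
      Arr = nat_transformations A B,
      Dom = nsrc,
      Cod = ntgt,
      Ident = (\<lambda>F. \<lparr>nsrc = F, ntgt = F, nat_at = restrict (\<lambda>a. Ident B (fobj F a)) (Obj A)\<rparr>),
      Comp = (\<lambda>t s. \<lparr>nsrc = nsrc s, ntgt = ntgt t,
                     nat_at = restrict (\<lambda>a. nat_at t a \<cdot>\<^bsub>B\<^esub> nat_at s a) (Obj A)\<rparr>)\<rparr>"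

text \<open>The functor \<open>G\<^sup>*\<close> from diagrams on the codomain of \<open>G\<close> to diagrams on its domain \<open>C\<close>.\<close>

definition precomposition ::
  "('o1, 'a1, 'z) cat_scheme \<Rightarrow> ('o1, 'a1, 'o2, 'a2) func
     \<Rightarrow> (('o2, 'a2, 'o3, 'a3) func, ('o2, 'a2, 'o3, 'a3) ntrans,
         ('o1, 'a1, 'o3, 'a3) func, ('o1, 'a1, 'o3, 'a3) ntrans) func" where
  "precomposition C G =
     \<lparr>fobj = (\<lambda>X. comp_func C X G),
      farr = (\<lambda>t. \<lparr>nsrc = comp_func C (nsrc t) G, ntgt = comp_func C (ntgt t) G,
                   nat_at = restrict (nat_at t \<circ> fobj G) (Obj C)\<rparr>)\<rparr>"

definition adjunction ::
  "('o1, 'a1, 'y) cat_scheme \<Rightarrow> ('o2, 'a2, 'z) cat_scheme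
     \<Rightarrow> ('o2, 'a2, 'o1, 'a1) func \<Rightarrow> ('o1, 'a1, 'o2, 'a2) func \<Rightarrow> bool" where
  "adjunction A B L R \<longleftrightarrow> is_functor B A L \<and> is_functor A B R
     \<and> (\<exists>\<phi>.
          (\<forall>b\<in>Obj B. \<forall>a\<in>Obj A. bij_betw (\<phi> b a) (Hom A (fobj L b) a) (Hom B b (fobj R a)))
        \<and> (\<forall>g\<in>Arr B. \<forall>h\<in>Arr A. \<forall>f\<in>Hom A (fobj L (Cod B g)) (Dom A h).
             \<phi> (Dom B g) (Cod A h) (h \<cdot>\<^bsub>A\<^esub> (f \<cdot>\<^bsub>A\<^esub> farr L g))
               = farr R h \<cdot>\<^bsub>B\<^esub> (\<phi> (Cod B g) (Dom A h) f \<cdot>\<^bsub>B\<^esub> g)))"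

definition has_left_adjoint ::
  "('o1, 'a1, 'y) cat_scheme \<Rightarrow> ('o2, 'a2, 'z) cat_scheme \<Rightarrow> ('o1, 'a1, 'o2, 'a2) func \<Rightarrow> bool" where
  "has_left_adjoint A B R \<longleftrightarrow> (\<exists>L. adjunction A B L R)"


section \<open>Subcategories, overcategories, undercategories\<close>

definition wide_subcategory :: "('o, 'a, 'z) cat_scheme \<Rightarrow> 'a set \<Rightarrow> bool" where
  "wide_subcategory C S \<longleftrightarrow> S \<subseteq> Arr C
     \<and> (\<forall>a\<in>Obj C. Ident C a \<in> S)
     \<and> (\<forall>f\<in>S. \<forall>g\<in>S. Dom C g = Cod C f \<longrightarrow> g \<cdot>\<^bsub>C\<^esub> f \<in> S)"

definition wide_subcat :: "('o, 'a, 'z) cat_scheme \<Rightarrow> 'a set \<Rightarrow> ('o, 'a) cat" where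
  "wide_subcat C S =
     \<lparr>Obj = Obj C, Arr = S, Dom = Dom C, Cod = Cod C, Ident = Ident C, Comp = Comp C\<rparr>"

definition full_subcat :: "('o, 'a, 'z) cat_scheme \<Rightarrow> 'o set \<Rightarrow> ('o, 'a) cat" where
  "full_subcat C P =
     \<lparr>Obj = Obj C \<inter> P, Arr = {f \<in> Arr C. Dom C f \<in> P \<and> Cod C f \<in> P},
      Dom = Dom C, Cod = Cod C, Ident = Ident C, Comp = Comp C\<rparr>"

text \<open>An arrow \<open>(f, h, g)\<close> of the overcategory \<open>C \<down> a\<close> is \<open>h\<close> regarded as a map from \<open>f\<close> to \<open>g\<close>
  over \<open>a\<close>; dually for undercategories.\<close>

definition over_cat :: "('o, 'a, 'z) cat_scheme \<Rightarrow> 'o \<Rightarrow> ('a, 'a \<times> 'a \<times> 'a) cat" where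
  "over_cat C a =
     \<lparr>Obj = {f \<in> Arr C. Cod C f = a},
      Arr = {(f, h, g). f \<in> Arr C \<and> Cod C f = a \<and> g \<in> Arr C \<and> Cod C g = a
                      \<and> h \<in> Hom C (Dom C f) (Dom C g) \<and> g \<cdot>\<^bsub>C\<^esub> h = f},
      Dom = (\<lambda>(f, h, g). f),
      Cod = (\<lambda>(f, h, g). g),
      Ident = (\<lambda>f. (f, Ident C (Dom C f), f)),
      Comp = (\<lambda>(f', h', g') (f, h, g). (f, h' \<cdot>\<^bsub>C\<^esub> h, g'))\<rparr>"

definition under_cat :: "('o, 'a, 'z) cat_scheme \<Rightarrow> 'o \<Rightarrow> ('a, 'a \<times> 'a \<times> 'a) cat" where
  "under_cat C a =
     \<lparr>Obj = {f \<in> Arr C. Dom C f = a},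
      Arr = {(f, h, g). f \<in> Arr C \<and> Dom C f = a \<and> g \<in> Arr C \<and> Dom C g = a
                      \<and> h \<in> Hom C (Cod C f) (Cod C g) \<and> h \<cdot>\<^bsub>C\<^esub> f = g},
      Dom = (\<lambda>(f, h, g). f),
      Cod = (\<lambda>(f, h, g). g),
      Ident = (\<lambda>f. (f, Ident C (Cod C f), f)),
      Comp = (\<lambda>(f', h', g') (f, h, g). (f, h' \<cdot>\<^bsub>C\<^esub> h, g'))\<rparr>"


section \<open>Limits and colimits\<close>

definition is_cone ::
  "('o1, 'a1, 'y) cat_scheme \<Rightarrow> ('o2, 'a2, 'z) cat_scheme \<Rightarrow> ('o1, 'a1, 'o2, 'a2) func
     \<Rightarrow> 'o2 \<Rightarrow> ('o1 \<Rightarrow> 'a2) \<Rightarrow> bool" where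
  "is_cone J M F L p \<longleftrightarrow> L \<in> Obj M
     \<and> (\<forall>j\<in>Obj J. p j \<in> Hom M L (fobj F j))
     \<and> (\<forall>f\<in>Arr J. farr F f \<cdot>\<^bsub>M\<^esub> p (Dom J f) = p (Cod J f))"

definition is_limit ::
  "('o1, 'a1, 'y) cat_scheme \<Rightarrow> ('o2, 'a2, 'z) cat_scheme \<Rightarrow> ('o1, 'a1, 'o2, 'a2) func
     \<Rightarrow> 'o2 \<Rightarrow> ('o1 \<Rightarrow> 'a2) \<Rightarrow> bool" where
  "is_limit J M F L p \<longleftrightarrow> is_cone J M F L p
     \<and> (\<forall>K q. is_cone J M F K q \<longrightarrow>
          (\<exists>!u. u \<in> Hom M K L \<and> (\<forall>j\<in>Obj J. p j \<cdot>\<^bsub>M\<^esub> u = q j)))"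

definition is_cocone ::
  "('o1, 'a1, 'y) cat_scheme \<Rightarrow> ('o2, 'a2, 'z) cat_scheme \<Rightarrow> ('o1, 'a1, 'o2, 'a2) func
     \<Rightarrow> 'o2 \<Rightarrow> ('o1 \<Rightarrow> 'a2) \<Rightarrow> bool" where
  "is_cocone J M F L p \<longleftrightarrow> L \<in> Obj M
     \<and> (\<forall>j\<in>Obj J. p j \<in> Hom M (fobj F j) L)
     \<and> (\<forall>f\<in>Arr J. p (Cod J f) \<cdot>\<^bsub>M\<^esub> farr F f = p (Dom J f))"

definition is_colimit ::
  "('o1, 'a1, 'y) cat_scheme \<Rightarrow> ('o2, 'a2, 'z) cat_scheme \<Rightarrow> ('o1, 'a1, 'o2, 'a2) func
     \<Rightarrow> 'o2 \<Rightarrow> ('o1 \<Rightarrow> 'a2) \<Rightarrow> bool" where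
  "is_colimit J M F L p \<longleftrightarrow> is_cocone J M F L p
     \<and> (\<forall>K q. is_cocone J M F K q \<longrightarrow>
          (\<exists>!u. u \<in> Hom M L K \<and> (\<forall>j\<in>Obj J. u \<cdot>\<^bsub>M\<^esub> p j = q j)))"

text \<open>\<open>p\<close> and \<open>q\<close> exhibit their common domain as the pullback of \<open>f\<close> and \<open>g\<close>.\<close>

definition is_pullback :: "('o, 'a, 'z) cat_scheme \<Rightarrow> 'a \<Rightarrow> 'a \<Rightarrow> 'a \<Rightarrow> 'a \<Rightarrow> bool" where
  "is_pullback M f g p q \<longleftrightarrow>
     f \<in> Arr M \<and> g \<in> Arr M \<and> p \<in> Arr M \<and> q \<in> Arr M
     \<and> Cod M f = Cod M g \<and> Dom M p = Dom M q \<and> Cod M p = Dom M f \<and> Cod M q = Dom M g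
     \<and> f \<cdot>\<^bsub>M\<^esub> p = g \<cdot>\<^bsub>M\<^esub> q
     \<and> (\<forall>K. \<forall>u\<in>Hom M K (Dom M f). \<forall>v\<in>Hom M K (Dom M g). f \<cdot>\<^bsub>M\<^esub> u = g \<cdot>\<^bsub>M\<^esub> v \<longrightarrow>
          (\<exists>!w. w \<in> Hom M K (Dom M p) \<and> p \<cdot>\<^bsub>M\<^esub> w = u \<and> q \<cdot>\<^bsub>M\<^esub> w = v))"

text \<open>\<open>i\<close> and \<open>j\<close> exhibit their common codomain as the pushout of \<open>f\<close> and \<open>g\<close>.\<close>

definition is_pushout :: "('o, 'a, 'z) cat_scheme \<Rightarrow> 'a \<Rightarrow> 'a \<Rightarrow> 'a \<Rightarrow> 'a \<Rightarrow> bool" where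
  "is_pushout M f g i j \<longleftrightarrow>
     f \<in> Arr M \<and> g \<in> Arr M \<and> i \<in> Arr M \<and> j \<in> Arr M
     \<and> Dom M f = Dom M g \<and> Cod M i = Cod M j \<and> Dom M i = Cod M f \<and> Dom M j = Cod M g
     \<and> i \<cdot>\<^bsub>M\<^esub> f = j \<cdot>\<^bsub>M\<^esub> g
     \<and> (\<forall>K. \<forall>u\<in>Hom M (Cod M f) K. \<forall>v\<in>Hom M (Cod M g) K. u \<cdot>\<^bsub>M\<^esub> f = v \<cdot>\<^bsub>M\<^esub> g \<longrightarrow>
          (\<exists>!w. w \<in> Hom M (Cod M i) K \<and> w \<cdot>\<^bsub>M\<^esub> i = u \<and> w \<cdot>\<^bsub>M\<^esub> j = v))"

text \<open>Every category that is small relative to \<open>'u\<close> is isomorphic to one whose objects and arrows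
  are elements of \<open>'u\<close>, so it is enough to consider the latter as shapes of diagrams.
  For infinite \<open>'u\<close>, the category of subsets of \<open>'u set\<close> and all functions between them has all
  these limits and colimits; its objects and arrows can be encoded as elements of \<open>'u set set\<close>.
  A quantification over all complete and cocomplete categories therefore covers nontrivial examples
  as soon as the types of objects and of arrows contain a copy of \<open>'u set set\<close>.\<close>

definition has_small_limits :: "'u itself \<Rightarrow> ('o, 'a, 'z) cat_scheme \<Rightarrow> bool" where
  "has_small_limits U M \<longleftrightarrow>
     (\<forall>(J :: ('u, 'u) cat) F. is_functor J M F \<longrightarrow> (\<exists>L p. is_limit J M F L p))"

definition has_small_colimits :: "'u itself \<Rightarrow> ('o, 'a, 'z) cat_scheme \<Rightarrow> bool" where
  "has_small_colimits U M \<longleftrightarrow>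
     (\<forall>(J :: ('u, 'u) cat) F. is_functor J M F \<longrightarrow> (\<exists>L p. is_colimit J M F L p))"


section \<open>Model categories\<close>

record ('o, 'a) model_cat = "('o, 'a) cat" +
  Weq :: "'a set"
  Cof :: "'a set"
  Fib :: "'a set"

definition is_retract :: "('o, 'a, 'z) cat_scheme \<Rightarrow> 'a \<Rightarrow> 'a \<Rightarrow> bool" where
  "is_retract M f g \<longleftrightarrow> f \<in> Arr M \<and> g \<in> Arr M
     \<and> (\<exists>i \<in> Hom M (Dom M f) (Dom M g). \<exists>r \<in> Hom M (Dom M g) (Dom M f).
         \<exists>j \<in> Hom M (Cod M f) (Cod M g). \<exists>s \<in> Hom M (Cod M g) (Cod M f).
           r \<cdot>\<^bsub>M\<^esub> i = Ident M (Dom M f) \<and> s \<cdot>\<^bsub>M\<^esub> j = Ident M (Cod M f)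
         \<and> g \<cdot>\<^bsub>M\<^esub> i = j \<cdot>\<^bsub>M\<^esub> f \<and> f \<cdot>\<^bsub>M\<^esub> r = s \<cdot>\<^bsub>M\<^esub> g)"

definition has_lifting :: "('o, 'a, 'z) cat_scheme \<Rightarrow> 'a \<Rightarrow> 'a \<Rightarrow> bool" where
  "has_lifting M i p \<longleftrightarrow>
     (\<forall>u \<in> Hom M (Dom M i) (Dom M p). \<forall>v \<in> Hom M (Cod M i) (Cod M p).
        p \<cdot>\<^bsub>M\<^esub> u = v \<cdot>\<^bsub>M\<^esub> i \<longrightarrow>
        (\<exists>h \<in> Hom M (Cod M i) (Dom M p). h \<cdot>\<^bsub>M\<^esub> i = u \<and> p \<cdot>\<^bsub>M\<^esub> h = v))"

definition model_category :: "'u itself \<Rightarrow> ('o, 'a, 'z) model_cat_scheme \<Rightarrow> bool" where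
  "model_category U M \<longleftrightarrow> category M
     \<and> has_small_limits U M \<and> has_small_colimits U M
     \<and> Weq M \<subseteq> Arr M \<and> Cof M \<subseteq> Arr M \<and> Fib M \<subseteq> Arr M
     \<and> (\<forall>f\<in>Arr M. \<forall>g\<in>Arr M. Dom M g = Cod M f \<longrightarrow>
          (f \<in> Weq M \<and> g \<in> Weq M \<longrightarrow> g \<cdot>\<^bsub>M\<^esub> f \<in> Weq M)
        \<and> (f \<in> Weq M \<and> g \<cdot>\<^bsub>M\<^esub> f \<in> Weq M \<longrightarrow> g \<in> Weq M)
        \<and> (g \<in> Weq M \<and> g \<cdot>\<^bsub>M\<^esub> f \<in> Weq M \<longrightarrow> f \<in> Weq M))
     \<and> (\<forall>f g. is_retract M f g \<longrightarrow>
          (g \<in> Weq M \<longrightarrow> f \<in> Weq M) \<and> (g \<in> Cof M \<longrightarrow> f \<in> Cof M) \<and> (g \<in> Fib M \<longrightarrow> f \<in> Fib M))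
     \<and> (\<forall>i \<in> Cof M. \<forall>p \<in> Fib M \<inter> Weq M. has_lifting M i p)
     \<and> (\<forall>i \<in> Cof M \<inter> Weq M. \<forall>p \<in> Fib M. has_lifting M i p)
     \<and> (\<forall>f\<in>Arr M. \<exists>i \<in> Cof M. \<exists>p \<in> Fib M \<inter> Weq M. Dom M p = Cod M i \<and> p \<cdot>\<^bsub>M\<^esub> i = f)
     \<and> (\<forall>f\<in>Arr M. \<exists>i \<in> Cof M \<inter> Weq M. \<exists>p \<in> Fib M. Dom M p = Cod M i \<and> p \<cdot>\<^bsub>M\<^esub> i = f)"

definition right_quillen ::
  "('o1, 'a1, 'y) model_cat_scheme \<Rightarrow> ('o2, 'a2, 'z) model_cat_scheme
     \<Rightarrow> ('o1, 'a1, 'o2, 'a2) func \<Rightarrow> bool" where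
  "right_quillen A B R \<longleftrightarrow> is_functor A B R \<and> has_left_adjoint A B R
     \<and> (\<forall>f \<in> Fib A. farr R f \<in> Fib B)
     \<and> (\<forall>f \<in> Fib A \<inter> Weq A. farr R f \<in> Fib B \<inter> Weq B)"


section \<open>Reedy categories and Reedy functors\<close>

record ('o, 'a) reedy = "('o, 'a) cat" +
  Direct :: "'a set"
  Inverse :: "'a set"

definition reedy_category :: "'u itself \<Rightarrow> ('o, 'a, 'z) reedy_scheme \<Rightarrow> bool" where
  "reedy_category U C \<longleftrightarrow> small_category U C
     \<and> wide_subcategory C (Direct C) \<and> wide_subcategory C (Inverse C)
     \<and> (\<exists>deg :: 'o \<Rightarrow> nat.
          (\<forall>f \<in> Direct C. f \<noteq> Ident C (Dom C f) \<longrightarrow> deg (Dom C f) < deg (Cod C f))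
        \<and> (\<forall>f \<in> Inverse C. f \<noteq> Ident C (Dom C f) \<longrightarrow> deg (Cod C f) < deg (Dom C f)))
     \<and> (\<forall>g \<in> Arr C. \<exists>!(d, i). d \<in> Direct C \<and> i \<in> Inverse C \<and> Dom C d = Cod C i \<and> d \<cdot>\<^bsub>C\<^esub> i = g)"

definition reedy_functor ::
  "('o1, 'a1, 'y) reedy_scheme \<Rightarrow> ('o2, 'a2, 'z) reedy_scheme \<Rightarrow> ('o1, 'a1, 'o2, 'a2) func \<Rightarrow> bool" where
  "reedy_functor C D G \<longleftrightarrow> is_functor C D G
     \<and> (\<forall>f \<in> Direct C. farr G f \<in> Direct D)
     \<and> (\<forall>f \<in> Inverse C. farr G f \<in> Inverse D)"

text \<open>The category of inverse \<open>C\<close>-factorizations of \<open>(a, s)\<close>, where \<open>s\<close> is a map \<open>G a \<rightarrow> b\<close>.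
  An object \<open>(\<nu>, \<mu>)\<close> determines \<open>\<gamma>\<close> as the codomain of \<open>\<nu>\<close>; a map \<open>\<tau>\<close> is stored together with
  its source and target.\<close>

definition fact_obj ::
  "('o1, 'a1, 'y) reedy_scheme \<Rightarrow> ('o2, 'a2, 'z) reedy_scheme \<Rightarrow> ('o1, 'a1, 'o2, 'a2) func
     \<Rightarrow> 'o1 \<Rightarrow> 'a2 \<Rightarrow> ('a1 \<times> 'a2) set" where
  "fact_obj C D G a s =
     {(\<nu>, \<mu>). \<nu> \<in> Inverse C \<and> Dom C \<nu> = a \<and> \<nu> \<noteq> Ident C a
            \<and> \<mu> \<in> Inverse D \<and> Dom D \<mu> = fobj G (Cod C \<nu>) \<and> Cod D \<mu> = Cod D s
            \<and> \<mu> \<cdot>\<^bsub>D\<^esub> farr G \<nu> = s}"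

definition fact_cat ::
  "('o1, 'a1, 'y) reedy_scheme \<Rightarrow> ('o2, 'a2, 'z) reedy_scheme \<Rightarrow> ('o1, 'a1, 'o2, 'a2) func
     \<Rightarrow> 'o1 \<Rightarrow> 'a2 \<Rightarrow> ('a1 \<times> 'a2, ('a1 \<times> 'a2) \<times> 'a1 \<times> ('a1 \<times> 'a2)) cat" where
  "fact_cat C D G a s =
     \<lparr>Obj = fact_obj C D G a s,
      Arr = {((\<nu>, \<mu>), \<tau>, (\<nu>', \<mu>')).
               (\<nu>, \<mu>) \<in> fact_obj C D G a s \<and> (\<nu>', \<mu>') \<in> fact_obj C D G a s
             \<and> \<tau> \<in> Inverse C \<and> Dom C \<tau> = Cod C \<nu> \<and> Cod C \<tau> = Cod C \<nu>'
             \<and> \<tau> \<cdot>\<^bsub>C\<^esub> \<nu> = \<nu>' \<and> \<mu>' \<cdot>\<^bsub>D\<^esub> farr G \<tau> = \<mu>},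
      Dom = (\<lambda>(x, \<tau>, y). x),
      Cod = (\<lambda>(x, \<tau>, y). y),
      Ident = (\<lambda>x. (x, Ident C (Cod C (fst x)), x)),
      Comp = (\<lambda>(x', \<tau>', y') (x, \<tau>, y). (x, \<tau>' \<cdot>\<^bsub>C\<^esub> \<tau>, y'))\<rparr>"


section \<open>Nerves\<close>

text \<open>A simplicial set: \<open>act X m n \<theta>\<close> is the map \<open>X\<^sub>n \<rightarrow> X\<^sub>m\<close> induced by a weakly monotone
  \<open>\<theta> : {0..m} \<rightarrow> {0..n}\<close>.\<close>

record 's sset =
  simplices :: "nat \<Rightarrow> 's set"
  act :: "nat \<Rightarrow> nat \<Rightarrow> (nat \<Rightarrow> nat) \<Rightarrow> 's \<Rightarrow> 's"

definition ord_cat :: "nat \<Rightarrow> (nat, nat \<times> nat) cat" where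
  "ord_cat n =
     \<lparr>Obj = {..n}, Arr = {(i, j). i \<le> j \<and> j \<le> n}, Dom = fst, Cod = snd,
      Ident = (\<lambda>i. (i, i)), Comp = (\<lambda>(j', k) (i, j). (i, k))\<rparr>"

definition nerve :: "('o, 'a, 'z) cat_scheme \<Rightarrow> (nat, nat \<times> nat, 'o, 'a) func sset" where
  "nerve K =
     \<lparr>simplices = (\<lambda>n. functors (ord_cat n) K),
      act = (\<lambda>m n \<theta> x. comp_func (ord_cat m) x \<lparr>fobj = \<theta>, farr = map_prod \<theta> \<theta>\<rparr>)\<rparr>"

definition sset_empty :: "'s sset \<Rightarrow> bool" where
  "sset_empty X \<longleftrightarrow> (\<forall>n. simplices X n = {})"

text \<open>\<open>X\<close> is connected if it has exactly one component, i.e. if the set \<open>\<pi>\<^sub>0 X\<close> of vertices modulo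
  the equivalence relation generated by the edges is a singleton.\<close>

definition sset_edges :: "'s sset \<Rightarrow> ('s \<times> 's) set" where
  "sset_edges X = {(act X 0 1 (\<lambda>_. 0) e, act X 0 1 (\<lambda>_. 1) e) | e. e \<in> simplices X 1}"

definition sset_connected :: "'s sset \<Rightarrow> bool" where
  "sset_connected X \<longleftrightarrow> simplices X 0 \<noteq> {}
     \<and> (\<forall>x \<in> simplices X 0. \<forall>y \<in> simplices X 0. (x, y) \<in> (sset_edges X \<union> (sset_edges X)\<inverse>)\<^sup>*)"

definition fibering_reedy_functor ::
  "('o1, 'a1, 'y) reedy_scheme \<Rightarrow> ('o2, 'a2, 'z) reedy_scheme \<Rightarrow> ('o1, 'a1, 'o2, 'a2) func \<Rightarrow> bool" where
  "fibering_reedy_functor C D G \<longleftrightarrow> reedy_functor C D G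
     \<and> (\<forall>a \<in> Obj C. \<forall>b \<in> Obj D. \<forall>s \<in> Inverse D. Dom D s = fobj G a \<and> Cod D s = b \<longrightarrow>
          sset_empty (nerve (fact_cat C D G a s)) \<or> sset_connected (nerve (fact_cat C D G a s)))"


section \<open>The Reedy model structure\<close>

definition latching_cat :: "('o, 'a, 'z) reedy_scheme \<Rightarrow> 'o \<Rightarrow> ('a, 'a \<times> 'a \<times> 'a) cat" where
  "latching_cat C a = full_subcat (over_cat (wide_subcat C (Direct C)) a) (- {Ident C a})"

definition latching_diagram ::
  "('o, 'a, 'z) reedy_scheme \<Rightarrow> ('o, 'a, 'o2, 'a2) func
     \<Rightarrow> ('a, 'a \<times> 'a \<times> 'a, 'o2, 'a2) func" where
  "latching_diagram C X = \<lparr>fobj = (\<lambda>f. fobj X (Dom C f)), farr = (\<lambda>(f, h, g). farr X h)\<rparr>"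

definition matching_cat :: "('o, 'a, 'z) reedy_scheme \<Rightarrow> 'o \<Rightarrow> ('a, 'a \<times> 'a \<times> 'a) cat" where
  "matching_cat C a = full_subcat (under_cat (wide_subcat C (Inverse C)) a) (- {Ident C a})"

definition matching_diagram ::
  "('o, 'a, 'z) reedy_scheme \<Rightarrow> ('o, 'a, 'o2, 'a2) func
     \<Rightarrow> ('a, 'a \<times> 'a \<times> 'a, 'o2, 'a2) func" where
  "matching_diagram C X = \<lparr>fobj = (\<lambda>f. fobj X (Cod C f)), farr = (\<lambda>(f, h, g). farr X h)\<rparr>"

definition is_latching_object ::
  "('o, 'a, 'y) reedy_scheme \<Rightarrow> ('o2, 'a2, 'z) cat_scheme \<Rightarrow> ('o, 'a, 'o2, 'a2) func
     \<Rightarrow> 'o \<Rightarrow> 'o2 \<Rightarrow> ('a \<Rightarrow> 'a2) \<Rightarrow> bool" where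
  "is_latching_object C M X a L \<iota> \<longleftrightarrow> is_colimit (latching_cat C a) M (latching_diagram C X) L \<iota>"

definition is_matching_object ::
  "('o, 'a, 'y) reedy_scheme \<Rightarrow> ('o2, 'a2, 'z) cat_scheme \<Rightarrow> ('o, 'a, 'o2, 'a2) func
     \<Rightarrow> 'o \<Rightarrow> 'o2 \<Rightarrow> ('a \<Rightarrow> 'a2) \<Rightarrow> bool" where
  "is_matching_object C M X a L \<pi> \<longleftrightarrow> is_limit (matching_cat C a) M (matching_diagram C X) L \<pi>"

text \<open>The canonical maps \<open>L\<^sub>aX \<rightarrow> X\<^sub>a\<close> and \<open>X\<^sub>a \<rightarrow> M\<^sub>aX\<close>.\<close>

definition is_latching_map ::
  "('o, 'a, 'y) reedy_scheme \<Rightarrow> ('o2, 'a2, 'z) cat_scheme \<Rightarrow> ('o, 'a, 'o2, 'a2) func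
     \<Rightarrow> 'o \<Rightarrow> 'o2 \<Rightarrow> ('a \<Rightarrow> 'a2) \<Rightarrow> 'a2 \<Rightarrow> bool" where
  "is_latching_map C M X a L \<iota> l \<longleftrightarrow> l \<in> Hom M L (fobj X a)
     \<and> (\<forall>f \<in> Obj (latching_cat C a). l \<cdot>\<^bsub>M\<^esub> \<iota> f = farr X f)"

definition is_matching_map ::
  "('o, 'a, 'y) reedy_scheme \<Rightarrow> ('o2, 'a2, 'z) cat_scheme \<Rightarrow> ('o, 'a, 'o2, 'a2) func
     \<Rightarrow> 'o \<Rightarrow> 'o2 \<Rightarrow> ('a \<Rightarrow> 'a2) \<Rightarrow> 'a2 \<Rightarrow> bool" where
  "is_matching_map C M X a L \<pi> m \<longleftrightarrow> m \<in> Hom M (fobj X a) L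
     \<and> (\<forall>f \<in> Obj (matching_cat C a). \<pi> f \<cdot>\<^bsub>M\<^esub> m = farr X f)"

text \<open>For \<open>t : X \<rightarrow> Y\<close>, \<open>r\<close> is a relative latching map of \<open>t\<close> at \<open>a\<close>, for some choice of the
  latching objects \<open>LX\<close>, \<open>LY\<close> and of the pushout with legs \<open>i : X\<^sub>a \<rightarrow> P\<close>, \<open>j : LY \<rightarrow> P\<close>; here
  \<open>k : LX \<rightarrow> LY\<close> is induced by \<open>t\<close>.  The relative latching map is thus determined up to
  isomorphism.\<close>

definition is_relative_latching_map ::
  "('o, 'a, 'y) reedy_scheme \<Rightarrow> ('o2, 'a2, 'z) cat_scheme \<Rightarrow> ('o, 'a, 'o2, 'a2) ntrans
     \<Rightarrow> 'o \<Rightarrow> 'a2 \<Rightarrow> bool" where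
  "is_relative_latching_map C M t a r \<longleftrightarrow>
     (\<exists>LX \<iota>X lX LY \<iota>Y lY k i j.
        is_latching_object C M (nsrc t) a LX \<iota>X \<and> is_latching_map C M (nsrc t) a LX \<iota>X lX
      \<and> is_latching_object C M (ntgt t) a LY \<iota>Y \<and> is_latching_map C M (ntgt t) a LY \<iota>Y lY
      \<and> k \<in> Hom M LX LY
      \<and> (\<forall>f \<in> Obj (latching_cat C a). k \<cdot>\<^bsub>M\<^esub> \<iota>X f = \<iota>Y f \<cdot>\<^bsub>M\<^esub> nat_at t (Dom C f))
      \<and> is_pushout M lX k i j
      \<and> r \<in> Hom M (Cod M i) (fobj (ntgt t) a)
      \<and> r \<cdot>\<^bsub>M\<^esub> i = nat_at t a \<and> r \<cdot>\<^bsub>M\<^esub> j = lY)"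

text \<open>Dually, with pullback legs \<open>p : P \<rightarrow> Y\<^sub>a\<close> and \<open>q : P \<rightarrow> MX\<close>.\<close>

definition is_relative_matching_map ::
  "('o, 'a, 'y) reedy_scheme \<Rightarrow> ('o2, 'a2, 'z) cat_scheme \<Rightarrow> ('o, 'a, 'o2, 'a2) ntrans
     \<Rightarrow> 'o \<Rightarrow> 'a2 \<Rightarrow> bool" where
  "is_relative_matching_map C M t a r \<longleftrightarrow>
     (\<exists>MX \<pi>X mX MY \<pi>Y mY k p q.
        is_matching_object C M (nsrc t) a MX \<pi>X \<and> is_matching_map C M (nsrc t) a MX \<pi>X mX
      \<and> is_matching_object C M (ntgt t) a MY \<pi>Y \<and> is_matching_map C M (ntgt t) a MY \<pi>Y mY
      \<and> k \<in> Hom M MX MY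
      \<and> (\<forall>f \<in> Obj (matching_cat C a). \<pi>Y f \<cdot>\<^bsub>M\<^esub> k = nat_at t (Cod C f) \<cdot>\<^bsub>M\<^esub> \<pi>X f)
      \<and> is_pullback M mY k p q
      \<and> r \<in> Hom M (fobj (nsrc t) a) (Dom M p)
      \<and> p \<cdot>\<^bsub>M\<^esub> r = nat_at t a \<and> q \<cdot>\<^bsub>M\<^esub> r = mX)"

definition reedy_model_structure ::
  "('o, 'a, 'y) reedy_scheme \<Rightarrow> ('o2, 'a2, 'z) model_cat_scheme
     \<Rightarrow> (('o, 'a, 'o2, 'a2) func, ('o, 'a, 'o2, 'a2) ntrans) model_cat" where
  "reedy_model_structure C M = cat.extend (functor_category C M)
     (model_cat.fields
        {t \<in> nat_transformations C M. \<forall>a \<in> Obj C. nat_at t a \<in> Weq M}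
        {t \<in> nat_transformations C M. \<forall>a \<in> Obj C. \<exists>r \<in> Cof M. is_relative_latching_map C M t a r}
        {t \<in> nat_transformations C M. \<forall>a \<in> Obj C. \<exists>r \<in> Fib M. is_relative_matching_map C M t a r})"

end

theory Submission
  imports Defs
begin

text \<open>Fibrations are the maps with the right lifting property against trivial cofibrations.  Unfolding pullbacks and
  limits turns the condition that \<open>t : X \<rightarrow> Y\<close> is a Reedy fibration into an elementary one
  (\<open>reedy_fibration_iff\<close>): for every trivial cofibration \<open>i : A \<rightarrow> B\<close> and every object \<open>a\<close>, a map \<open>u : A \<rightarrow> X a\<close>, a map
  \<open>v : B \<rightarrow> Y a\<close> and a cone \<open>w\<close> from \<open>B\<close> to the values of \<open>X\<close> on the matching category of \<open>a\<close>, if compatible, come from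
  one map \<open>B \<rightarrow> X a\<close>.

  Let \<open>G\<close> be fibering, and let such a problem be given for the restriction of \<open>t : X \<rightarrow> Y\<close> along \<open>G\<close> at an object \<open>a\<close> of
  \<open>C\<close>.  The cone \<open>w\<close> is indexed by the non-identity inverse arrows \<open>\<nu>\<close> out of \<open>a\<close>.  It prescribes a map \<open>B \<rightarrow> X (cod s)\<close>
  for each inverse arrow \<open>s\<close> out of \<open>G a\<close> with a factorization \<open>s = \<mu> \<cdot> G \<nu>\<close>, namely \<open>X \<mu> \<cdot> w \<nu>\<close>, and connectedness of
  the category of factorizations of \<open>s\<close> is what makes this independent of the factorization
  (\<open>matching_cone_extension\<close>).  For the remaining inverse arrows \<open>s\<close> out of \<open>G a\<close> a map \<open>B \<rightarrow> X (cod s)\<close> is chosen by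
  induction on the degree of \<open>cod s\<close>, by the lifting property of \<open>t\<close> at \<open>cod s\<close>; the identity of \<open>G a\<close> comes last, and the
  map obtained there is the required lift (\<open>precomposition_matching_lifts\<close>).  Weak equivalences are defined objectwise,
  hence preserved, and the left adjoint is the left Kan extension (\<open>precomposition_has_left_adjoint\<close>).

  For the converse one model category suffices: sets, with injections as cofibrations, surjections as fibrations, and all
  maps as weak equivalences.  The diagram \<open>d \<mapsto> Pow (Hom(d, b))\<close> is Reedy fibrant (\<open>subset_diagram_lifts\<close>).  If the
  category of factorizations of \<open>s : G a \<rightarrow> b\<close> has several components, one component \<open>P\<close> defines a point of the matching
  object of the restricted diagram at \<open>a\<close>, the family of sets \<open>{\<mu>. (\<nu>, \<mu>) \<in> P}\<close>.  It is not in the image of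
  \<open>Pow (Hom(G a, b))\<close>, because a set of arrows \<open>G a \<rightarrow> b\<close> cannot distinguish between two factorizations of \<open>s\<close>
  (\<open>right_quillen_imp_fibering\<close>).\<close>


section \<open>Arrows, functors and natural transformations\<close>

lemma Hom_iff: "f \<in> Hom C a b \<longleftrightarrow> f \<in> Arr C \<and> Dom C f = a \<and> Cod C f = b"
  by (simp add: Hom_def)

lemma HomD:
  assumes "f \<in> Hom C a b"
  shows "f \<in> Arr C" "Dom C f = a" "Cod C f = b"
  using assms by (simp_all add: Hom_iff)

lemma Arr_Hom: "f \<in> Arr C \<Longrightarrow> f \<in> Hom C (Dom C f) (Cod C f)"
  by (simp add: Hom_iff)

context category
begin

lemma Hom_Obj:
  assumes "f \<in> Hom C a b"
  shows "a \<in> Obj C" "b \<in> Obj C"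
  using assms Dom_Obj Cod_Obj by (auto simp: Hom_iff)

lemma Comp_Arr:
  assumes "f \<in> Arr C" "g \<in> Arr C" "Dom C g = Cod C f"
  shows "g \<cdot> f \<in> Arr C" "Dom C (g \<cdot> f) = Dom C f" "Cod C (g \<cdot> f) = Cod C g"
  using Comp_Hom[of f "Dom C f" "Cod C f" g "Cod C g"] assms by (auto simp: Hom_iff)

lemma Ident_Arr:
  assumes "a \<in> Obj C"
  shows "Ident C a \<in> Arr C" "Dom C (Ident C a) = a" "Cod C (Ident C a) = a"
  using Ident_Hom[OF assms] by (auto simp: Hom_iff)

lemma Comp_Arr_assoc:
  assumes "f \<in> Arr C" "g \<in> Arr C" "h \<in> Arr C" "Dom C g = Cod C f" "Dom C h = Cod C g"
  shows "h \<cdot> (g \<cdot> f) = (h \<cdot> g) \<cdot> f"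
  using Comp_assoc[of f _ _ g _ h] assms by (auto simp: Hom_iff)

lemma Comp_Arr_Ident:
  assumes "f \<in> Arr C"
  shows "f \<cdot> Ident C (Dom C f) = f" "Ident C (Cod C f) \<cdot> f = f"
  using Comp_Ident_left Comp_Ident_right assms by (auto simp: Hom_iff)

end

text \<open>The categories of arrows under or over objects that occur below have triples \<open>(x, f, y)\<close> as
  arrows, where \<open>f\<close> is an arrow of \<open>C\<close> between the objects underlying \<open>x\<close> and \<open>y\<close>; the category laws are
  inherited from \<open>C\<close>.\<close>

lemma category_of_triples:
  fixes K :: "('x, 'x \<times> 'a \<times> 'x) cat"
  assumes "category C"
    and K: "Dom K = (\<lambda>(x, f, y). x)" "Cod K = (\<lambda>(x, f, y). y)" "Ident K = (\<lambda>x. (x, Ident C (ob x), x))"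
      "Comp K = (\<lambda>(x', f', y') (x, f, y). (x, f' \<cdot>\<^bsub>C\<^esub> f, y'))"
    and arr: "\<And>x f y. (x, f, y) \<in> Arr K \<Longrightarrow> x \<in> Obj K \<and> y \<in> Obj K \<and> f \<in> Hom C (ob x) (ob y)"
    and id: "\<And>x. x \<in> Obj K \<Longrightarrow> (x, Ident C (ob x), x) \<in> Arr K"
    and comp: "\<And>x f y g z. (x, f, y) \<in> Arr K \<Longrightarrow> (y, g, z) \<in> Arr K \<Longrightarrow> (x, g \<cdot>\<^bsub>C\<^esub> f, z) \<in> Arr K"
  shows "category K"
proof -
  interpret C: category C by fact
  have K_Hom: "\<exists>h. k = (x, h, y) \<and> k \<in> Arr K \<and> h \<in> Hom C (ob x) (ob y)" if "k \<in> Hom K x y" for k x y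
    using that arr by (cases k) (auto simp: Hom_iff[of _ K] K(1,2))
  show ?thesis
  proof
    show "Dom K k \<in> Obj K" "Cod K k \<in> Obj K" if "k \<in> Arr K" for k
      using that arr by (cases k; auto simp: K(1,2))+
    show "Ident K x \<in> Hom K x x" if "x \<in> Obj K" for x
      using id[OF that] by (simp add: Hom_iff[of _ K] K(1-3))
    show "Comp K l k \<in> Hom K x z" if "k \<in> Hom K x y" "l \<in> Hom K y z" for k l x y z
      using K_Hom[OF that(1)] K_Hom[OF that(2)] comp by (auto simp: Hom_iff[of _ K] K(1,2,4))
    show "Comp K k (Ident K x) = k" if "k \<in> Hom K x y" for k x y
      using K_Hom[OF that] C.Comp_Ident_right by (auto simp: K(3,4))
    show "Comp K (Ident K y) k = k" if "k \<in> Hom K x y" for k x y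
      using K_Hom[OF that] C.Comp_Ident_left by (auto simp: K(3,4))
    show "Comp K m (Comp K l k) = Comp K (Comp K m l) k"
      if "k \<in> Hom K x y" "l \<in> Hom K y z" "m \<in> Hom K z w" for k l m x y z w
      using K_Hom[OF that(1)] K_Hom[OF that(2)] K_Hom[OF that(3)] C.Comp_assoc by (auto simp: K(4))
  qed
qed

lemma functor_maps:
  assumes "is_functor A B F"
  shows "category A" "category B"
    and "a \<in> Obj A \<Longrightarrow> fobj F a \<in> Obj B"
    and "f \<in> Hom A a b \<Longrightarrow> farr F f \<in> Hom B (fobj F a) (fobj F b)"
    and "f \<in> Arr A \<Longrightarrow> farr F f \<in> Hom B (fobj F (Dom A f)) (fobj F (Cod A f))"
    and "a \<in> Obj A \<Longrightarrow> farr F (Ident A a) = Ident B (fobj F a)"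
    and "f \<in> Hom A a b \<Longrightarrow> g \<in> Hom A b c \<Longrightarrow> farr F (g \<cdot>\<^bsub>A\<^esub> f) = farr F g \<cdot>\<^bsub>B\<^esub> farr F f"
  using assms by (auto simp: is_functor_def Hom_iff)

lemma functors_functor: "F \<in> functors A B \<Longrightarrow> is_functor A B F"
  by (simp add: functors_def)

lemma func_eqI:
  assumes "F \<in> functors A B" "F' \<in> functors A B"
    and "\<And>a. a \<in> Obj A \<Longrightarrow> fobj F a = fobj F' a"
    and "\<And>f. f \<in> Arr A \<Longrightarrow> farr F f = farr F' f"
  shows "F = F'"
proof -
  have "fobj F = fobj F'" "farr F = farr F'"
    using assms by (auto simp: functors_def intro!: extensionalityI)
  then show ?thesis by simp
qed

lemma nat_transformationsD:
  assumes "t \<in> nat_transformations A B"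
  shows "nsrc t \<in> functors A B" "ntgt t \<in> functors A B"
    and "a \<in> Obj A \<Longrightarrow> nat_at t a \<in> Hom B (fobj (nsrc t) a) (fobj (ntgt t) a)"
    and "f \<in> Hom A a b \<Longrightarrow>
      nat_at t b \<cdot>\<^bsub>B\<^esub> farr (nsrc t) f = farr (ntgt t) f \<cdot>\<^bsub>B\<^esub> nat_at t a"
  using assms by (auto simp: nat_transformations_def Hom_iff)

lemma ntrans_eqI:
  assumes "t \<in> nat_transformations A B" "t' \<in> nat_transformations A B"
    and "nsrc t = nsrc t'" "ntgt t = ntgt t'"
    and "\<And>a. a \<in> Obj A \<Longrightarrow> nat_at t a = nat_at t' a"
  shows "t = t'"
proof -
  have "nat_at t = nat_at t'"
    using assms by (auto simp: nat_transformations_def intro!: extensionalityI)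
  then show ?thesis using assms by simp
qed

lemma comp_func_functors:
  assumes G: "is_functor A B G" and F: "is_functor B E F"
  shows "comp_func A F G \<in> functors A E"
proof -
  interpret A: category A using G by (rule functor_maps)
  show ?thesis
    using G F unfolding functors_def is_functor_def comp_func_def
    by (auto simp: A.Dom_Obj A.Cod_Obj A.Ident_Arr A.Comp_Arr Hom_iff)
qed

lemma functor_category_simps [simp]:
  "Obj (functor_category A B) = functors A B"
  "Arr (functor_category A B) = nat_transformations A B"
  "Dom (functor_category A B) = nsrc"
  "Cod (functor_category A B) = ntgt"
  "Ident (functor_category A B) F =
     \<lparr>nsrc = F, ntgt = F, nat_at = restrict (\<lambda>a. Ident B (fobj F a)) (Obj A)\<rparr>"
  "Comp (functor_category A B) t s = \<lparr>nsrc = nsrc s, ntgt = ntgt t,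
                     nat_at = restrict (\<lambda>a. nat_at t a \<cdot>\<^bsub>B\<^esub> nat_at s a) (Obj A)\<rparr>"
  by (simp_all add: functor_category_def)

lemma category_functor_category:
  fixes B (structure)
  assumes "category A" "category B"
  shows "category (functor_category A B)"
proof -
  interpret A: category A by fact
  interpret B: category B by fact
  have id: "Ident (functor_category A B) F \<in> nat_transformations A B" if F: "F \<in> functors A B" for F
  proof -
    note f = functor_maps[OF functors_functor[OF F]]
    show ?thesis
      using F f(3) B.Comp_Ident_left[OF f(5)] B.Comp_Ident_right[OF f(5)]
      by (auto simp: nat_transformations_def B.Ident_Hom A.Dom_Obj A.Cod_Obj)
  qed
  have comp: "Comp (functor_category A B) t s \<in> nat_transformations A B"
    if s: "s \<in> nat_transformations A B" and t: "t \<in> nat_transformations A B" and st: "nsrc t = ntgt s"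
    for s t
  proof -
    note S = nat_transformationsD[OF s] and T = nat_transformationsD[OF t, unfolded st]
    have "nat_at t (Cod A f) \<cdot> nat_at s (Cod A f) \<cdot> farr (nsrc s) f
        = farr (ntgt t) f \<cdot> (nat_at t (Dom A f) \<cdot> nat_at s (Dom A f))" if f: "f \<in> Arr A" for f
    proof -
      let ?a = "Dom A f" and ?b = "Cod A f"
      have ob: "?a \<in> Obj A" "?b \<in> Obj A" using f A.Dom_Obj A.Cod_Obj by auto
      note h = functor_maps(5)[OF functors_functor[OF S(1)] f] functor_maps(5)[OF functors_functor[OF S(2)] f]
        functor_maps(5)[OF functors_functor[OF T(2)] f] S(3)[OF ob(1)] S(3)[OF ob(2)] T(3)[OF ob(1)] T(3)[OF ob(2)]
      have "nat_at t ?b \<cdot> nat_at s ?b \<cdot> farr (nsrc s) f = nat_at t ?b \<cdot> (nat_at s ?b \<cdot> farr (nsrc s) f)"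
        using B.Comp_assoc h by metis
      also have "\<dots> = nat_at t ?b \<cdot> (farr (ntgt s) f \<cdot> nat_at s ?a)"
        using S(4)[OF Arr_Hom[OF f]] by simp
      also have "\<dots> = nat_at t ?b \<cdot> farr (ntgt s) f \<cdot> nat_at s ?a"
        using B.Comp_assoc h by metis
      also have "\<dots> = farr (ntgt t) f \<cdot> nat_at t ?a \<cdot> nat_at s ?a"
        using T(4)[OF Arr_Hom[OF f]] by simp
      also have "\<dots> = farr (ntgt t) f \<cdot> (nat_at t ?a \<cdot> nat_at s ?a)"
        using B.Comp_assoc h by metis
      finally show ?thesis .
    qed
    then show ?thesis
      using S T B.Comp_Hom[OF S(3) T(3)] by (simp add: nat_transformations_def A.Dom_Obj A.Cod_Obj)
  qed
  show ?thesis
  proof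
    show "f \<in> Arr (functor_category A B) \<Longrightarrow> Dom (functor_category A B) f \<in> Obj (functor_category A B)" for f
      by (simp add: nat_transformationsD)
    show "f \<in> Arr (functor_category A B) \<Longrightarrow> Cod (functor_category A B) f \<in> Obj (functor_category A B)" for f
      by (simp add: nat_transformationsD)
    show "a \<in> Obj (functor_category A B) \<Longrightarrow> Ident (functor_category A B) a \<in> Hom (functor_category A B) a a" for a
      using id by (simp add: Hom_iff)
    show "f \<in> Hom (functor_category A B) a b \<Longrightarrow> g \<in> Hom (functor_category A B) b c
       \<Longrightarrow> Comp (functor_category A B) g f \<in> Hom (functor_category A B) a c" for f g a b c
      using comp[of f g] by (simp add: Hom_iff)
    show "Comp (functor_category A B) f (Ident (functor_category A B) a) = f"
      if f: "f \<in> Hom (functor_category A B) a b" for f a b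
    proof (rule ntrans_eqI[of _ A B])
      show "Comp (functor_category A B) f (Ident (functor_category A B) a) \<in> nat_transformations A B"
        using f by (intro comp id) (auto simp: Hom_iff nat_transformationsD)
    qed (use f in \<open>auto simp: Hom_iff nat_transformationsD intro!: B.Comp_Ident_right nat_transformationsD(3)\<close>)
    show "Comp (functor_category A B) (Ident (functor_category A B) b) f = f"
      if f: "f \<in> Hom (functor_category A B) a b" for f a b
    proof (rule ntrans_eqI[of _ A B])
      show "Comp (functor_category A B) (Ident (functor_category A B) b) f \<in> nat_transformations A B"
        using f by (intro comp id) (auto simp: Hom_iff nat_transformationsD)
    qed (use f in \<open>auto simp: Hom_iff nat_transformationsD intro!: B.Comp_Ident_left nat_transformationsD(3)\<close>)
    show "Comp (functor_category A B) h (Comp (functor_category A B) g f)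
        = Comp (functor_category A B) (Comp (functor_category A B) h g) f"
      if f: "f \<in> Hom (functor_category A B) a b" and g: "g \<in> Hom (functor_category A B) b c"
        and h: "h \<in> Hom (functor_category A B) c d" for f g h a b c d
    proof -
      have "nat_at h x \<cdot> (nat_at g x \<cdot> nat_at f x) = nat_at h x \<cdot> nat_at g x \<cdot> nat_at f x"
        if "x \<in> Obj A" for x
      proof (rule B.Comp_assoc)
        show "nat_at f x \<in> Hom B (fobj a x) (fobj b x)" "nat_at g x \<in> Hom B (fobj b x) (fobj c x)"
          "nat_at h x \<in> Hom B (fobj c x) (fobj d x)"
          using HomD[OF f] HomD[OF g] HomD[OF h] nat_transformationsD(3)[OF _ that] by fastforce+
      qed
      then show ?thesis by (auto simp: fun_eq_iff)
    qed
  qed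
qed

section \<open>Small limits and colimits\<close>

lemma infinite_pairing:
  assumes "infinite (UNIV :: 'u set)"
  obtains p :: "'u \<times> 'u \<Rightarrow> 'u" where "inj p"
proof -
  have "\<exists>p. bij_betw p (UNIV \<times> UNIV :: ('u \<times> 'u) set) (UNIV :: 'u set)"
    unfolding card_of_ordIso using card_of_Times_same_infinite[OF assms] .
  then obtain p :: "'u \<times> 'u \<Rightarrow> 'u" where "bij_betw p (UNIV \<times> UNIV) UNIV" ..
  then have "inj p" by (simp add: bij_betw_def)
  then show thesis by (rule that)
qed

definition op_cat :: "('o, 'a, 'z) cat_scheme \<Rightarrow> ('o, 'a) cat" where
  "op_cat C = \<lparr>Obj = Obj C, Arr = Arr C, Dom = Cod C, Cod = Dom C, Ident = Ident C,
               Comp = (\<lambda>g f. f \<cdot>\<^bsub>C\<^esub> g)\<rparr>"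

lemma op_cat_simps [simp]:
  "Obj (op_cat C) = Obj C" "Arr (op_cat C) = Arr C" "Dom (op_cat C) = Cod C" "Cod (op_cat C) = Dom C"
  "Ident (op_cat C) = Ident C" "Comp (op_cat C) g f = f \<cdot>\<^bsub>C\<^esub> g"
  "Hom (op_cat C) a b = Hom C b a"
  by (auto simp: op_cat_def Hom_def)

lemma op_op_cat: "op_cat (op_cat C) = (C :: ('o, 'a) cat)"
  by (simp add: op_cat_def)

lemma category_op_cat:
  assumes "category C" shows "category (op_cat C)"
proof -
  interpret category C by fact
  show ?thesis
    by unfold_locales (auto simp: Dom_Obj Cod_Obj Ident_Hom Comp_Ident_left Comp_Ident_right
        Comp_assoc intro: Comp_Hom)
qed

lemma is_functor_op_cat: "is_functor A B F \<Longrightarrow> is_functor (op_cat A) (op_cat B) F"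
  unfolding is_functor_def by (auto simp: category_op_cat)

lemma is_functor_op_cat': "is_functor J (op_cat M) F \<Longrightarrow> category M \<Longrightarrow> is_functor (op_cat J) M F"
  unfolding is_functor_def by (auto simp: category_op_cat)

lemma is_limit_op_cat: "is_limit (op_cat J) (op_cat M) F L p \<longleftrightarrow> is_colimit J M F L p"
  by (simp add: is_limit_def is_colimit_def is_cone_def is_cocone_def)

text \<open>Replacing a small category by an isomorphic one whose objects and arrows are
  elements of the universe: an arrow is encoded by \<open>e\<close>, and an object by the code of its identity.\<close>

lemma small_limit_exists:
  fixes J :: "('oj, 'aj, 'z) cat_scheme"
  assumes lim: "has_small_limits TYPE('u) M"
    and small: "small_category TYPE('u) J" and F: "is_functor J M F"
  shows "\<exists>L p. is_limit J M F L p"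
proof -
  obtain e :: "'aj \<Rightarrow> 'u" where e: "inj_on e (Arr J)" and "category J"
    using small unfolding small_category_def by blast
  interpret category J by fact
  define d where "d = inv_into (Arr J) e"
  define i where "i a = e (Ident J a)" for a
  have d [simp]: "d (e f) = f" if "f \<in> Arr J" for f
    using e that by (simp add: d_def)
  have di [simp]: "d (i a) = Ident J a" if "a \<in> Obj J" for a
    using Ident_Arr[OF that] by (simp add: i_def)
  have ii: "i a = i b \<longleftrightarrow> a = b" if "a \<in> Obj J" "b \<in> Obj J" for a b
    using that di Ident_Arr by metis
  define J' where "J' = \<lparr>Obj = i ` Obj J, Arr = e ` Arr J, Dom = (\<lambda>x. i (Dom J (d x))),
    Cod = (\<lambda>x. i (Cod J (d x))), Ident = (\<lambda>x. x), Comp = (\<lambda>x y. e (d x \<cdot>\<^bsub>J\<^esub> d y))\<rparr>"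
  define F' where "F' = \<lparr>fobj = (\<lambda>x. fobj F (Dom J (d x))), farr = (\<lambda>x. farr F (d x))\<rparr>"
  note J = Dom_Obj Cod_Obj Ident_Arr Comp_Arr Comp_Arr_Ident ii
  have "i a \<in> e ` Arr J" if "a \<in> Obj J" for a
    using Ident_Arr[OF that] by (simp add: i_def)
  then have "category J'"
    by unfold_locales (auto simp: J'_def Hom_iff J Comp_Arr_assoc i_def[symmetric] intro!: imageI)
  then have F': "is_functor J' M F'"
    using F by (auto simp: is_functor_def J'_def F'_def J)
  have cone: "is_cone J' M F' L p \<longleftrightarrow> is_cone J M F L (p \<circ> i)" for L p
    by (auto simp: is_cone_def J'_def F'_def J)
  obtain L p where lim': "is_limit J' M F' L p"
    using lim F' unfolding has_small_limits_def by blast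
  have "is_limit J M F L (p \<circ> i)"
    unfolding is_limit_def
  proof (intro conjI allI impI)
    show "is_cone J M F L (p \<circ> i)" using lim' cone by (simp add: is_limit_def)
    fix K q assume q: "is_cone J M F K q"
    have "is_cone J M F K ((\<lambda>x. q (Dom J (d x))) \<circ> i)"
      using q by (auto simp: is_cone_def J)
    with lim' have "\<exists>!u. u \<in> Hom M K L \<and> (\<forall>j\<in>Obj J'. p j \<cdot>\<^bsub>M\<^esub> u = q (Dom J (d j)))"
      unfolding cone[symmetric] is_limit_def by blast
    then show "\<exists>!u. u \<in> Hom M K L \<and> (\<forall>j\<in>Obj J. (p \<circ> i) j \<cdot>\<^bsub>M\<^esub> u = q j)"
      by (simp add: J'_def J cong: ball_cong)
  qed
  then show ?thesis by blast
qed

lemma small_colimit_exists: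
  assumes colim: "has_small_colimits TYPE('u) M"
    and small: "small_category TYPE('u) J" and F: "is_functor J M F"
  shows "\<exists>L p. is_colimit J M F L p"
proof -
  have M: "category M" using F by (rule functor_maps)
  have "has_small_limits TYPE('u) (op_cat M)"
    unfolding has_small_limits_def
  proof (intro allI impI)
    fix K :: "('u, 'u) cat" and F assume "is_functor K (op_cat M) F"
    then obtain L p where "is_colimit (op_cat K) M F L p"
      using colim M is_functor_op_cat' unfolding has_small_colimits_def by blast
    then show "\<exists>L p. is_limit K (op_cat M) F L p"
      using is_limit_op_cat[of "op_cat K" M] by (auto simp: op_op_cat)
  qed
  moreover have "small_category TYPE('u) (op_cat J)"
    using small category_op_cat by (auto simp: small_category_def)
  ultimately show ?thesis
    using small_limit_exists is_functor_op_cat[OF F] is_limit_op_cat by metis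
qed

lemma ex1_implies_eq: "\<exists>!w. P w \<Longrightarrow> P u \<Longrightarrow> P u' \<Longrightarrow> u = u'"
  by blast

lemma limit_map_exists:
  assumes "is_limit J M F L p" "is_cone J M F K q"
  shows "\<exists>u\<in>Hom M K L. \<forall>j\<in>Obj J. p j \<cdot>\<^bsub>M\<^esub> u = q j"
  using assms unfolding is_limit_def by blast

lemma cone_comp:
  fixes M (structure)
  assumes M: "category M" and J: "category J" and F: "is_functor J M F" and p: "is_cone J M F L p" and u: "u \<in> Hom M K L"
  shows "is_cone J M F K (\<lambda>j. p j \<cdot> u)"
proof -
  interpret M: category M by fact
  interpret J: category J by fact
  show ?thesis
    unfolding is_cone_def
  proof (intro conjI ballI)
    show "K \<in> Obj M" using M.Hom_Obj u by blast
    show "p j \<cdot> u \<in> Hom M K (fobj F j)" if "j \<in> Obj J" for j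
      using p that u by (auto simp: is_cone_def intro: M.Comp_Hom)
    show "farr F f \<cdot> (p (Dom J f) \<cdot> u) = p (Cod J f) \<cdot> u" if f: "f \<in> Arr J" for f
      using p f M.Comp_assoc[OF u _ functor_maps(5)[OF F f]] J.Dom_Obj[OF f]
      by (simp add: is_cone_def)
  qed
qed

lemma limit_jointly_monic:
  fixes M (structure)
  assumes M: "category M" and J: "category J" and F: "is_functor J M F" and L: "is_limit J M F L p"
    and u: "u \<in> Hom M K L" "u' \<in> Hom M K L"
    and eq: "\<And>j. j \<in> Obj J \<Longrightarrow> p j \<cdot> u = p j \<cdot> u'"
  shows "u = u'"
proof -
  have "is_cone J M F K (\<lambda>j. p j \<cdot> u)"
    using cone_comp[OF M J F _ u(1)] L by (simp add: is_limit_def)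
  with L have ex1: "\<exists>!w. w \<in> Hom M K L \<and> (\<forall>j\<in>Obj J. p j \<cdot> w = p j \<cdot> u)"
    unfolding is_limit_def by blast
  show ?thesis
    by (rule ex1_implies_eq[OF ex1]) (use u eq in simp_all)
qed

lemma colimit_map_exists:
  assumes "is_colimit J M F L p" "is_cocone J M F K q"
  shows "\<exists>u\<in>Hom M L K. \<forall>j\<in>Obj J. u \<cdot>\<^bsub>M\<^esub> p j = q j"
  using assms unfolding is_colimit_def by blast

lemma colimit_jointly_epic:
  assumes M: "category M" and J: "category J" and F: "is_functor J M F" and L: "is_colimit J M F L p"
    and u: "u \<in> Hom M L K" "u' \<in> Hom M L K"
    and eq: "\<And>j. j \<in> Obj J \<Longrightarrow> u \<cdot>\<^bsub>M\<^esub> p j = u' \<cdot>\<^bsub>M\<^esub> p j"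
  shows "u = u'"
  using limit_jointly_monic[OF category_op_cat[OF M] category_op_cat[OF J] is_functor_op_cat[OF F]
      L[folded is_limit_op_cat], of u K u'] u eq by simp

text \<open>A cospan is a diagram on the poset \<open>0 \<le> 2 \<ge> 1\<close>, and its limit is a pullback.\<close>

lemma pullback_exists:
  fixes M (structure)
  assumes inf: "infinite (UNIV :: 'u set)"
    and lim: "has_small_limits TYPE('u) M" and M: "category M"
    and f: "f \<in> Hom M a c" and g: "g \<in> Hom M b c"
  shows "\<exists>p q. is_pullback M f g p q"
proof -
  interpret M: category M by fact
  define J :: "(nat, nat \<times> nat) cat" where
    "J = \<lparr>Obj = {0, 1, 2}, Arr = {x. fst x \<in> {0, 1, 2} \<and> (snd x = fst x \<or> snd x = 2)}, Dom = fst, Cod = snd,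
          Ident = (\<lambda>i. (i, i)), Comp = (\<lambda>x y. (fst y, snd x))\<rparr>"
  define F where "F = \<lparr>fobj = (\<lambda>i::nat. if i = 0 then a else if i = 1 then b else c),
    farr = (\<lambda>x::nat \<times> nat. if x = (0,0) then Ident M a else if x = (1,1) then Ident M b
       else if x = (2,2) then Ident M c else if x = (0,2) then f else g)\<rparr>"
  note ob = M.Hom_Obj[OF f] M.Hom_Obj[OF g]
  have J: "category J"
    by unfold_locales (auto simp: J_def Hom_iff prod_eq_iff)
  have F: "is_functor J M F"
    unfolding is_functor_def
  proof (intro conjI ballI impI)
    show FHom: "farr F x \<in> Hom M (fobj F (Dom J x)) (fobj F (Cod J x))" if "x \<in> Arr J" for x
      using that f g M.Ident_Hom[OF ob(1)] M.Ident_Hom[OF ob(2)] M.Ident_Hom[OF ob(3)]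
      by (cases x) (auto simp: J_def F_def)
    show "farr F (y \<cdot>\<^bsub>J\<^esub> x) = farr F y \<cdot> farr F x"
      if "x \<in> Arr J" "y \<in> Arr J" "Dom J y = Cod J x" for x y
    proof -
      have Fid: "farr F (i, i) = Ident M (fobj F i)" if "i \<in> {0, 1, 2}" for i
        using that by (auto simp: F_def)
      show ?thesis
      proof (cases "fst x = snd x")
        case True
        then have "x = (fst y, fst y)" "y \<cdot>\<^bsub>J\<^esub> x = y" "fst y \<in> {0, 1, 2}"
          using that by (auto simp: J_def prod_eq_iff)
        then show ?thesis
          using M.Comp_Ident_right[OF FHom[OF that(2)]] Fid[of "fst y"] by (simp add: J_def)
      next
        case False
        then have "y = (snd x, snd x)" "y \<cdot>\<^bsub>J\<^esub> x = x" "snd x \<in> {0, 1, 2}"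
          using that by (auto simp: J_def prod_eq_iff)
        then show ?thesis
          using M.Comp_Ident_left[OF FHom[OF that(1)]] Fid[of "snd x"] by (simp add: J_def)
      qed
    qed
  qed (use J M ob in \<open>auto simp: J_def F_def\<close>)
  obtain h :: "nat \<Rightarrow> 'u" where "inj h"
    using inf infinite_countable_subset by blast
  moreover have "inj_on (\<lambda>x. 3 * fst x + snd x) (Arr J)"
    by (auto simp: inj_on_def J_def)
  ultimately have "inj_on (h \<circ> (\<lambda>x. 3 * fst x + snd x)) (Arr J)"
    by (intro comp_inj_on) (auto intro: inj_on_subset)
  then have small: "small_category TYPE('u) J"
    using J by (auto simp: small_category_def)
  obtain L p where L: "is_limit J M F L p"
    using small_limit_exists[OF lim small F] by blast
  have cone: "is_cone J M F K q \<longleftrightarrow> K \<in> Obj M \<and> q 0 \<in> Hom M K a \<and> q 1 \<in> Hom M K b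
    \<and> f \<cdot> q 0 = q 2 \<and> g \<cdot> q 1 = q 2" (is "?l \<longleftrightarrow> ?r")
    for K and q :: "nat \<Rightarrow> 'b"
  proof
    assume l: ?l
    have "(0, 2) \<in> Arr J" "(1, 2) \<in> Arr J" by (auto simp: J_def)
    with l have "farr F (0, 2) \<cdot> q 0 = q 2" "farr F (1, 2) \<cdot> q 1 = q 2"
      by (auto simp: is_cone_def J_def)
    moreover have "farr F (0, 2) = f" "farr F (1, 2) = g" by (simp_all add: F_def)
    ultimately show ?r
      using l by (simp add: is_cone_def J_def F_def)
  next
    assume r: ?r
    then have "q 2 \<in> Hom M K c" using M.Comp_Hom[OF _ f, of "q 0" K] by simp
    then show ?l using r M.Comp_Ident_left by (force simp: is_cone_def J_def F_def)
  qed
  have "is_cone J M F L p" using L by (simp add: is_limit_def)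
  then have p: "L \<in> Obj M" "p 0 \<in> Hom M L a" "p 1 \<in> Hom M L b"
     "f \<cdot> p 0 = p 2" "g \<cdot> p 1 = p 2"
    unfolding cone by auto
  have "\<exists>!w. w \<in> Hom M K L \<and> p 0 \<cdot> w = u \<and> p 1 \<cdot> w = v"
    if u: "u \<in> Hom M K a" and v: "v \<in> Hom M K b" and uv: "f \<cdot> u = g \<cdot> v" for K u v
  proof -
    define q where "q i = (if i = 0 then u else if i = (1::nat) then v else f \<cdot> u)" for i
    have "is_cone J M F K q"
      unfolding cone using u v uv M.Hom_Obj by (auto simp: q_def)
    with L have "\<exists>!w. w \<in> Hom M K L \<and> (\<forall>j\<in>Obj J. p j \<cdot> w = q j)"
      unfolding is_limit_def by blast
    moreover have "(\<forall>j\<in>Obj J. p j \<cdot> w = q j) \<longleftrightarrow> p 0 \<cdot> w = u \<and> p 1 \<cdot> w = v"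
      if w: "w \<in> Hom M K L" for w
    proof -
      have "p 2 \<cdot> w = f \<cdot> (p 0 \<cdot> w)"
        using p M.Comp_assoc[OF w p(2) f] by simp
      then show ?thesis by (auto simp: J_def q_def)
    qed
    ultimately show ?thesis by (simp cong: conj_cong)
  qed
  then have "is_pullback M f g (p 0) (p 1)"
    using p(4,5) HomD[OF p(2)] HomD[OF p(3)] HomD[OF f] HomD[OF g]
    by (simp add: is_pullback_def)
  then show ?thesis by blast
qed

section \<open>Connectedness of a nerve\<close>

text \<open>Vertices of the nerve are objects and edges are arrows, so that connectedness of the nerve
  means that any two objects are joined by a zigzag of arrows.\<close>

definition arrow_graph :: "('o, 'a, 'z) cat_scheme \<Rightarrow> ('o \<times> 'o) set" where
  "arrow_graph K = (\<lambda>f. (Dom K f, Cod K f)) ` Arr K"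

lemma category_ord_cat: "category (ord_cat n)"
  by unfold_locales (auto simp: ord_cat_def Hom_iff)

definition vertex :: "('o, 'a, 'z) cat_scheme \<Rightarrow> 'o \<Rightarrow> (nat, nat \<times> nat, 'o, 'a) func" where
  "vertex K x = \<lparr>fobj = restrict (\<lambda>_. x) {..0}, farr = restrict (\<lambda>_. Ident K x) {(0,0)}\<rparr>"

lemma ord_cat_0: "Obj (ord_cat 0) = {0}" "Arr (ord_cat 0) = {(0,0)}" "Ident (ord_cat 0) i = (i, i)"
  by (auto simp: ord_cat_def)

lemma nerve_vertices:
  assumes "category K"
  shows "simplices (nerve K) 0 = vertex K ` Obj K" "inj_on (vertex K) (Obj K)"
proof -
  interpret category K by fact
  have "vertex K x \<in> functors (ord_cat 0) K" if "x \<in> Obj K" for x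
    using that assms category_ord_cat[of 0] Ident_Hom[OF that] Comp_Ident_left[OF Ident_Hom[OF that]]
    by (auto simp: functors_def is_functor_def vertex_def ord_cat_def)
  moreover have "F = vertex K (fobj F 0)" "fobj F 0 \<in> Obj K" if F: "F \<in> functors (ord_cat 0) K" for F
  proof -
    show ob: "fobj F 0 \<in> Obj K"
      using functor_maps(3)[OF functors_functor[OF F], of 0] by (simp add: ord_cat_0)
    show "F = vertex K (fobj F 0)"
    proof (rule func_eqI[OF F calculation[OF ob]])
      show "farr F f = farr (vertex K (fobj F 0)) f" if "f \<in> Arr (ord_cat 0)" for f
        using functor_maps(6)[OF functors_functor[OF F], of 0] that by (simp add: ord_cat_0 vertex_def)
    qed (simp add: ord_cat_0 vertex_def)
  qed
  ultimately show "simplices (nerve K) 0 = vertex K ` Obj K"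
    by (auto simp: nerve_def)
  show "inj_on (vertex K) (Obj K)"
    by (auto simp: inj_on_def vertex_def restrict_def fun_eq_iff)
qed

lemma nerve_edges:
  assumes "category K"
  shows "sset_edges (nerve K) = map_prod (vertex K) (vertex K) ` arrow_graph K"
proof -
  interpret category K by fact
  have ends: "act (nerve K) 0 1 (\<lambda>_. i) F = vertex K (fobj F i)"
    if "F \<in> functors (ord_cat 1) K" "i \<le> 1" for F i
    using that functor_maps(6)[OF functors_functor[OF that(1)], of i]
    by (auto simp: nerve_def comp_func_def vertex_def ord_cat_def intro!: ext)
  have "\<exists>f\<in>Arr K. fobj F 0 = Dom K f \<and> fobj F 1 = Cod K f" if F: "F \<in> functors (ord_cat 1) K" for F
    using functor_maps(5)[OF functors_functor[OF F], of "(0,1)"]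
    by (intro bexI[of _ "farr F (0,1)"]) (auto simp: ord_cat_def Hom_iff)
  moreover have "\<exists>F\<in>functors (ord_cat 1) K. fobj F 0 = Dom K f \<and> fobj F 1 = Cod K f"
    if f: "f \<in> Arr K" for f
  proof -
    define F where "F = \<lparr>fobj = restrict (\<lambda>i::nat. if i = 0 then Dom K f else Cod K f) {..1},
      farr = restrict (\<lambda>x. if x = (0,1) then f else if x = (0,0) then Ident K (Dom K f) else Ident K (Cod K f))
        {(i, j). i \<le> j \<and> j \<le> (1::nat)}\<rparr>"
    have A: "{(i, j). i \<le> j \<and> j \<le> (1::nat)} = {(0,0), (0,Suc 0), (Suc 0,Suc 0)}" by auto
    have F: "farr F (0,0) = Ident K (Dom K f)" "farr F (0,Suc 0) = f"
      "farr F (Suc 0,Suc 0) = Ident K (Cod K f)" "fobj F 0 = Dom K f" "fobj F (Suc 0) = Cod K f"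
      "fobj F \<in> extensional {..1}" "farr F \<in> extensional {(i, j). i \<le> j \<and> j \<le> (1::nat)}"
      unfolding F_def by auto
    have O: "Obj (ord_cat 1) = {0, Suc 0}" by (auto simp: ord_cat_def)
    note ids = Dom_Obj[OF f] Cod_Obj[OF f] Ident_Arr[OF Dom_Obj[OF f]] Ident_Arr[OF Cod_Obj[OF f]]
      Comp_Arr_Ident[OF f] Comp_Ident_left[OF Ident_Hom[OF Dom_Obj[OF f]]]
      Comp_Ident_left[OF Ident_Hom[OF Cod_Obj[OF f]]]
    have "is_functor (ord_cat 1) K F"
      unfolding is_functor_def O
    proof (intro conjI ballI impI)
      show "farr F x \<in> Hom K (fobj F (Dom (ord_cat 1) x)) (fobj F (Cod (ord_cat 1) x))"
        if "x \<in> Arr (ord_cat 1)" for x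
        using that f ids by (auto simp: ord_cat_def F Hom_iff A simp del: One_nat_def)
      show "farr F (y \<cdot>\<^bsub>ord_cat 1\<^esub> x) = farr F y \<cdot>\<^bsub>K\<^esub> farr F x"
        if "x \<in> Arr (ord_cat 1)" "y \<in> Arr (ord_cat 1)" "Dom (ord_cat 1) y = Cod (ord_cat 1) x" for x y
        using that f ids by (auto simp: ord_cat_def F A simp del: One_nat_def)
    qed (use assms category_ord_cat ids in \<open>auto simp: F ord_cat_def\<close>)
    then have "F \<in> functors (ord_cat 1) K"
      using F(6,7) by (simp add: functors_def ord_cat_def)
    then show ?thesis by (intro bexI[of _ F]) (auto simp: F_def)
  qed
  ultimately have ends_eq: "(\<lambda>F. (fobj F 0, fobj F 1)) ` functors (ord_cat 1) K = arrow_graph K"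
    unfolding arrow_graph_def by (auto simp: image_iff) metis+
  have "sset_edges (nerve K) = (\<lambda>F. (vertex K (fobj F 0), vertex K (fobj F 1))) ` functors (ord_cat 1) K"
  proof -
    have "simplices (nerve K) 1 = functors (ord_cat 1) K" by (simp add: nerve_def)
    then have "sset_edges (nerve K)
        = (\<lambda>F. (act (nerve K) 0 1 (\<lambda>_. 0) F, act (nerve K) 0 1 (\<lambda>_. 1) F)) ` functors (ord_cat 1) K"
      by (auto simp: sset_edges_def)
    then show ?thesis using ends by (auto intro: image_cong)
  qed
  also have "\<dots> = map_prod (vertex K) (vertex K) ` arrow_graph K"
    unfolding ends_eq[symmetric] image_image by simp
  finally show ?thesis .
qed

lemma sset_empty_nerve:
  assumes "category K"
  shows "sset_empty (nerve K) \<longleftrightarrow> Obj K = {}"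
proof -
  have "functors (ord_cat n) K = {}" if "Obj K = {}" for n
    using that by (auto simp: functors_def is_functor_def ord_cat_def)
  then show ?thesis
    using nerve_vertices(1)[OF assms] by (auto simp: sset_empty_def nerve_def)
qed

lemma rtrancl_map_prod_image:
  assumes "(f x, z) \<in> (map_prod f f ` R)\<^sup>*" "inj_on f A" "R \<subseteq> A \<times> A" "x \<in> A"
  shows "\<exists>y. z = f y \<and> (x, y) \<in> R\<^sup>*"
  using assms(1)
proof (induction rule: rtrancl_induct)
  case base
  then show ?case by blast
next
  case (step w z)
  then obtain y where y: "w = f y" "(x, y) \<in> R\<^sup>*" by blast
  then have "y \<in> A" using assms(3,4) by (auto elim: rtranclE)
  moreover obtain y' z' where "(y', z') \<in> R" "w = f y'" "z = f z'" using step(2) by auto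
  ultimately show ?case
    using y assms(2,3) by (metis inj_onD mem_Sigma_iff rtrancl.rtrancl_into_rtrancl subsetD)
qed

lemma sset_connected_nerve:
  assumes "category K"
  shows "sset_connected (nerve K) \<longleftrightarrow> Obj K \<noteq> {} \<and>
    (\<forall>x\<in>Obj K. \<forall>y\<in>Obj K. (x, y) \<in> (arrow_graph K \<union> (arrow_graph K)\<inverse>)\<^sup>*)"
proof -
  interpret category K by fact
  let ?R = "arrow_graph K \<union> (arrow_graph K)\<inverse>" and ?v = "vertex K"
  have sub: "?R \<subseteq> Obj K \<times> Obj K"
    by (auto simp: arrow_graph_def Dom_Obj Cod_Obj)
  have im: "sset_edges (nerve K) \<union> (sset_edges (nerve K))\<inverse> = map_prod ?v ?v ` ?R"
    unfolding nerve_edges[OF assms] by force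
  have "(?v x, ?v y) \<in> (map_prod ?v ?v ` ?R)\<^sup>* \<longleftrightarrow> (x, y) \<in> ?R\<^sup>*" if xy: "x \<in> Obj K" "y \<in> Obj K" for x y
  proof
    assume "(?v x, ?v y) \<in> (map_prod ?v ?v ` ?R)\<^sup>*"
    then obtain y' where y': "?v y = ?v y'" "(x, y') \<in> ?R\<^sup>*"
      using rtrancl_map_prod_image[OF _ nerve_vertices(2)[OF assms] sub xy(1)] by blast
    then have "y' \<in> Obj K" using sub xy by (auto elim: rtranclE)
    then show "(x, y) \<in> ?R\<^sup>*" using y' nerve_vertices(2)[OF assms] xy by (metis inj_onD)
  next
    assume "(x, y) \<in> ?R\<^sup>*"
    then show "(?v x, ?v y) \<in> (map_prod ?v ?v ` ?R)\<^sup>*"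
      by (induction rule: rtrancl_induct) (auto intro: rtrancl.rtrancl_into_rtrancl)
  qed
  then show ?thesis
    unfolding sset_connected_def im nerve_vertices(1)[OF assms] by auto
qed


section \<open>Inverse arrows of a Reedy category\<close>

lemma reedy_category_category: "reedy_category U C \<Longrightarrow> category C"
  by (simp add: reedy_category_def small_category_def)

lemma Inverse_closed:
  assumes "reedy_category U C"
  shows "f \<in> Inverse C \<Longrightarrow> f \<in> Arr C"
    and "a \<in> Obj C \<Longrightarrow> Ident C a \<in> Inverse C"
    and "f \<in> Inverse C \<Longrightarrow> g \<in> Inverse C \<Longrightarrow> Dom C g = Cod C f \<Longrightarrow> g \<cdot>\<^bsub>C\<^esub> f \<in> Inverse C"
  using assms by (auto simp: reedy_category_def wide_subcategory_def)

lemma Direct_closed: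
  assumes "reedy_category U C"
  shows "f \<in> Direct C \<Longrightarrow> f \<in> Arr C"
    and "a \<in> Obj C \<Longrightarrow> Ident C a \<in> Direct C"
  using assms by (auto simp: reedy_category_def wide_subcategory_def)

lemma reedy_degree:
  fixes C :: "('o, 'a, 'z) reedy_scheme"
  assumes "reedy_category U C"
  shows "\<exists>deg :: 'o \<Rightarrow> nat. \<forall>f\<in>Inverse C. f \<noteq> Ident C (Dom C f) \<longrightarrow> deg (Cod C f) < deg (Dom C f)"
  using assms unfolding reedy_category_def by blast

lemma reedy_factorization:
  fixes C (structure)
  assumes "reedy_category U C" "f \<in> Arr C"
  obtains d i where "d \<in> Direct C" "i \<in> Inverse C" "Dom C d = Cod C i" "d \<cdot> i = f"
proof -
  have "\<exists>!(d, i). d \<in> Direct C \<and> i \<in> Inverse C \<and> Dom C d = Cod C i \<and> d \<cdot> i = f"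
    using assms by (simp add: reedy_category_def)
  then obtain x where "case x of (d, i) \<Rightarrow> d \<in> Direct C \<and> i \<in> Inverse C \<and> Dom C d = Cod C i \<and> d \<cdot> i = f"
    by (rule ex1E)
  then show thesis using that by (cases x) auto
qed

lemma reedy_factorization_unique:
  fixes C (structure)
  assumes C: "reedy_category U C"
    and d: "d \<in> Direct C" "i \<in> Inverse C" "Dom C d = Cod C i"
    and d': "d' \<in> Direct C" "i' \<in> Inverse C" "Dom C d' = Cod C i'"
    and eq: "d \<cdot> i = d' \<cdot> i'"
  shows "d = d'" "i = i'"
proof -
  interpret category C using C by (rule reedy_category_category)
  have "d \<cdot> i \<in> Arr C"
    using Comp_Arr(1)[OF Inverse_closed(1)[OF C d(2)] Direct_closed(1)[OF C d(1)] d(3)] .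
  then have ex1: "\<exists>!(d', i'). d' \<in> Direct C \<and> i' \<in> Inverse C \<and> Dom C d' = Cod C i' \<and> d' \<cdot> i' = d \<cdot> i"
    using C by (simp add: reedy_category_def)
  have "(d, i) = (d', i')"
    by (rule ex1_implies_eq[OF ex1]) (use d d' eq in auto)
  then show "d = d'" "i = i'" by simp_all
qed

text \<open>In the factorization of an arrow \<open>f\<close> that becomes inverse after precomposing with an inverse arrow,
  the direct part must be an identity, by uniqueness of the factorization of \<open>f \<cdot> i\<close>.\<close>

lemma Inverse_cancel_right:
  fixes C (structure)
  assumes C: "reedy_category U C" and f: "f \<in> Arr C" and i: "i \<in> Inverse C" "Dom C f = Cod C i"
    and fi: "f \<cdot> i \<in> Inverse C"
  shows "f \<in> Inverse C"
proof -
  interpret category C using C by (rule reedy_category_category)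
  obtain d j where dj: "d \<in> Direct C" "j \<in> Inverse C" "Dom C d = Cod C j" "d \<cdot> j = f"
    using reedy_factorization[OF C f] .
  note arr = Direct_closed(1)[OF C dj(1)] Inverse_closed(1)[OF C dj(2)] Inverse_closed(1)[OF C i(1)]
  have ji: "Dom C j = Cod C i" using Comp_Arr(2)[OF arr(2,1) dj(3)] dj(4) i(2) by simp
  have ob: "Cod C f \<in> Obj C" using Cod_Obj f .
  have fi': "f \<cdot> i \<in> Arr C" "Cod C (f \<cdot> i) = Cod C f" using Comp_Arr arr f i by auto
  have "d \<cdot> (j \<cdot> i) = Ident C (Cod C f) \<cdot> (f \<cdot> i)"
    using Comp_Arr_assoc[OF arr(3,2,1) ji dj(3)] dj(4) Comp_Arr_Ident(2)[OF fi'(1)] fi'(2) by simp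
  note eq = this
  have ends: "Dom C d = Cod C (j \<cdot> i)" "Dom C (Ident C (Cod C f)) = Cod C (f \<cdot> i)"
    using Comp_Arr(3)[OF arr(3,2) ji] dj(3) Ident_Arr(2)[OF ob] fi'(2) by simp_all
  have "d = Ident C (Cod C f)"
    by (rule reedy_factorization_unique(1)[OF C dj(1) Inverse_closed(3)[OF C i(1) dj(2) ji] ends(1)
        Direct_closed(2)[OF C ob] fi ends(2) eq])
  note d = this
  have cod: "Cod C f = Cod C j"
    using dj(3) Ident_Arr(2)[OF ob] unfolding d by simp
  have "f = j"
    using dj(4) Comp_Arr_Ident(2)[OF arr(2)] unfolding d cod by (rule trans[OF sym])
  then show ?thesis using dj(2) by simp
qed

text \<open>The degree strictly decreases along \<open>f\<close> and does not increase along \<open>g\<close>.\<close>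

lemma Inverse_Comp_not_Ident:
  fixes C :: "('o, 'a, 'z) reedy_scheme"
  assumes C: "reedy_category U C" and f: "f \<in> Inverse C" "f \<noteq> Ident C (Dom C f)"
    and g: "g \<in> Inverse C" "Dom C g = Cod C f"
  shows "g \<cdot>\<^bsub>C\<^esub> f \<noteq> Ident C (Dom C f)"
proof
  assume eq: "g \<cdot>\<^bsub>C\<^esub> f = Ident C (Dom C f)"
  interpret category C using C by (rule reedy_category_category)
  obtain deg :: "'o \<Rightarrow> nat" where deg: "\<forall>f\<in>Inverse C. f \<noteq> Ident C (Dom C f) \<longrightarrow> deg (Cod C f) < deg (Dom C f)"
    using reedy_degree[OF C] ..
  note arr = Inverse_closed(1)[OF C f(1)] Inverse_closed(1)[OF C g(1)]
  have "Cod C g = Dom C f"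
    using Comp_Arr(3)[OF arr g(2)] Ident_Arr(3)[OF Dom_Obj[OF arr(1)]] eq by simp
  moreover have "deg (Cod C g) \<le> deg (Dom C g)"
    using deg g(1) Ident_Arr(3)[OF Dom_Obj[OF arr(2)]] by (cases "g = Ident C (Dom C g)") auto
  ultimately show False using deg f g(2) by force
qed

section \<open>Matching objects\<close>

lemma matching_cat_simps [simp]:
  "Obj (matching_cat C a) = {f \<in> Inverse C. Dom C f = a \<and> f \<noteq> Ident C a}"
  "Arr (matching_cat C a) = {(f, h, g). f \<in> Obj (matching_cat C a) \<and> g \<in> Obj (matching_cat C a)
      \<and> h \<in> Inverse C \<and> Dom C h = Cod C f \<and> Cod C h = Cod C g \<and> h \<cdot>\<^bsub>C\<^esub> f = g}"
  "Dom (matching_cat C a) = (\<lambda>(f, h, g). f)"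
  "Cod (matching_cat C a) = (\<lambda>(f, h, g). g)"
  "Ident (matching_cat C a) = (\<lambda>f. (f, Ident C (Cod C f), f))"
  "Comp (matching_cat C a) = (\<lambda>(f', h', g') (f, h, g). (f, h' \<cdot>\<^bsub>C\<^esub> h, g'))"
  by (auto simp: matching_cat_def full_subcat_def under_cat_def wide_subcat_def Hom_def)

lemma category_matching_cat:
  fixes C (structure)
  assumes C: "reedy_category U C"
  shows "category (matching_cat C a)"
proof -
  interpret category C using C by (rule reedy_category_category)
  note inv = Inverse_closed[OF C]
  show ?thesis
  proof (rule category_of_triples[OF reedy_category_category[OF C] matching_cat_simps(3-6)])
    fix f h g assume x: "(f, h, g) \<in> Arr (matching_cat C a)"
    then show "f \<in> Obj (matching_cat C a) \<and> g \<in> Obj (matching_cat C a) \<and> h \<in> Hom C (Cod C f) (Cod C g)"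
      using inv(1) by (auto simp: Hom_iff)
    fix k l assume y: "(g, k, l) \<in> Arr (matching_cat C a)"
    have "k \<cdot> h \<cdot> f = l"
      using x y Comp_Arr_assoc[OF inv(1) inv(1) inv(1), of f h k] by simp
    then show "(f, k \<cdot> h, l) \<in> Arr (matching_cat C a)"
      using x y inv(3)[of h k] Comp_Arr[OF inv(1) inv(1), of h k] by simp
  next
    fix f assume "f \<in> Obj (matching_cat C a)"
    then show "(f, Ident C (Cod C f), f) \<in> Arr (matching_cat C a)"
      using inv(1)[of f] inv(2)[OF Cod_Obj, of f] Ident_Arr[OF Cod_Obj, of f] Comp_Arr_Ident(2)[of f] by simp
  qed
qed

lemma matching_cat_small:
  fixes C :: "('o, 'a, 'z) reedy_scheme"
  assumes inf: "infinite (UNIV :: 'u set)" and C: "reedy_category TYPE('u) C"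
  shows "small_category TYPE('u) (matching_cat C a)"
proof -
  obtain p :: "'u \<times> 'u \<Rightarrow> 'u" where p: "inj p" using infinite_pairing[OF inf] .
  obtain e :: "'a \<Rightarrow> 'u" where e: "inj_on e (Arr C)"
    using C unfolding reedy_category_def small_category_def by blast
  have "inj_on (\<lambda>(f, h, g). p (e f, p (e h, e g))) (Arr (matching_cat C a))"
  proof (rule inj_onI)
    fix x y assume "x \<in> Arr (matching_cat C a)" "y \<in> Arr (matching_cat C a)"
      and eq: "(\<lambda>(f, h, g). p (e f, p (e h, e g))) x = (\<lambda>(f, h, g). p (e f, p (e h, e g))) y"
    moreover obtain f h g f' h' g' where xy: "x = (f, h, g)" "y = (f', h', g')" by (cases x; cases y)
    ultimately have "f \<in> Arr C" "h \<in> Arr C" "g \<in> Arr C" "f' \<in> Arr C" "h' \<in> Arr C" "g' \<in> Arr C"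
      using Inverse_closed(1)[OF C] by auto
    moreover have "e f = e f'" "e h = e h'" "e g = e g'"
      using eq unfolding xy by (simp_all add: inj_eq[OF p])
    ultimately show "x = y" unfolding xy by (simp add: inj_on_eq_iff[OF e])
  qed
  then show ?thesis using category_matching_cat[OF C] by (auto simp: small_category_def)
qed

lemma matching_diagram_functor:
  assumes C: "reedy_category U C" and X: "is_functor C M X"
  shows "is_functor (matching_cat C a) M (matching_diagram C X)"
proof -
  interpret category C using C by (rule reedy_category_category)
  have "farr X (h' \<cdot>\<^bsub>C\<^esub> h) = farr X h' \<cdot>\<^bsub>M\<^esub> farr X h"
    if "h \<in> Inverse C" "h' \<in> Inverse C" "Dom C h' = Cod C h" for h h'
    using functor_maps(7)[OF X] Inverse_closed(1)[OF C] that by (auto simp: Hom_iff)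
  then show ?thesis
    using functor_maps[OF X] category_matching_cat[OF C] Inverse_closed(1)[OF C] Cod_Obj
    by (auto simp: is_functor_def matching_diagram_def Hom_iff)
qed

lemma matching_cone_iff:
  "is_cone (matching_cat C a) M (matching_diagram C X) K w \<longleftrightarrow> K \<in> Obj M
    \<and> (\<forall>f\<in>Obj (matching_cat C a). w f \<in> Hom M K (fobj X (Cod C f)))
    \<and> (\<forall>f\<in>Obj (matching_cat C a). \<forall>h\<in>Inverse C. Dom C h = Cod C f \<longrightarrow>
         h \<cdot>\<^bsub>C\<^esub> f \<in> Obj (matching_cat C a) \<longrightarrow> farr X h \<cdot>\<^bsub>M\<^esub> w f = w (h \<cdot>\<^bsub>C\<^esub> f))"
  if C: "reedy_category U C"
proof -
  interpret category C using C by (rule reedy_category_category)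
  have cod: "Cod C (h \<cdot>\<^bsub>C\<^esub> f) = Cod C h" if "f \<in> Inverse C" "h \<in> Inverse C" "Dom C h = Cod C f" for f h
    using Comp_Arr(3) Inverse_closed(1)[OF C] that by blast
  show ?thesis
    unfolding is_cone_def matching_diagram_def by (auto simp: cod)
qed

lemma diagram_cone:
  assumes C: "reedy_category U C" and X: "is_functor C M X" and a: "a \<in> Obj C"
  shows "is_cone (matching_cat C a) M (matching_diagram C X) (fobj X a) (farr X)"
  unfolding matching_cone_iff[OF C]
  using functor_maps(3,5)[OF X] functor_maps(7)[OF X, symmetric] a Inverse_closed(1)[OF C]
  by (auto simp: Hom_iff)

lemma pullback_universal:
  fixes M (structure)
  assumes "is_pullback M f g p q" "u \<in> Hom M K (Dom M f)" "v \<in> Hom M K (Dom M g)"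
    and "f \<cdot> u = g \<cdot> v"
  shows "\<exists>!w. w \<in> Hom M K (Dom M p) \<and> p \<cdot> w = u \<and> q \<cdot> w = v"
proof -
  from assms(1) have "\<forall>K. \<forall>u\<in>Hom M K (Dom M f). \<forall>v\<in>Hom M K (Dom M g). f \<cdot> u = g \<cdot> v \<longrightarrow>
      (\<exists>!w. w \<in> Hom M K (Dom M p) \<and> p \<cdot> w = u \<and> q \<cdot> w = v)"
    unfolding is_pullback_def by (elim conjE)
  from this[rule_format, OF assms(2-4)] show ?thesis .
qed

lemma relative_matching_map_exists:
  fixes M (structure)
  assumes inf: "infinite (UNIV :: 'u set)" and lim: "has_small_limits TYPE('u) M"
    and C: "reedy_category TYPE('u) C" and M: "category M"
    and t: "t \<in> nat_transformations C M" and a: "a \<in> Obj C"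
  shows "\<exists>r. is_relative_matching_map C M t a r"
proof -
  interpret C: category C using C by (rule reedy_category_category)
  interpret M: category M by fact
  let ?J = "matching_cat C a"
  define X where "X = nsrc t"
  define Y where "Y = ntgt t"
  note T = nat_transformationsD[OF t, folded X_def Y_def]
  note X = functors_functor[OF T(1)] and Y = functors_functor[OF T(2)]
  note J = category_matching_cat[OF C, of a]
  note FX = matching_diagram_functor[OF C X, of a] and FY = matching_diagram_functor[OF C Y, of a]
  obtain MX \<pi>X where MX: "is_limit ?J M (matching_diagram C X) MX \<pi>X"
    using small_limit_exists[OF lim matching_cat_small[OF inf C] FX] by blast
  obtain MY \<pi>Y where MY: "is_limit ?J M (matching_diagram C Y) MY \<pi>Y"
    using small_limit_exists[OF lim matching_cat_small[OF inf C] FY] by blast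
  obtain mX where mX: "mX \<in> Hom M (fobj X a) MX" "\<forall>f\<in>Obj ?J. \<pi>X f \<cdot> mX = farr X f"
    using limit_map_exists[OF MX diagram_cone[OF C X a]] by blast
  obtain mY where mY: "mY \<in> Hom M (fobj Y a) MY" "\<forall>f\<in>Obj ?J. \<pi>Y f \<cdot> mY = farr Y f"
    using limit_map_exists[OF MY diagram_cone[OF C Y a]] by blast
  have \<pi>X: "MX \<in> Obj M" "\<And>f. f \<in> Obj ?J \<Longrightarrow> \<pi>X f \<in> Hom M MX (fobj X (Cod C f))"
      "\<And>f h. f \<in> Obj ?J \<Longrightarrow> h \<in> Inverse C \<Longrightarrow> Dom C h = Cod C f \<Longrightarrow> h \<cdot>\<^bsub>C\<^esub> f \<in> Obj ?J \<Longrightarrow> farr X h \<cdot> \<pi>X f = \<pi>X (h \<cdot>\<^bsub>C\<^esub> f)"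
    using MX unfolding is_limit_def matching_cone_iff[OF C] by blast+
  have \<pi>Y: "\<And>f. f \<in> Obj ?J \<Longrightarrow> \<pi>Y f \<in> Hom M MY (fobj Y (Cod C f))"
    using MY unfolding is_limit_def matching_cone_iff[OF C] by blast+
  have tf: "nat_at t (Cod C f) \<in> Hom M (fobj X (Cod C f)) (fobj Y (Cod C f))" if "f \<in> Obj ?J" for f
    using that T(3) C.Cod_Obj Inverse_closed(1)[OF C] by auto
  have "is_cone ?J M (matching_diagram C Y) MX (\<lambda>f. nat_at t (Cod C f) \<cdot> \<pi>X f)"
    unfolding matching_cone_iff[OF C]
  proof (intro conjI ballI impI)
    show "nat_at t (Cod C f) \<cdot> \<pi>X f \<in> Hom M MX (fobj Y (Cod C f))" if "f \<in> Obj ?J" for f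
      using M.Comp_Hom[OF \<pi>X(2) tf] that by blast
    fix f h assume f: "f \<in> Obj ?J" and h: "h \<in> Inverse C" "Dom C h = Cod C f" and hf: "h \<cdot>\<^bsub>C\<^esub> f \<in> Obj ?J"
    have hh: "h \<in> Hom C (Cod C f) (Cod C (h \<cdot>\<^bsub>C\<^esub> f))"
      using Inverse_closed(1)[OF C] f h C.Comp_Arr(3)[of f h] by (auto simp: Hom_iff)
    note H = functor_maps(4)[OF X hh] functor_maps(4)[OF Y hh] \<pi>X(2)[OF f] tf[OF f] tf[OF hf]
    have "farr Y h \<cdot> (nat_at t (Cod C f) \<cdot> \<pi>X f) = nat_at t (Cod C (h \<cdot>\<^bsub>C\<^esub> f)) \<cdot> farr X h \<cdot> \<pi>X f"
      using M.Comp_assoc[OF H(3,4,2)] T(4)[OF hh] by simp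
    also have "\<dots> = nat_at t (Cod C (h \<cdot>\<^bsub>C\<^esub> f)) \<cdot> \<pi>X (h \<cdot>\<^bsub>C\<^esub> f)"
      using M.Comp_assoc[OF H(3,1,5)] \<pi>X(3)[OF f h hf] by simp
    finally show "farr Y h \<cdot> (nat_at t (Cod C f) \<cdot> \<pi>X f) = nat_at t (Cod C (h \<cdot>\<^bsub>C\<^esub> f)) \<cdot> \<pi>X (h \<cdot>\<^bsub>C\<^esub> f)" .
  qed fact
  then obtain k where k: "k \<in> Hom M MX MY"
      "\<forall>f\<in>Obj ?J. \<pi>Y f \<cdot> k = nat_at t (Cod C f) \<cdot> \<pi>X f"
    using limit_map_exists[OF MY] by blast
  obtain p q where pq: "is_pullback M mY k p q"
    using pullback_exists[OF inf lim M mY(1) k(1)] by blast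
  have ta: "nat_at t a \<in> Hom M (fobj X a) (fobj Y a)" using T(3)[OF a] .
  have "mY \<cdot> nat_at t a = k \<cdot> mX"
  proof (rule limit_jointly_monic[OF M J FY MY])
    fix f assume f: "f \<in> Obj ?J"
    then have ff: "f \<in> Hom C a (Cod C f)"
      using Inverse_closed(1)[OF C] by (auto simp: Hom_iff)
    have "\<pi>Y f \<cdot> (mY \<cdot> nat_at t a) = farr Y f \<cdot> nat_at t a"
      using M.Comp_assoc[OF ta mY(1) \<pi>Y[OF f]] mY(2)[rule_format, OF f] by simp
    also have "\<dots> = nat_at t (Cod C f) \<cdot> (\<pi>X f \<cdot> mX)"
      using T(4)[OF ff] mX(2)[rule_format, OF f] by simp
    also have "\<dots> = \<pi>Y f \<cdot> (k \<cdot> mX)"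
      using M.Comp_assoc[OF mX(1) \<pi>X(2)[OF f] tf[OF f]] M.Comp_assoc[OF mX(1) k(1) \<pi>Y[OF f]] k(2)[rule_format, OF f]
      by simp
    finally show "\<pi>Y f \<cdot> (mY \<cdot> nat_at t a) = \<pi>Y f \<cdot> (k \<cdot> mX)" .
  qed (use M.Comp_Hom ta mX mY k in blast)+
  then obtain r where "r \<in> Hom M (fobj X a) (Dom M p)" "p \<cdot> r = nat_at t a" "q \<cdot> r = mX"
    using pq ta mX(1) HomD[OF mY(1)] HomD[OF k(1)] unfolding is_pullback_def by metis
  then show ?thesis
    unfolding is_relative_matching_map_def is_matching_object_def is_matching_map_def
      X_def[symmetric] Y_def[symmetric]
    using MX MY mX mY k pq by blast
qed

section \<open>Fibrations and lifting\<close>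

text \<open>The lifting problem of \<open>i : A \<rightarrow> B\<close> against a relative matching map, with the pullback
  and the matching objects spelled out: a map from \<open>B\<close> to the pullback is a map \<open>v\<close> to
  \<open>Y\<^sub>a\<close> together with a cone \<open>w\<close>.\<close>

definition matching_lifts ::
  "('o, 'a, 'y) reedy_scheme \<Rightarrow> ('o2, 'a2, 'z) cat_scheme \<Rightarrow> ('o, 'a, 'o2, 'a2) ntrans
     \<Rightarrow> 'o \<Rightarrow> 'a2 \<Rightarrow> bool" where
  "matching_lifts C M t a i \<longleftrightarrow>
     (\<forall>u \<in> Hom M (Dom M i) (fobj (nsrc t) a). \<forall>v \<in> Hom M (Cod M i) (fobj (ntgt t) a).
      \<forall>w. is_cone (matching_cat C a) M (matching_diagram C (nsrc t)) (Cod M i) w \<longrightarrow>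
        nat_at t a \<cdot>\<^bsub>M\<^esub> u = v \<cdot>\<^bsub>M\<^esub> i \<longrightarrow>
        (\<forall>f \<in> Obj (matching_cat C a). w f \<cdot>\<^bsub>M\<^esub> i = farr (nsrc t) f \<cdot>\<^bsub>M\<^esub> u
            \<and> nat_at t (Cod C f) \<cdot>\<^bsub>M\<^esub> w f = farr (ntgt t) f \<cdot>\<^bsub>M\<^esub> v) \<longrightarrow>
        (\<exists>h \<in> Hom M (Cod M i) (fobj (nsrc t) a). h \<cdot>\<^bsub>M\<^esub> i = u \<and> nat_at t a \<cdot>\<^bsub>M\<^esub> h = v
            \<and> (\<forall>f \<in> Obj (matching_cat C a). farr (nsrc t) f \<cdot>\<^bsub>M\<^esub> h = w f)))"

lemma relative_matching_map_lifting:
  fixes M (structure)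
  assumes C: "reedy_category U C" and M: "category M"
    and t: "t \<in> nat_transformations C M" and a: "a \<in> Obj C"
    and r: "is_relative_matching_map C M t a r" and i: "i \<in> Arr M"
  shows "has_lifting M i r \<longleftrightarrow> matching_lifts C M t a i"
proof -
  interpret C: category C using C by (rule reedy_category_category)
  interpret M: category M by fact
  let ?J = "matching_cat C a"
  define X where "X = nsrc t"
  define Y where "Y = ntgt t"
  define A where "A = Dom M i"
  define B where "B = Cod M i"
  have i: "i \<in> Hom M A B" using i by (simp add: A_def B_def Hom_iff)
  note T = nat_transformationsD[OF t, folded X_def Y_def]
  note X = functors_functor[OF T(1)] and Y = functors_functor[OF T(2)]
  note J = category_matching_cat[OF C, of a]
  note FX = matching_diagram_functor[OF C X, of a] and FY = matching_diagram_functor[OF C Y, of a]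
  obtain MX \<pi>X mX MY \<pi>Y mY k p q where
    MX: "is_limit ?J M (matching_diagram C X) MX \<pi>X"
    and mX: "mX \<in> Hom M (fobj X a) MX" "\<forall>f\<in>Obj ?J. \<pi>X f \<cdot> mX = farr X f"
    and MY: "is_limit ?J M (matching_diagram C Y) MY \<pi>Y"
    and mY: "mY \<in> Hom M (fobj Y a) MY" "\<forall>f\<in>Obj ?J. \<pi>Y f \<cdot> mY = farr Y f"
    and k: "k \<in> Hom M MX MY" "\<forall>f\<in>Obj ?J. \<pi>Y f \<cdot> k = nat_at t (Cod C f) \<cdot> \<pi>X f"
    and pq: "is_pullback M mY k p q"
    and r: "r \<in> Hom M (fobj X a) (Dom M p)" "p \<cdot> r = nat_at t a" "q \<cdot> r = mX"
    using r unfolding is_relative_matching_map_def is_matching_object_def is_matching_map_def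
      X_def[symmetric] Y_def[symmetric] by blast
  have \<pi>X: "\<And>f. f \<in> Obj ?J \<Longrightarrow> \<pi>X f \<in> Hom M MX (fobj X (Cod C f))"
    using MX unfolding is_limit_def matching_cone_iff[OF C] by blast+
  have \<pi>Y: "\<And>f. f \<in> Obj ?J \<Longrightarrow> \<pi>Y f \<in> Hom M MY (fobj Y (Cod C f))"
    using MY unfolding is_limit_def matching_cone_iff[OF C] by blast+
  have tf: "nat_at t (Cod C f) \<in> Hom M (fobj X (Cod C f)) (fobj Y (Cod C f))" if "f \<in> Obj ?J" for f
    using that T(3) C.Cod_Obj Inverse_closed(1)[OF C] by auto
  define P where "P = Dom M p"
  have p: "p \<in> Hom M P (fobj Y a)" and q: "q \<in> Hom M P MX" and comm: "mY \<cdot> p = k \<cdot> q"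
    using pq HomD[OF mY(1)] HomD[OF k(1)] by (auto simp: is_pullback_def Hom_iff P_def)
  have pull: "\<exists>!w. w \<in> Hom M K P \<and> p \<cdot> w = u \<and> q \<cdot> w = v"
    if "u \<in> Hom M K (fobj Y a)" "v \<in> Hom M K MX" "mY \<cdot> u = k \<cdot> v" for K u v
    using pullback_universal[OF pq, of u K v] that HomD[OF mY(1)] HomD[OF k(1)] by (simp add: P_def)
  have pull_eq: "z = z'" if z: "z \<in> Hom M K P" "z' \<in> Hom M K P" "p \<cdot> z = p \<cdot> z'" "q \<cdot> z = q \<cdot> z'" for K z z'
  proof -
    have "mY \<cdot> (p \<cdot> z) = k \<cdot> (q \<cdot> z)"
      using M.Comp_assoc[OF z(1) p mY(1)] M.Comp_assoc[OF z(1) q k(1)] comm by simp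
    note ex1 = pull[OF M.Comp_Hom[OF z(1) p] M.Comp_Hom[OF z(1) q] this]
    show ?thesis by (rule ex1_implies_eq[OF ex1]) (use z in auto)
  qed
  note r = r[folded P_def]
  show ?thesis
  proof
    assume lift: "has_lifting M i r"
    show "matching_lifts C M t a i"
      unfolding matching_lifts_def X_def[symmetric] Y_def[symmetric] A_def[symmetric] B_def[symmetric]
    proof (intro ballI allI impI)
      fix u v w assume u: "u \<in> Hom M A (fobj X a)" and v: "v \<in> Hom M B (fobj Y a)"
        and w: "is_cone ?J M (matching_diagram C X) B w"
        and uv: "nat_at t a \<cdot> u = v \<cdot> i"
        and wf: "\<forall>f \<in> Obj ?J. w f \<cdot> i = farr X f \<cdot> u \<and> nat_at t (Cod C f) \<cdot> w f = farr Y f \<cdot> v"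
      obtain w' where w': "w' \<in> Hom M B MX" "\<forall>f\<in>Obj ?J. \<pi>X f \<cdot> w' = w f"
        using limit_map_exists[OF MX w] by blast
      have "mY \<cdot> v = k \<cdot> w'"
      proof (rule limit_jointly_monic[OF M J FY MY])
        fix f assume f: "f \<in> Obj ?J"
        show "\<pi>Y f \<cdot> (mY \<cdot> v) = \<pi>Y f \<cdot> (k \<cdot> w')"
          using M.Comp_assoc[OF v mY(1) \<pi>Y[OF f]] M.Comp_assoc[OF w'(1) k(1) \<pi>Y[OF f]]
            M.Comp_assoc[OF w'(1) \<pi>X[OF f] tf[OF f]] w'(2)[rule_format, OF f] wf f mY(2) k(2) by metis
      qed (use M.Comp_Hom mY k v w' in blast)+
      then obtain z where z: "z \<in> Hom M B P" "p \<cdot> z = v" "q \<cdot> z = w'"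
        using pull[OF v w'(1)] by blast
      have "r \<cdot> u = z \<cdot> i"
      proof (rule pull_eq)
        show "r \<cdot> u \<in> Hom M A P" "z \<cdot> i \<in> Hom M A P" using M.Comp_Hom r u z i by blast+
        show "p \<cdot> (r \<cdot> u) = p \<cdot> (z \<cdot> i)"
          using M.Comp_assoc[OF u r(1) p] M.Comp_assoc[OF i z(1) p] r(2) z(2) uv by simp
        have "mX \<cdot> u = w' \<cdot> i"
        proof (rule limit_jointly_monic[OF M J FX MX])
          fix f assume f: "f \<in> Obj ?J"
          show "\<pi>X f \<cdot> (mX \<cdot> u) = \<pi>X f \<cdot> (w' \<cdot> i)"
            using M.Comp_assoc[OF u mX(1) \<pi>X[OF f]] M.Comp_assoc[OF i w'(1) \<pi>X[OF f]] w'(2)[rule_format, OF f] wf f mX(2)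
            by metis
        qed (use M.Comp_Hom mX u w' i in blast)+
        then show "q \<cdot> (r \<cdot> u) = q \<cdot> (z \<cdot> i)"
          using M.Comp_assoc[OF u r(1) q] M.Comp_assoc[OF i z(1) q] r(3) z(3) by simp
      qed
      then obtain h where h: "h \<in> Hom M B (fobj X a)" "h \<cdot> i = u" "r \<cdot> h = z"
        using lift u z(1) HomD[OF r(1)] unfolding has_lifting_def A_def[symmetric] B_def[symmetric] by metis
      have "nat_at t a \<cdot> h = v"
        using M.Comp_assoc[OF h(1) r(1) p] h(3) r(2) z(2) by simp
      moreover have "farr X f \<cdot> h = w f" if f: "f \<in> Obj ?J" for f
      proof -
        have "mX \<cdot> h = w'" using M.Comp_assoc[OF h(1) r(1) q] h(3) r(3) z(3) by simp
        then show ?thesis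
          using M.Comp_assoc[OF h(1) mX(1) \<pi>X[OF f]] mX(2) f w'(2)[rule_format, OF f] by metis
      qed
      ultimately show "\<exists>h\<in>Hom M B (fobj X a). h \<cdot> i = u \<and> nat_at t a \<cdot> h = v
          \<and> (\<forall>f\<in>Obj ?J. farr X f \<cdot> h = w f)"
        using h by blast
    qed
  next
    assume lift: "matching_lifts C M t a i"
    have "\<exists>h\<in>Hom M B (fobj X a). h \<cdot> i = u \<and> r \<cdot> h = z"
      if u: "u \<in> Hom M A (fobj X a)" and z: "z \<in> Hom M B P" and uz: "r \<cdot> u = z \<cdot> i" for u z
    proof -
      define v where "v = p \<cdot> z"
      define w' where "w' = q \<cdot> z"
      define w where "w f = \<pi>X f \<cdot> w'" for f
      have v: "v \<in> Hom M B (fobj Y a)" and w': "w' \<in> Hom M B MX"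
        using M.Comp_Hom z p q by (auto simp: v_def w'_def)
      have cone: "is_cone ?J M (matching_diagram C X) B w"
        using cone_comp[OF M J FX _ w'] MX unfolding w_def is_limit_def by blast
      have uv: "nat_at t a \<cdot> u = v \<cdot> i"
        using M.Comp_assoc[OF u r(1) p] M.Comp_assoc[OF i z(1) p] r(2) uz by (simp add: v_def)
      have mw: "mX \<cdot> u = w' \<cdot> i"
        using M.Comp_assoc[OF u r(1) q] M.Comp_assoc[OF i z(1) q] r(3) uz by (simp add: w'_def)
      have mv: "mY \<cdot> v = k \<cdot> w'"
        using M.Comp_assoc[OF z p mY(1)] M.Comp_assoc[OF z q k(1)] comm by (simp add: v_def w'_def)
      have wf: "w f \<cdot> i = farr X f \<cdot> u \<and> nat_at t (Cod C f) \<cdot> w f = farr Y f \<cdot> v"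
        if f: "f \<in> Obj ?J" for f
      proof
        show "w f \<cdot> i = farr X f \<cdot> u"
          using M.Comp_assoc[OF u mX(1) \<pi>X[OF f]] M.Comp_assoc[OF i w' \<pi>X[OF f]] mw mX(2) f
          unfolding w_def by metis
        show "nat_at t (Cod C f) \<cdot> w f = farr Y f \<cdot> v"
          using M.Comp_assoc[OF v mY(1) \<pi>Y[OF f]] M.Comp_assoc[OF w' k(1) \<pi>Y[OF f]]
            M.Comp_assoc[OF w' \<pi>X[OF f] tf[OF f]] mv f mY(2) k(2) unfolding w_def by metis
      qed
      obtain h where h: "h \<in> Hom M B (fobj X a)" "h \<cdot> i = u" "nat_at t a \<cdot> h = v"
          "\<forall>f\<in>Obj ?J. farr X f \<cdot> h = w f"
        using lift[unfolded matching_lifts_def X_def[symmetric] Y_def[symmetric] A_def[symmetric] B_def[symmetric],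
            rule_format, OF u v cone uv wf] by blast
      have "r \<cdot> h = z"
      proof (rule pull_eq)
        show "r \<cdot> h \<in> Hom M B P" "z \<in> Hom M B P" using M.Comp_Hom r h z by blast+
        show "p \<cdot> (r \<cdot> h) = p \<cdot> z"
          using M.Comp_assoc[OF h(1) r(1) p] r(2) h(3) by (simp add: v_def)
        have "mX \<cdot> h = w'"
        proof (rule limit_jointly_monic[OF M J FX MX])
          fix f assume f: "f \<in> Obj ?J"
          show "\<pi>X f \<cdot> (mX \<cdot> h) = \<pi>X f \<cdot> w'"
            using M.Comp_assoc[OF h(1) mX(1) \<pi>X[OF f]] h(4) f mX(2) w_def by metis
        qed (use M.Comp_Hom mX h w' in blast)+
        then show "q \<cdot> (r \<cdot> h) = q \<cdot> z"
          using M.Comp_assoc[OF h(1) r(1) q] r(3) by (simp add: w'_def)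
      qed
      then show ?thesis using h by blast
    qed
    then show "has_lifting M i r"
      unfolding has_lifting_def A_def[symmetric] B_def[symmetric] using HomD[OF r(1)] by simp
  qed
qed

text \<open>The retract argument: a map that lifts against its own first factor in a factorization into a trivial
  cofibration and a fibration is a retract of the second factor.\<close>

lemma fibration_iff_lifting:
  fixes M (structure)
  assumes M: "model_category U M" and p: "p \<in> Arr M"
  shows "p \<in> Fib M \<longleftrightarrow> (\<forall>i \<in> Cof M \<inter> Weq M. has_lifting M i p)"
proof
  show "p \<in> Fib M \<Longrightarrow> \<forall>i \<in> Cof M \<inter> Weq M. has_lifting M i p"
    using M unfolding model_category_def by blast
next
  assume lift: "\<forall>i \<in> Cof M \<inter> Weq M. has_lifting M i p"
  interpret category M using M by (simp add: model_category_def)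
  obtain i q where i: "i \<in> Cof M \<inter> Weq M" and q: "q \<in> Fib M" "Dom M q = Cod M i" "q \<cdot> i = p"
    using M p unfolding model_category_def by metis
  have arr: "i \<in> Arr M" "q \<in> Arr M" using M i q unfolding model_category_def by blast+
  note ends = Comp_Arr(2,3)[OF arr q(2), unfolded q(3)]
  note ob = Dom_Obj[OF p] Cod_Obj[OF p]
  have "Ident M (Dom M p) \<in> Hom M (Dom M i) (Dom M p)" "q \<in> Hom M (Cod M i) (Cod M p)"
    using Ident_Hom[OF ob(1)] ends arr q by (auto simp: Hom_iff)
  moreover have "p \<cdot> Ident M (Dom M p) = q \<cdot> i"
    using Comp_Arr_Ident[OF p] q by simp
  ultimately obtain h where h: "h \<in> Hom M (Cod M i) (Dom M p)" "h \<cdot> i = Ident M (Dom M p)" "p \<cdot> h = q"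
    using lift i unfolding has_lifting_def by metis
  have "is_retract M p q"
    unfolding is_retract_def
  proof (intro conjI)
    show "\<exists>i\<in>Hom M (Dom M p) (Dom M q). \<exists>r\<in>Hom M (Dom M q) (Dom M p). \<exists>j\<in>Hom M (Cod M p) (Cod M q).
      \<exists>s\<in>Hom M (Cod M q) (Cod M p). r \<cdot> i = Ident M (Dom M p) \<and> s \<cdot> j = Ident M (Cod M p) \<and>
        q \<cdot> i = j \<cdot> p \<and> p \<cdot> r = s \<cdot> q"
    proof (intro bexI conjI)
      show "h \<cdot> i = Ident M (Dom M p)" by fact
      show "Ident M (Cod M p) \<cdot> Ident M (Cod M p) = Ident M (Cod M p)"
        using Comp_Ident_left[OF Ident_Hom[OF ob(2)]] .
      show "q \<cdot> i = Ident M (Cod M p) \<cdot> p" using Comp_Arr_Ident[OF p] q by simp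
      show "p \<cdot> h = Ident M (Cod M p) \<cdot> q"
        using Comp_Arr_Ident(2)[OF arr(2)] ends h by simp
    qed (use arr ends q h Ident_Hom[OF ob(2)] in \<open>auto simp: Hom_iff\<close>)
  qed (use p arr in auto)
  then show "p \<in> Fib M" using M q unfolding model_category_def by blast
qed

lemma reedy_model_structure_simps [simp]:
  "Obj (reedy_model_structure C M) = functors C M"
  "Arr (reedy_model_structure C M) = nat_transformations C M"
  "Dom (reedy_model_structure C M) = nsrc"
  "Cod (reedy_model_structure C M) = ntgt"
  "Ident (reedy_model_structure C M) = Ident (functor_category C M)"
  "Comp (reedy_model_structure C M) = Comp (functor_category C M)"
  "Weq (reedy_model_structure C M) = {t \<in> nat_transformations C M. \<forall>a \<in> Obj C. nat_at t a \<in> Weq M}"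
  "Fib (reedy_model_structure C M) =
     {t \<in> nat_transformations C M. \<forall>a \<in> Obj C. \<exists>r \<in> Fib M. is_relative_matching_map C M t a r}"
  by (simp_all add: reedy_model_structure_def functor_category_def cat.defs model_cat.defs)

text \<open>A Reedy fibration is asked to have some relative matching map that is a fibration, for some choice of limits and
  pullbacks.  The lifting condition mentions no choice, and some relative matching map exists, so the choice does not
  matter.\<close>

theorem reedy_fibration_iff:
  assumes inf: "infinite (UNIV :: 'u set)" and M: "model_category TYPE('u) M"
    and C: "reedy_category TYPE('u) C" and t: "t \<in> nat_transformations C M"
  shows "t \<in> Fib (reedy_model_structure C M) \<longleftrightarrow>
    (\<forall>a \<in> Obj C. \<forall>i \<in> Cof M \<inter> Weq M. matching_lifts C M t a i)"
proof -
  have catM: "category M" and lim: "has_small_limits TYPE('u) M" and cof: "Cof M \<subseteq> Arr M"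
    using M by (auto simp: model_category_def)
  have "(\<exists>r \<in> Fib M. is_relative_matching_map C M t a r) \<longleftrightarrow> (\<forall>i \<in> Cof M \<inter> Weq M. matching_lifts C M t a i)"
    if a: "a \<in> Obj C" for a
  proof -
    have "r \<in> Fib M \<longleftrightarrow> (\<forall>i \<in> Cof M \<inter> Weq M. matching_lifts C M t a i)"
      if r: "is_relative_matching_map C M t a r" for r
    proof -
      have "r \<in> Arr M" using r by (auto simp: is_relative_matching_map_def Hom_iff)
      then show ?thesis
        using fibration_iff_lifting[OF M] relative_matching_map_lifting[OF C catM t a r] cof by blast
    qed
    then show ?thesis
      using relative_matching_map_exists[OF inf lim C catM t a] by blast
  qed
  then show ?thesis using t by auto
qed


section \<open>Precomposition with a functor\<close>

lemma comp_func_simps: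
  "a \<in> Obj A \<Longrightarrow> fobj (comp_func A F G) a = fobj F (fobj G a)"
  "f \<in> Arr A \<Longrightarrow> farr (comp_func A F G) f = farr F (farr G f)"
  by (simp_all add: comp_func_def)

lemma precomposition_simps:
  "fobj (precomposition C G) X = comp_func C X G"
  "nsrc (farr (precomposition C G) t) = comp_func C (nsrc t) G"
  "ntgt (farr (precomposition C G) t) = comp_func C (ntgt t) G"
  "a \<in> Obj C \<Longrightarrow> nat_at (farr (precomposition C G) t) a = nat_at t (fobj G a)"
  by (simp_all add: precomposition_def)

lemma precomposition_nat_transformation:
  assumes G: "is_functor C D G" and t: "t \<in> nat_transformations D M"
  shows "farr (precomposition C G) t \<in> nat_transformations C M"
proof -
  interpret C: category C using G by (rule functor_maps)
  note T = nat_transformationsD[OF t]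
  note comp = comp_func_functors[OF G functors_functor]
  have "nat_at t (fobj G (Cod C f)) \<cdot>\<^bsub>M\<^esub> farr (nsrc t) (farr G f)
      = farr (ntgt t) (farr G f) \<cdot>\<^bsub>M\<^esub> nat_at t (fobj G (Dom C f))" if "f \<in> Arr C" for f
    using T(4)[OF functor_maps(5)[OF G that]] .
  then show ?thesis
    using comp[OF T(1)] comp[OF T(2)] T(3)[OF functor_maps(3)[OF G]]
    by (simp add: nat_transformations_def precomposition_def comp_func_simps C.Dom_Obj C.Cod_Obj)
qed

lemma category_reedy_model_structure:
  assumes "category C" "category M"
  shows "category (reedy_model_structure C M)"
  using category_functor_category[OF assms] unfolding category_def Hom_def by simp

lemma precomposition_functor:
  assumes G: "is_functor C D G" and M: "category M"
  shows "is_functor (reedy_model_structure D M) (reedy_model_structure C M) (precomposition C G)"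
  unfolding is_functor_def
proof (intro conjI ballI impI)
  interpret C: category C using G by (rule functor_maps)
  note cats = functor_maps(1,2)[OF G]
  show "category (reedy_model_structure D M)" "category (reedy_model_structure C M)"
    using category_reedy_model_structure cats M by blast+
  show "fobj (precomposition C G) X \<in> Obj (reedy_model_structure C M)"
    if "X \<in> Obj (reedy_model_structure D M)" for X
    using that comp_func_functors[OF G functors_functor] by (simp add: precomposition_simps)
  show "farr (precomposition C G) t \<in> Hom (reedy_model_structure C M)
      (fobj (precomposition C G) (Dom (reedy_model_structure D M) t))
      (fobj (precomposition C G) (Cod (reedy_model_structure D M) t))"
    if "t \<in> Arr (reedy_model_structure D M)" for t
    using that precomposition_nat_transformation[OF G] by (simp add: Hom_iff precomposition_simps)
  show "farr (precomposition C G) (Ident (reedy_model_structure D M) X)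
      = Ident (reedy_model_structure C M) (fobj (precomposition C G) X)" for X
    using functor_maps(3)[OF G]
    by (auto simp: precomposition_def comp_func_simps intro!: restrict_ext)
  show "farr (precomposition C G) (t \<cdot>\<^bsub>reedy_model_structure D M\<^esub> s)
      = farr (precomposition C G) t \<cdot>\<^bsub>reedy_model_structure C M\<^esub> farr (precomposition C G) s" for s t
    using functor_maps(3)[OF G]
    by (auto simp: precomposition_def comp_func_simps intro!: restrict_ext)
qed

section \<open>Fibering functors preserve fibrations\<close>

lemma fact_cat_simps [simp]:
  "Obj (fact_cat C D G a s) = fact_obj C D G a s"
  "Arr (fact_cat C D G a s) = {((\<nu>, \<mu>), \<tau>, (\<nu>', \<mu>')).
               (\<nu>, \<mu>) \<in> fact_obj C D G a s \<and> (\<nu>', \<mu>') \<in> fact_obj C D G a s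
             \<and> \<tau> \<in> Inverse C \<and> Dom C \<tau> = Cod C \<nu> \<and> Cod C \<tau> = Cod C \<nu>'
             \<and> \<tau> \<cdot>\<^bsub>C\<^esub> \<nu> = \<nu>' \<and> \<mu>' \<cdot>\<^bsub>D\<^esub> farr G \<tau> = \<mu>}"
  "Dom (fact_cat C D G a s) = (\<lambda>(x, \<tau>, y). x)"
  "Cod (fact_cat C D G a s) = (\<lambda>(x, \<tau>, y). y)"
  "Ident (fact_cat C D G a s) = (\<lambda>x. (x, Ident C (Cod C (fst x)), x))"
  "Comp (fact_cat C D G a s) = (\<lambda>(x', \<tau>', y') (x, \<tau>, y). (x, \<tau>' \<cdot>\<^bsub>C\<^esub> \<tau>, y'))"
  by (simp_all add: fact_cat_def)

lemma category_fact_cat: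
  fixes C (structure)
  assumes C: "reedy_category U C" and D: "reedy_category U D" and G: "reedy_functor C D G"
  shows "category (fact_cat C D G a s)"
proof -
  interpret category C using C by (rule reedy_category_category)
  interpret D: category D using D by (rule reedy_category_category)
  have G': "is_functor C D G" using G by (simp add: reedy_functor_def)
  note inv = Inverse_closed[OF C] and invD = Inverse_closed[OF D]
  let ?F = "fact_cat C D G a s"
  show ?thesis
  proof (rule category_of_triples[OF reedy_category_category[OF C] fact_cat_simps(3-6)])
    fix x \<tau> y assume x: "(x, \<tau>, y) \<in> Arr ?F"
    then show "x \<in> Obj ?F \<and> y \<in> Obj ?F \<and> \<tau> \<in> Hom C (Cod C (fst x)) (Cod C (fst y))"
      using inv(1) by (auto simp: Hom_iff)
    fix \<tau>' z assume y: "(y, \<tau>', z) \<in> Arr ?F"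
    have \<tau>: "\<tau> \<in> Inverse C" "Dom C \<tau> = Cod C (fst x)" "Cod C \<tau> = Cod C (fst y)" "\<tau> \<cdot> fst x = fst y"
        "snd y \<cdot>\<^bsub>D\<^esub> farr G \<tau> = snd x"
      and \<tau>': "\<tau>' \<in> Inverse C" "Dom C \<tau>' = Cod C (fst y)" "Cod C \<tau>' = Cod C (fst z)" "\<tau>' \<cdot> fst y = fst z"
        "snd z \<cdot>\<^bsub>D\<^esub> farr G \<tau>' = snd y"
      using x y by auto
    have \<nu>: "fst x \<in> Arr C" and \<mu>: "snd z \<in> Hom D (fobj G (Cod C (fst z))) (Cod D (snd z))"
      using x y inv(1) invD(1) by (auto simp: fact_obj_def Hom_iff)
    have h: "\<tau> \<in> Hom C (Cod C (fst x)) (Cod C (fst y))" "\<tau>' \<in> Hom C (Cod C (fst y)) (Cod C (fst z))"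
      using \<tau> \<tau>' inv(1) by (auto simp: Hom_iff)
    have "\<tau>' \<cdot> \<tau> \<cdot> fst x = fst z"
      using Comp_Arr_assoc[OF \<nu> HomD(1)[OF h(1)] HomD(1)[OF h(2)] \<tau>(2)] \<tau> \<tau>' by simp
    moreover have "snd z \<cdot>\<^bsub>D\<^esub> farr G (\<tau>' \<cdot> \<tau>) = snd x"
      using D.Comp_assoc[OF functor_maps(4)[OF G' h(1)] functor_maps(4)[OF G' h(2)] \<mu>] \<tau>(5) \<tau>'(5)
        functor_maps(7)[OF G' h] by simp
    ultimately show "(x, \<tau>' \<cdot> \<tau>, z) \<in> Arr ?F"
      using x y inv(3)[OF \<tau>(1) \<tau>'(1)] \<tau> \<tau>' HomD(2,3)[OF Comp_Hom[OF h]] by auto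
  next
    fix x assume x: "x \<in> Obj ?F"
    then have \<nu>: "fst x \<in> Arr C" and \<mu>: "snd x \<in> Arr D" "Dom D (snd x) = fobj G (Cod C (fst x))"
      using inv(1) invD(1) by (auto simp: fact_obj_def)
    show "(x, Ident C (Cod C (fst x)), x) \<in> Arr ?F"
      using x inv(2)[OF Cod_Obj[OF \<nu>]] Ident_Arr[OF Cod_Obj[OF \<nu>]] Comp_Arr_Ident(2)[OF \<nu>]
        functor_maps(6)[OF G' Cod_Obj[OF \<nu>]] D.Comp_Arr_Ident(1)[OF \<mu>(1)] \<mu>(2) by (cases x) simp
  qed
qed

lemma zigzag_invariant:
  assumes "(x, y) \<in> (R \<union> R\<inverse>)\<^sup>*" and "\<And>x y. (x, y) \<in> R \<Longrightarrow> f x = f y"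
  shows "f x = f y"
  using assms(1) by (induction rule: rtrancl_induct) (use assms(2) in auto)

text \<open>This is where the fibering condition enters: a cone over the matching category of \<open>C\<close> extends
  to every inverse arrow \<open>s\<close> that factors through the image of a non-identity inverse arrow.
  Each factorization offers a value, an arrow between factorizations forces the two values to agree,
  and any two factorizations are joined by a zigzag of arrows.\<close>

lemma matching_cone_extension:
  fixes M (structure)
  assumes C: "reedy_category U C" and D: "reedy_category U D"
    and fib: "fibering_reedy_functor C D G" and X: "is_functor D M X" and a: "a \<in> Obj C"
    and w: "is_cone (matching_cat C a) M (matching_diagram C (comp_func C X G)) B w"
  shows "\<exists>W. \<forall>s\<in>Inverse D. Dom D s = fobj G a \<longrightarrow>
      (\<forall>(\<nu>, \<mu>)\<in>fact_obj C D G a s. farr X \<mu> \<cdot> w \<nu> = W s)"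
proof -
  interpret C: category C using C by (rule reedy_category_category)
  interpret D: category D using D by (rule reedy_category_category)
  interpret M: category M using X by (rule functor_maps)
  have rG: "reedy_functor C D G" using fib by (simp add: fibering_reedy_functor_def)
  then have G: "is_functor C D G" by (simp add: reedy_functor_def)
  note invC = Inverse_closed[OF C] and invD = Inverse_closed[OF D]
  have w_Hom: "w \<nu> \<in> Hom M B (fobj X (fobj G (Cod C \<nu>)))" if "\<nu> \<in> Obj (matching_cat C a)" for \<nu>
    using w that C.Cod_Obj invC(1) unfolding matching_cone_iff[OF C] by (auto simp: comp_func_simps)
  have w_eq: "farr X (farr G \<tau>) \<cdot> w \<nu> = w (\<tau> \<cdot>\<^bsub>C\<^esub> \<nu>)"
    if "\<nu> \<in> Obj (matching_cat C a)" "\<tau> \<in> Inverse C" "Dom C \<tau> = Cod C \<nu>" "\<tau> \<cdot>\<^bsub>C\<^esub> \<nu> \<in> Obj (matching_cat C a)" for \<nu> \<tau>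
    using w that invC(1) unfolding matching_cone_iff[OF C] by (auto simp: comp_func_simps)
  define val where "val = (\<lambda>(\<nu>, \<mu>). farr X \<mu> \<cdot> w \<nu>)"
  have val: "val x = val y" if s: "s \<in> Inverse D" "Dom D s = fobj G a"
    and x: "x \<in> fact_obj C D G a s" and y: "y \<in> fact_obj C D G a s" for s x y
  proof -
    let ?F = "fact_cat C D G a s"
    note F = category_fact_cat[OF C D rG, of a s]
    have "sset_empty (nerve ?F) \<or> sset_connected (nerve ?F)"
      using fib a s D.Cod_Obj[OF invD(1)[OF s(1)]] by (auto simp: fibering_reedy_functor_def)
    then have "(x, y) \<in> (arrow_graph ?F \<union> (arrow_graph ?F)\<inverse>)\<^sup>*"
      unfolding sset_empty_nerve[OF F] sset_connected_nerve[OF F] using x y by auto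
    then show ?thesis
    proof (rule zigzag_invariant)
      fix x y assume "(x, y) \<in> arrow_graph ?F"
      then obtain \<nu> \<mu> \<tau> \<nu>' \<mu>' where xy: "x = (\<nu>, \<mu>)" "y = (\<nu>', \<mu>')"
        and ob: "(\<nu>, \<mu>) \<in> fact_obj C D G a s" "(\<nu>', \<mu>') \<in> fact_obj C D G a s"
        and \<tau>: "\<tau> \<in> Inverse C" "Dom C \<tau> = Cod C \<nu>" "Cod C \<tau> = Cod C \<nu>'"
          "\<tau> \<cdot>\<^bsub>C\<^esub> \<nu> = \<nu>'" "\<mu>' \<cdot>\<^bsub>D\<^esub> farr G \<tau> = \<mu>"
        by (auto simp: arrow_graph_def)
      have \<nu>: "\<nu> \<in> Obj (matching_cat C a)" "\<nu>' \<in> Obj (matching_cat C a)"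
        using ob by (auto simp: fact_obj_def)
      have h: "\<tau> \<in> Hom C (Cod C \<nu>) (Cod C \<nu>')" "\<mu>' \<in> Hom D (fobj G (Cod C \<nu>')) (Cod D s)"
        using \<tau> ob(2) invC(1) invD(1) by (auto simp: Hom_iff fact_obj_def)
      note h' = functor_maps(4)[OF G h(1)]
      have "farr X \<mu> \<cdot> w \<nu> = farr X \<mu>' \<cdot> farr X (farr G \<tau>) \<cdot> w \<nu>"
        using functor_maps(7)[OF X h' h(2)] \<tau>(5) by simp
      also have "\<dots> = farr X \<mu>' \<cdot> w \<nu>'"
        using M.Comp_assoc[OF w_Hom[OF \<nu>(1)] functor_maps(4)[OF X h'] functor_maps(4)[OF X h(2)]]
          w_eq[OF \<nu>(1) \<tau>(1,2)] \<nu>(2) \<tau>(4) by simp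
      finally show "val x = val y" by (simp add: val_def xy)
    qed
  qed
  define W where "W s = val (SOME x. x \<in> fact_obj C D G a s)" for s
  have "val x = W s" if "s \<in> Inverse D" "Dom D s = fobj G a" "x \<in> fact_obj C D G a s" for s x
    unfolding W_def by (rule val[OF that]) (rule someI, rule that)
  then show ?thesis by (intro exI[of _ W]) (auto simp: val_def)
qed

text \<open>A lift at \<open>a\<close> is found as one member of a family of compatible lifts \<open>h s\<close>, indexed by all inverse arrows
  \<open>s\<close> out of \<open>G a\<close>, and is the member at the identity.  The family is built by recursion on the degree of the
  codomain of \<open>s\<close>: where \<open>s\<close> factors through the image of a non-identity inverse arrow, the extended cone prescribes \<open>h s\<close>;
  elsewhere \<open>h s\<close> is a lift against the relative matching map at the codomain of \<open>s\<close>.\<close>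

theorem precomposition_matching_lifts:
  fixes C :: "('oc, 'ac, 'y) reedy_scheme" and D :: "('od, 'ad, 'z) reedy_scheme"
    and M (structure)
  assumes C: "reedy_category U C" and D: "reedy_category U D"
    and fib: "fibering_reedy_functor C D G" and M: "category M"
    and t: "t \<in> nat_transformations D M" and i: "i \<in> Arr M"
    and lifts: "\<And>b. b \<in> Obj D \<Longrightarrow> matching_lifts D M t b i"
    and a: "a \<in> Obj C"
  shows "matching_lifts C M (farr (precomposition C G) t) a i"
proof -
  interpret C: category C using C by (rule reedy_category_category)
  interpret D: category D using D by (rule reedy_category_category)
  interpret M: category M by fact
  have rG: "reedy_functor C D G" using fib by (simp add: fibering_reedy_functor_def)
  then have G: "is_functor C D G" by (simp add: reedy_functor_def)
  note invC = Inverse_closed[OF C] and invD = Inverse_closed[OF D]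
  have G_inv: "farr G f \<in> Inverse D" if "f \<in> Inverse C" for f
    using rG that by (simp add: reedy_functor_def)
  define X where "X = nsrc t"
  define Y where "Y = ntgt t"
  define A where "A = Dom M i"
  define B where "B = Cod M i"
  have i: "i \<in> Hom M A B" using i by (simp add: A_def B_def Hom_iff)
  note T = nat_transformationsD[OF t, folded X_def Y_def]
  note X = functors_functor[OF T(1)] and Y = functors_functor[OF T(2)]
  let ?J = "matching_cat C a"
  have lift: "\<exists>h\<in>Hom M B (fobj X (fobj G a)). h \<cdot> i = u \<and> nat_at t (fobj G a) \<cdot> h = v
      \<and> (\<forall>f\<in>Obj ?J. farr X (farr G f) \<cdot> h = w f)"
    if u: "u \<in> Hom M A (fobj X (fobj G a))" and v: "v \<in> Hom M B (fobj Y (fobj G a))"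
      and w: "is_cone ?J M (matching_diagram C (comp_func C X G)) B w"
      and uv: "nat_at t (fobj G a) \<cdot> u = v \<cdot> i"
      and wf: "\<And>f. f \<in> Obj ?J \<Longrightarrow> w f \<cdot> i = farr X (farr G f) \<cdot> u"
        "\<And>f. f \<in> Obj ?J \<Longrightarrow> nat_at t (fobj G (Cod C f)) \<cdot> w f = farr Y (farr G f) \<cdot> v"
    for u v w
  proof -
    \<comment> \<open>\<open>R\<close> singles out the inverse arrows out of \<open>G a\<close>, and \<open>S\<close> those on which the cone prescribes the value \<open>W\<close>.\<close>
    define S where "S s \<longleftrightarrow> fact_obj C D G a s \<noteq> {}" for s
    define R where "R s \<longleftrightarrow> s \<in> Inverse D \<and> Dom D s = fobj G a" for s
    obtain W where W: "\<forall>s\<in>Inverse D. Dom D s = fobj G a \<longrightarrow>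
        (\<forall>(\<nu>, \<mu>)\<in>fact_obj C D G a s. farr X \<mu> \<cdot> w \<nu> = W s)"
      using matching_cone_extension[OF C D fib X a w] ..
    have w_Hom: "w \<nu> \<in> Hom M B (fobj X (fobj G (Cod C \<nu>)))" if "\<nu> \<in> Obj (matching_cat C a)" for \<nu>
      using w that C.Cod_Obj invC(1) unfolding matching_cone_iff[OF C] by (auto simp: comp_func_simps)
    have R_Hom: "s \<in> Hom D (fobj G a) (Cod D s)" if "R s" for s
      using that invD(1) by (simp add: R_def Hom_iff)
    have R_comp: "R (q \<cdot>\<^bsub>D\<^esub> s)" "Cod D (q \<cdot>\<^bsub>D\<^esub> s) = Cod D q" if "R s" "q \<in> Inverse D" "Dom D q = Cod D s" for s q
      using that invD(3) D.Comp_Arr(2,3) invD(1) by (auto simp: R_def)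
    have S_D: "\<exists>\<nu> \<mu>. (\<nu>, \<mu>) \<in> fact_obj C D G a s \<and> W s = farr X \<mu> \<cdot> w \<nu> \<and> \<nu> \<in> Obj ?J
        \<and> \<nu> \<in> Hom C a (Cod C \<nu>) \<and> \<mu> \<in> Inverse D \<and> \<mu> \<in> Hom D (fobj G (Cod C \<nu>)) (Cod D s) \<and> \<mu> \<cdot>\<^bsub>D\<^esub> farr G \<nu> = s"
      if s: "S s" "R s" for s
    proof -
      obtain \<nu> \<mu> where x: "(\<nu>, \<mu>) \<in> fact_obj C D G a s" using s(1) by (auto simp: S_def)
      moreover have "W s = farr X \<mu> \<cdot> w \<nu>" using W s(2) x by (force simp: R_def)
      ultimately show ?thesis
        using invC(1) invD(1) by (intro exI[of _ \<nu>] exI[of _ \<mu>]) (auto simp: fact_obj_def Hom_iff)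
    qed
    have W_Hom: "W s \<in> Hom M B (fobj X (Cod D s))" if s: "S s" "R s" for s
      using S_D[OF that] M.Comp_Hom w_Hom functor_maps(4)[OF X] by metis
    have S_comp: "S (q \<cdot>\<^bsub>D\<^esub> s) \<and> W (q \<cdot>\<^bsub>D\<^esub> s) = farr X q \<cdot> W s"
      if s: "S s" "R s" and q: "q \<in> Inverse D" "Dom D q = Cod D s" for s q
    proof -
      obtain \<nu> \<mu> where x: "(\<nu>, \<mu>) \<in> fact_obj C D G a s" "W s = farr X \<mu> \<cdot> w \<nu>" "\<nu> \<in> Obj ?J"
          "\<nu> \<in> Hom C a (Cod C \<nu>)" "\<mu> \<in> Inverse D" "\<mu> \<in> Hom D (fobj G (Cod C \<nu>)) (Cod D s)" "\<mu> \<cdot>\<^bsub>D\<^esub> farr G \<nu> = s"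
        using S_D[OF s] by blast
      have qh: "q \<in> Hom D (Cod D s) (Cod D q)" using q invD(1) by (simp add: Hom_iff)
      have "q \<cdot>\<^bsub>D\<^esub> \<mu> \<in> Inverse D" using invD(3)[OF x(5) q(1)] q(2) HomD(3)[OF x(6)] by simp
      moreover have "q \<cdot>\<^bsub>D\<^esub> \<mu> \<cdot>\<^bsub>D\<^esub> farr G \<nu> = q \<cdot>\<^bsub>D\<^esub> s"
        using D.Comp_assoc[OF functor_maps(4)[OF G x(4)] x(6) qh] x(7) by simp
      ultimately have y: "(\<nu>, q \<cdot>\<^bsub>D\<^esub> \<mu>) \<in> fact_obj C D G a (q \<cdot>\<^bsub>D\<^esub> s)"
        using x(3) R_comp(2)[OF s(2) q] HomD[OF D.Comp_Hom[OF x(6) qh]] by (simp add: fact_obj_def)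
      then have "W (q \<cdot>\<^bsub>D\<^esub> s) = farr X (q \<cdot>\<^bsub>D\<^esub> \<mu>) \<cdot> w \<nu>"
        using W R_comp(1)[OF s(2) q] by (force simp: R_def)
      also have "\<dots> = farr X q \<cdot> W s"
        using functor_maps(7)[OF X x(6) qh] x(2)
          M.Comp_assoc[OF w_Hom[OF x(3)] functor_maps(4)[OF X x(6)] functor_maps(4)[OF X qh]] by simp
      finally show ?thesis using y by (auto simp: S_def)
    qed
    \<comment> \<open>\<open>r\<close> is an admissible value at \<open>s\<close>, relative to the values of \<open>h\<close> at arrows with codomain of smaller degree.\<close>
    define good where "good h s r \<longleftrightarrow> (R s \<longrightarrow> r \<in> Hom M B (fobj X (Cod D s)) \<and> r \<cdot> i = farr X s \<cdot> u
        \<and> nat_at t (Cod D s) \<cdot> r = farr Y s \<cdot> v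
        \<and> (\<forall>q\<in>Obj (matching_cat D (Cod D s)). farr X q \<cdot> r = h (q \<cdot>\<^bsub>D\<^esub> s))
        \<and> (S s \<longrightarrow> r = W s))" for h s r
    obtain deg :: "'od \<Rightarrow> nat" where deg: "\<forall>f\<in>Inverse D. f \<noteq> Ident D (Dom D f) \<longrightarrow> deg (Cod D f) < deg (Dom D f)"
      using reedy_degree[OF D] ..
    define less where "less = measure (\<lambda>s. deg (Cod D s))"
    have smaller: "(q \<cdot>\<^bsub>D\<^esub> s, s) \<in> less" if "R s" "q \<in> Obj (matching_cat D (Cod D s))" for q s
      using that deg R_comp(2)[of s q] by (auto simp: less_def)
    have "\<exists>h. \<forall>s. good h s (h s)"
    proof (rule dependent_wf_choice)
      show "wf less" by (simp add: less_def)
      show "good f s r = good g s r" if "\<And>z. (z, s) \<in> less \<Longrightarrow> f z = g z" for f g s r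
        using that smaller by (auto simp: good_def)
      show "\<exists>r. good h s r" if IH: "\<And>y. (y, s) \<in> less \<Longrightarrow> good h y (h y)" for s h
      proof (cases "R s")
        case False
        then show ?thesis by (simp add: good_def)
      next
        case R: True
        let ?b = "Cod D s"
        note s = R_Hom[OF R]
        have b: "?b \<in> Obj D" using D.Hom_Obj[OF s] by simp
        have IH': "R (q \<cdot>\<^bsub>D\<^esub> s)" "Cod D (q \<cdot>\<^bsub>D\<^esub> s) = Cod D q" "good h (q \<cdot>\<^bsub>D\<^esub> s) (h (q \<cdot>\<^bsub>D\<^esub> s))"
          if "q \<in> Obj (matching_cat D ?b)" for q
          using R_comp[OF R] smaller[OF R] IH that by auto
        show ?thesis
        proof (cases "S s")
          case S: True
          obtain \<nu> \<mu> where x: "W s = farr X \<mu> \<cdot> w \<nu>" "\<nu> \<in> Obj ?J"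
              "\<nu> \<in> Hom C a (Cod C \<nu>)" "\<mu> \<in> Hom D (fobj G (Cod C \<nu>)) (Cod D s)" "\<mu> \<cdot>\<^bsub>D\<^esub> farr G \<nu> = s"
            using S_D[OF S R] by blast
          note wh = w_Hom[OF x(2)] and G\<nu> = functor_maps(4)[OF G x(3)]
          note Xh = functor_maps(4)[OF X x(4)] functor_maps(4)[OF X G\<nu>] functor_maps(4)[OF Y x(4)] functor_maps(4)[OF Y G\<nu>]
          have gob: "fobj G (Cod C \<nu>) \<in> Obj D" using D.Hom_Obj[OF x(4)] by simp
          have "W s \<cdot> i = farr X \<mu> \<cdot> (farr X (farr G \<nu>) \<cdot> u)"
            using M.Comp_assoc[OF i wh Xh(1)] x(1) wf(1)[OF x(2)] by simp
          also have "\<dots> = farr X s \<cdot> u"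
            using M.Comp_assoc[OF u Xh(2,1)] functor_maps(7)[OF X G\<nu> x(4)] x(5) by simp
          finally have 1: "W s \<cdot> i = farr X s \<cdot> u" .
          have "nat_at t ?b \<cdot> W s = farr Y \<mu> \<cdot> nat_at t (fobj G (Cod C \<nu>)) \<cdot> w \<nu>"
            using M.Comp_assoc[OF wh Xh(1) T(3)[OF b]] T(4)[OF x(4)] x(1) by simp
          also have "\<dots> = farr Y \<mu> \<cdot> (farr Y (farr G \<nu>) \<cdot> v)"
            using M.Comp_assoc[OF wh T(3)[OF gob] Xh(3)] wf(2)[OF x(2)] by simp
          also have "\<dots> = farr Y s \<cdot> v"
            using M.Comp_assoc[OF v Xh(4,3)] functor_maps(7)[OF Y G\<nu> x(4)] x(5) by simp
          finally have 2: "nat_at t ?b \<cdot> W s = farr Y s \<cdot> v" .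
          have "farr X q \<cdot> W s = h (q \<cdot>\<^bsub>D\<^esub> s)" if q: "q \<in> Obj (matching_cat D ?b)" for q
            using S_comp[OF S R, of q] IH'(1,3)[OF q] q by (auto simp: good_def)
          \<comment> \<open>The equation just shown uses that arrows with prescribed values are closed under postcomposition.\<close>
          then have "good h s (W s)"
            using 1 2 W_Hom[OF S R] by (simp add: good_def)
          then show ?thesis ..
        next
          case nS: False
          have IHq: "h (q \<cdot>\<^bsub>D\<^esub> s) \<in> Hom M B (fobj X (Cod D q))"
              "h (q \<cdot>\<^bsub>D\<^esub> s) \<cdot> i = farr X (q \<cdot>\<^bsub>D\<^esub> s) \<cdot> u"
              "nat_at t (Cod D q) \<cdot> h (q \<cdot>\<^bsub>D\<^esub> s) = farr Y (q \<cdot>\<^bsub>D\<^esub> s) \<cdot> v"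
              "\<And>k. k \<in> Obj (matching_cat D (Cod D q)) \<Longrightarrow> farr X k \<cdot> h (q \<cdot>\<^bsub>D\<^esub> s) = h (k \<cdot>\<^bsub>D\<^esub> (q \<cdot>\<^bsub>D\<^esub> s))"
            if q: "q \<in> Obj (matching_cat D ?b)" for q
            using IH'[OF q] unfolding good_def by simp_all
          have qh: "q \<in> Hom D ?b (Cod D q)" if q: "q \<in> Obj (matching_cat D ?b)" for q
            using q invD(1) by (simp add: Hom_iff)
          have cone: "is_cone (matching_cat D ?b) M (matching_diagram D X) B (\<lambda>q. h (q \<cdot>\<^bsub>D\<^esub> s))"
            unfolding matching_cone_iff[OF D]
          proof (intro conjI ballI impI)
            show "B \<in> Obj M" using M.Hom_Obj[OF i] by simp
            fix q assume q: "q \<in> Obj (matching_cat D ?b)"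
            show "h (q \<cdot>\<^bsub>D\<^esub> s) \<in> Hom M B (fobj X (Cod D q))" using IHq(1)[OF q] .
            fix k assume k: "k \<in> Inverse D" "Dom D k = Cod D q"
            have kh: "k \<in> Hom D (Cod D q) (Cod D k)" using k invD(1) by (simp add: Hom_iff)
            have assoc: "k \<cdot>\<^bsub>D\<^esub> (q \<cdot>\<^bsub>D\<^esub> s) = k \<cdot>\<^bsub>D\<^esub> q \<cdot>\<^bsub>D\<^esub> s"
              using D.Comp_assoc[OF s qh[OF q] kh] .
            show "farr X k \<cdot> h (q \<cdot>\<^bsub>D\<^esub> s) = h (k \<cdot>\<^bsub>D\<^esub> q \<cdot>\<^bsub>D\<^esub> s)"
            proof (cases "k = Ident D (Cod D q)")
              case False
              then show ?thesis using IHq(4)[OF q, of k] k assoc by simp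
            next
              case True
              have ob: "Cod D q \<in> Obj D" using D.Hom_Obj[OF qh[OF q]] by simp
              show ?thesis
                unfolding True functor_maps(6)[OF X ob] D.Comp_Ident_left[OF qh[OF q]]
                using M.Comp_Ident_left[OF IHq(1)[OF q]] .
            qed
          qed
          note sX = functor_maps(4)[OF X s] and sY = functor_maps(4)[OF Y s]
          note Ga = functor_maps(3)[OF G a]
          have u': "farr X s \<cdot> u \<in> Hom M A (fobj X ?b)" using M.Comp_Hom[OF u sX] .
          have v': "farr Y s \<cdot> v \<in> Hom M B (fobj Y ?b)" using M.Comp_Hom[OF v sY] .
          have uv': "nat_at t ?b \<cdot> (farr X s \<cdot> u) = farr Y s \<cdot> v \<cdot> i"
            using M.Comp_assoc[OF u sX T(3)[OF b]] T(4)[OF s] M.Comp_assoc[OF u T(3)[OF Ga] sY] uv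
              M.Comp_assoc[OF i v sY] by simp
          have wf': "h (q \<cdot>\<^bsub>D\<^esub> s) \<cdot> i = farr X q \<cdot> (farr X s \<cdot> u)
              \<and> nat_at t (Cod D q) \<cdot> h (q \<cdot>\<^bsub>D\<^esub> s) = farr Y q \<cdot> (farr Y s \<cdot> v)"
            if q: "q \<in> Obj (matching_cat D ?b)" for q
            using IHq(2,3)[OF q] functor_maps(7)[OF X s qh[OF q]] functor_maps(7)[OF Y s qh[OF q]]
              M.Comp_assoc[OF u sX functor_maps(4)[OF X qh[OF q]]]
              M.Comp_assoc[OF v sY functor_maps(4)[OF Y qh[OF q]]] by simp
          have "\<exists>r\<in>Hom M B (fobj X ?b). r \<cdot> i = farr X s \<cdot> u \<and> nat_at t ?b \<cdot> r = farr Y s \<cdot> v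
              \<and> (\<forall>q\<in>Obj (matching_cat D ?b). farr X q \<cdot> r = h (q \<cdot>\<^bsub>D\<^esub> s))"
            using lifts[OF b, unfolded matching_lifts_def X_def[symmetric] Y_def[symmetric] A_def[symmetric] B_def[symmetric],
              rule_format, OF u' v' cone uv' wf'] .
          then show ?thesis using nS by (auto simp: good_def)
        qed
      qed
    qed
    then obtain h where h: "\<And>s. good h s (h s)" by blast
    let ?id = "Ident D (fobj G a)"
    note Ga = functor_maps(3)[OF G a]
    have Rid: "R ?id" "Cod D ?id = fobj G a" using invD(2)[OF Ga] D.Ident_Arr[OF Ga] by (auto simp: R_def)
    note hid = h[of ?id, unfolded good_def Rid(2), rule_format, OF Rid(1)]
    show ?thesis
    proof (intro bexI conjI ballI)
      show "h ?id \<in> Hom M B (fobj X (fobj G a))" using hid by simp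
      show "h ?id \<cdot> i = u"
        using hid functor_maps(6)[OF X Ga] M.Comp_Ident_left[OF u] by simp
      show "nat_at t (fobj G a) \<cdot> h ?id = v"
        using hid functor_maps(6)[OF Y Ga] M.Comp_Ident_left[OF v] by simp
      fix f assume f: "f \<in> Obj ?J"
      have fh: "f \<in> Hom C a (Cod C f)" using f invC(1) by (simp add: Hom_iff)
      note Gf = functor_maps(4)[OF G fh]
      have ob: "fobj G (Cod C f) \<in> Obj D" using D.Hom_Obj[OF Gf] by simp
      have RGf: "R (farr G f)" using G_inv f HomD[OF Gf] by (simp add: R_def)
      have x: "(f, Ident D (fobj G (Cod C f))) \<in> fact_obj C D G a (farr G f)"
        using f invD(2)[OF ob] D.Ident_Arr[OF ob] HomD[OF Gf] D.Comp_Ident_left[OF Gf] by (simp add: fact_obj_def)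
      have "W (farr G f) = farr X (Ident D (fobj G (Cod C f))) \<cdot> w f"
        using W RGf x by (force simp: R_def)
      also have "\<dots> = w f"
        using functor_maps(6)[OF X ob] M.Comp_Ident_left[OF w_Hom[OF f]] by simp
      finally have Ww: "W (farr G f) = w f" .
      have SGf: "S (farr G f)" using x by (auto simp: S_def)
      have hGf: "h (farr G f) = w f" using h[of "farr G f"] RGf SGf Ww by (simp add: good_def)
      show "farr X (farr G f) \<cdot> h ?id = w f"
      proof (cases "farr G f = ?id")
        case True
        then show ?thesis
          using hGf hid functor_maps(6)[OF X Ga] M.Comp_Ident_left[of "h ?id" B "fobj X (fobj G a)"] by simp
      next
        case False
        then have "farr X (farr G f) \<cdot> h ?id = h (farr G f \<cdot>\<^bsub>D\<^esub> ?id)"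
          using hid RGf by (simp add: R_def)
        then show ?thesis using hGf D.Comp_Ident_right[OF Gf] by simp
      qed
    qed
  qed
  show ?thesis
    unfolding matching_lifts_def precomposition_simps X_def[symmetric] Y_def[symmetric] A_def[symmetric] B_def[symmetric]
  proof (intro ballI allI impI)
    fix u v w assume u: "u \<in> Hom M A (fobj (comp_func C X G) a)" and v: "v \<in> Hom M B (fobj (comp_func C Y G) a)"
      and w: "is_cone ?J M (matching_diagram C (comp_func C X G)) B w"
      and uv: "nat_at (farr (precomposition C G) t) a \<cdot> u = v \<cdot> i"
      and wf: "\<forall>f\<in>Obj ?J. w f \<cdot> i = farr (comp_func C X G) f \<cdot> u
         \<and> nat_at (farr (precomposition C G) t) (Cod C f) \<cdot> w f = farr (comp_func C Y G) f \<cdot> v"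
    have f: "f \<in> Arr C" "Cod C f \<in> Obj C" if "f \<in> Obj ?J" for f
      using that invC(1) C.Cod_Obj by auto
    have "\<exists>h\<in>Hom M B (fobj X (fobj G a)). h \<cdot> i = u \<and> nat_at t (fobj G a) \<cdot> h = v
      \<and> (\<forall>f\<in>Obj ?J. farr X (farr G f) \<cdot> h = w f)"
    proof (rule lift[OF _ _ w])
      show "w f \<cdot> i = farr X (farr G f) \<cdot> u" "nat_at t (fobj G (Cod C f)) \<cdot> w f = farr Y (farr G f) \<cdot> v"
        if "f \<in> Obj ?J" for f
        using wf[rule_format, OF that] f[OF that] by (simp_all add: comp_func_simps precomposition_simps)
    qed (use u v uv a in \<open>simp_all add: comp_func_simps precomposition_simps\<close>)
    then obtain h where h: "h \<in> Hom M B (fobj X (fobj G a))" "h \<cdot> i = u" "nat_at t (fobj G a) \<cdot> h = v"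
      "\<forall>f\<in>Obj ?J. farr X (farr G f) \<cdot> h = w f" by blast
    show "\<exists>h\<in>Hom M B (fobj (comp_func C X G) a). h \<cdot> i = u
        \<and> nat_at (farr (precomposition C G) t) a \<cdot> h = v
        \<and> (\<forall>f\<in>Obj ?J. farr (comp_func C X G) f \<cdot> h = w f)"
    proof (intro bexI conjI ballI)
      show "farr (comp_func C X G) f \<cdot> h = w f" if "f \<in> Obj ?J" for f
        using h(4)[rule_format, OF that] f[OF that] by (simp add: comp_func_simps)
    qed (use h a in \<open>simp_all add: comp_func_simps precomposition_simps\<close>)
  qed
qed


section \<open>The left adjoint of precomposition\<close>

lemma has_left_adjointI:
  fixes B (structure)
  assumes R: "is_functor A B R"
    and univ: "\<And>b. b \<in> Obj B \<Longrightarrow> \<exists>a\<in>Obj A. \<exists>\<eta>\<in>Hom B b (fobj R a). \<forall>a'\<in>Obj A. \<forall>g\<in>Hom B b (fobj R a').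
      \<exists>!f. f \<in> Hom A a a' \<and> farr R f \<cdot> \<eta> = g"
  shows "has_left_adjoint A B R"
proof -
  interpret A: category A using R by (rule functor_maps)
  interpret B: category B using R by (rule functor_maps)
  define univ_at where "univ_at b x \<longleftrightarrow> fst x \<in> Obj A \<and> snd x \<in> Hom B b (fobj R (fst x)) \<and> (\<forall>a'\<in>Obj A. \<forall>g\<in>Hom B b (fobj R a').
      \<exists>!f. f \<in> Hom A (fst x) a' \<and> farr R f \<cdot> snd x = g)" for b x
  have "\<forall>b\<in>Obj B. \<exists>x. univ_at b x"
  proof
    fix b assume "b \<in> Obj B"
    from univ[OF this] show "\<exists>x. univ_at b x"
      unfolding univ_at_def split_paired_Ex fst_conv snd_conv by (simp only: Bex_def ex_simps)
  qed
  then obtain x where "\<forall>b\<in>Obj B. univ_at b (x b)"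
    using bchoice[of "Obj B" univ_at] by auto
  note x = this[unfolded univ_at_def]
  define L where "L b = fst (x b)" for b
  define \<eta> where "\<eta> b = snd (x b)" for b
  have L: "L b \<in> Obj A" and \<eta>: "\<eta> b \<in> Hom B b (fobj R (L b))"
    and ex1: "\<And>a' g. a' \<in> Obj A \<Longrightarrow> g \<in> Hom B b (fobj R a') \<Longrightarrow> \<exists>!f. f \<in> Hom A (L b) a' \<and> farr R f \<cdot> \<eta> b = g"
    if "b \<in> Obj B" for b
    using bspec[OF x that] by (simp_all add: L_def \<eta>_def)
  have eqI: "f = f'" if "b \<in> Obj B" "a \<in> Obj A" "f \<in> Hom A (L b) a" "f' \<in> Hom A (L b) a"
      "farr R f \<cdot> \<eta> b = farr R f' \<cdot> \<eta> b" for b a f f'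
  proof -
    have "farr R f \<cdot> \<eta> b \<in> Hom B b (fobj R a)"
      using B.Comp_Hom[OF \<eta>[OF that(1)] functor_maps(4)[OF R that(3)]] .
    from ex1_implies_eq[OF ex1[OF that(1,2) this]] show ?thesis using that by simp
  qed
  define l where "l g = (THE f. f \<in> Hom A (L (Dom B g)) (L (Cod B g)) \<and> farr R f \<cdot> \<eta> (Dom B g) = \<eta> (Cod B g) \<cdot> g)" for g
  have l: "l g \<in> Hom A (L b) (L c)" "farr R (l g) \<cdot> \<eta> b = \<eta> c \<cdot> g" if g: "g \<in> Hom B b c" for g b c
  proof -
    note ob = B.Hom_Obj[OF g]
    have "l g \<in> Hom A (L b) (L c) \<and> farr R (l g) \<cdot> \<eta> b = \<eta> c \<cdot> g"
      using theI'[OF ex1[OF ob(1) L[OF ob(2)] B.Comp_Hom[OF g \<eta>[OF ob(2)]]]] HomD[OF g]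
      by (simp add: l_def)
    then show "l g \<in> Hom A (L b) (L c)" "farr R (l g) \<cdot> \<eta> b = \<eta> c \<cdot> g" by auto
  qed
  define F where "F = \<lparr>fobj = L, farr = l\<rparr>"
  have F: "is_functor B A F"
    unfolding is_functor_def F_def func.simps
  proof (intro conjI ballI impI)
    show "l g \<in> Hom A (L (Dom B g)) (L (Cod B g))" if "g \<in> Arr B" for g
      using l(1)[OF Arr_Hom[OF that]] .
    show "l (Ident B b) = Ident A (L b)" if b: "b \<in> Obj B" for b
    proof (rule eqI[OF b L[OF b]])
      show "l (Ident B b) \<in> Hom A (L b) (L b)" "Ident A (L b) \<in> Hom A (L b) (L b)"
        using l(1)[OF B.Ident_Hom[OF b]] A.Ident_Hom[OF L[OF b]] by auto
      show "farr R (l (Ident B b)) \<cdot> \<eta> b = farr R (Ident A (L b)) \<cdot> \<eta> b"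
        using l(2)[OF B.Ident_Hom[OF b]] functor_maps(6)[OF R L[OF b]] B.Comp_Ident_left[OF \<eta>[OF b]]
          B.Comp_Ident_right[OF \<eta>[OF b]] by simp
    qed
    show "l (g \<cdot> f) = l g \<cdot>\<^bsub>A\<^esub> l f" if "f \<in> Arr B" "g \<in> Arr B" "Dom B g = Cod B f" for f g
    proof -
      have f: "f \<in> Hom B (Dom B f) (Cod B f)" and g: "g \<in> Hom B (Cod B f) (Cod B g)"
        using that by (simp_all add: Hom_iff)
      note ob = B.Hom_Obj[OF f] B.Hom_Obj[OF g]
      note Rf = functor_maps(4)[OF R l(1)[OF f]] and Rg = functor_maps(4)[OF R l(1)[OF g]]
      show ?thesis
      proof (rule eqI[OF ob(1) L[OF ob(4)] l(1)[OF B.Comp_Hom[OF f g]] A.Comp_Hom[OF l(1)[OF f] l(1)[OF g]]])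
        have "farr R (l g \<cdot>\<^bsub>A\<^esub> l f) \<cdot> \<eta> (Dom B f) = farr R (l g) \<cdot> (\<eta> (Cod B f) \<cdot> f)"
          using functor_maps(7)[OF R l(1)[OF f] l(1)[OF g]] B.Comp_assoc[OF \<eta>[OF ob(1)] Rf Rg] l(2)[OF f] by simp
        also have "\<dots> = \<eta> (Cod B g) \<cdot> (g \<cdot> f)"
          using B.Comp_assoc[OF f \<eta>[OF ob(2)] Rg] l(2)[OF g] B.Comp_assoc[OF f g \<eta>[OF ob(4)]] by simp
        finally show "farr R (l (g \<cdot> f)) \<cdot> \<eta> (Dom B f) = farr R (l g \<cdot>\<^bsub>A\<^esub> l f) \<cdot> \<eta> (Dom B f)"
          using l(2)[OF B.Comp_Hom[OF f g]] by simp
      qed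
    qed
  qed (use A.category_axioms B.category_axioms L in auto)
  define \<phi> where "\<phi> b a f = farr R f \<cdot> \<eta> b" for b and a :: 'a and f
  have "adjunction A B F R"
    unfolding adjunction_def
  proof (intro conjI exI[of _ \<phi>] ballI F R)
    fix b a assume b: "b \<in> Obj B" and a: "a \<in> Obj A"
    have "\<phi> b a f \<in> Hom B b (fobj R a)" if f: "f \<in> Hom A (L b) a" for f
      using B.Comp_Hom[OF \<eta>[OF b] functor_maps(4)[OF R f]] by (simp add: \<phi>_def)
    moreover have "inj_on (\<phi> b a) (Hom A (L b) a)"
      by (rule inj_onI) (rule eqI[OF b a], simp_all add: \<phi>_def)
    moreover have "g \<in> \<phi> b a ` Hom A (L b) a" if g: "g \<in> Hom B b (fobj R a)" for g
    proof -
      obtain f where "f \<in> Hom A (L b) a \<and> farr R f \<cdot> \<eta> b = g"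
        using ex1[OF b a g] by (rule ex1E)
      then show ?thesis by (auto simp: \<phi>_def)
    qed
    ultimately show "bij_betw (\<phi> b a) (Hom A (fobj F b) a) (Hom B b (fobj R a))"
      unfolding bij_betw_def by (auto simp: F_def)
  next
    fix g h f assume "g \<in> Arr B" "h \<in> Arr A" and f: "f \<in> Hom A (fobj F (Cod B g)) (Dom A h)"
    then have g: "g \<in> Hom B (Dom B g) (Cod B g)" and h: "h \<in> Hom A (Dom A h) (Cod A h)"
      by (simp_all add: Hom_iff)
    have f: "f \<in> Hom A (L (Cod B g)) (Dom A h)" using f by (simp add: F_def)
    note ob = B.Hom_Obj[OF g]
    note lg = l(1)[OF g]
    note R' = functor_maps(4)[OF R f] functor_maps(4)[OF R h] functor_maps(4)[OF R lg]
    have "farr R (h \<cdot>\<^bsub>A\<^esub> (f \<cdot>\<^bsub>A\<^esub> l g)) = farr R h \<cdot> (farr R f \<cdot> farr R (l g))"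
      using functor_maps(7)[OF R A.Comp_Hom[OF lg f] h] functor_maps(7)[OF R lg f] by simp
    then have "farr R (h \<cdot>\<^bsub>A\<^esub> (f \<cdot>\<^bsub>A\<^esub> l g)) \<cdot> \<eta> (Dom B g)
        = farr R h \<cdot> (farr R f \<cdot> (\<eta> (Cod B g) \<cdot> g))"
      using B.Comp_assoc[OF \<eta>[OF ob(1)] B.Comp_Hom[OF R'(3,1)] R'(2)]
        B.Comp_assoc[OF \<eta>[OF ob(1)] R'(3,1)] l(2)[OF g] by simp
    then show "\<phi> (Dom B g) (Cod A h) (h \<cdot>\<^bsub>A\<^esub> (f \<cdot>\<^bsub>A\<^esub> farr F g))
        = farr R h \<cdot> (\<phi> (Cod B g) (Dom A h) f \<cdot> g)"
      using B.Comp_assoc[OF g \<eta>[OF ob(2)] R'(1)] by (simp add: \<phi>_def F_def)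
  qed
  then show ?thesis by (auto simp: has_left_adjoint_def)
qed

text \<open>An object over \<open>b\<close> records its object \<open>a\<close> of \<open>C\<close>, which the arrow \<open>s : G a \<rightarrow> b\<close> does not determine.\<close>

definition comma_cat ::
  "('o1, 'a1, 'y) cat_scheme \<Rightarrow> ('o2, 'a2, 'z) cat_scheme \<Rightarrow> ('o1, 'a1, 'o2, 'a2) func \<Rightarrow> 'o2
     \<Rightarrow> ('o1 \<times> 'a2, ('o1 \<times> 'a2) \<times> 'a1 \<times> ('o1 \<times> 'a2)) cat" where
  "comma_cat C D G b =
     \<lparr>Obj = {(a, s). a \<in> Obj C \<and> s \<in> Hom D (fobj G a) b},
      Arr = {((a, s), f, (a', s')). s' \<in> Hom D (fobj G a') b \<and> f \<in> Hom C a a' \<and> s' \<cdot>\<^bsub>D\<^esub> farr G f = s},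
      Dom = (\<lambda>(x, f, y). x),
      Cod = (\<lambda>(x, f, y). y),
      Ident = (\<lambda>x. (x, Ident C (fst x), x)),
      Comp = (\<lambda>(x', f', y') (x, f, y). (x, f' \<cdot>\<^bsub>C\<^esub> f, y'))\<rparr>"

definition comma_diagram :: "('o1, 'a1, 'o3, 'a3) func \<Rightarrow> ('o1 \<times> 'a2, ('o1 \<times> 'a2) \<times> 'a1 \<times> ('o1 \<times> 'a2), 'o3, 'a3) func" where
  "comma_diagram X = \<lparr>fobj = (\<lambda>(a, s). fobj X a), farr = (\<lambda>(x, f, y). farr X f)\<rparr>"

lemma comma_cat_simps [simp]:
  "Obj (comma_cat C D G b) = {(a, s). a \<in> Obj C \<and> s \<in> Hom D (fobj G a) b}"
  "Arr (comma_cat C D G b) = {((a, s), f, (a', s')). s' \<in> Hom D (fobj G a') b \<and> f \<in> Hom C a a' \<and> s' \<cdot>\<^bsub>D\<^esub> farr G f = s}"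
  "Dom (comma_cat C D G b) = (\<lambda>(x, f, y). x)"
  "Cod (comma_cat C D G b) = (\<lambda>(x, f, y). y)"
  "Ident (comma_cat C D G b) = (\<lambda>x. (x, Ident C (fst x), x))"
  "Comp (comma_cat C D G b) = (\<lambda>(x', f', y') (x, f, y). (x, f' \<cdot>\<^bsub>C\<^esub> f, y'))"
  by (simp_all add: comma_cat_def)

lemma category_comma_cat:
  fixes D (structure)
  assumes G: "is_functor C D G"
  shows "category (comma_cat C D G b)"
proof -
  interpret C: category C using G by (rule functor_maps)
  interpret D: category D using G by (rule functor_maps)
  let ?F = "comma_cat C D G b"
  show ?thesis
  proof (rule category_of_triples[OF C.category_axioms comma_cat_simps(3-6)])
    fix x f y assume x: "(x, f, y) \<in> Arr ?F"
    then have f: "f \<in> Hom C (fst x) (fst y)" "snd y \<in> Hom D (fobj G (fst y)) b" "snd y \<cdot> farr G f = snd x" by auto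
    show "x \<in> Obj ?F \<and> y \<in> Obj ?F \<and> f \<in> Hom C (fst x) (fst y)"
      using f C.Hom_Obj[OF f(1)] D.Comp_Hom[OF functor_maps(4)[OF G f(1)] f(2)] by auto
    fix g z assume "(y, g, z) \<in> Arr ?F"
    then have g: "g \<in> Hom C (fst y) (fst z)" "snd z \<in> Hom D (fobj G (fst z)) b" "snd z \<cdot> farr G g = snd y" by auto
    have "snd z \<cdot> farr G (g \<cdot>\<^bsub>C\<^esub> f) = snd x"
      using functor_maps(7)[OF G f(1) g(1)] D.Comp_assoc[OF functor_maps(4)[OF G f(1)] functor_maps(4)[OF G g(1)] g(2)] f(3) g(3)
      by simp
    then show "(x, g \<cdot>\<^bsub>C\<^esub> f, z) \<in> Arr ?F" using g(2) C.Comp_Hom[OF f(1) g(1)] by (cases x; cases z) simp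
  next
    fix x assume "x \<in> Obj ?F"
    then show "(x, Ident C (fst x), x) \<in> Arr ?F"
      using C.Ident_Hom functor_maps(6)[OF G] D.Comp_Ident_right by (cases x) auto
  qed
qed

lemma small_comma_cat:
  fixes C :: "('o1, 'a1, 'y) cat_scheme" and D :: "('o2, 'a2, 'z) cat_scheme"
  assumes inf: "infinite (UNIV :: 'u set)" and C: "small_category TYPE('u) C" and D: "small_category TYPE('u) D"
    and G: "is_functor C D G"
  shows "small_category TYPE('u) (comma_cat C D G b)"
proof -
  interpret C: category C using G by (rule functor_maps)
  interpret D: category D using G by (rule functor_maps)
  obtain p :: "'u \<times> 'u \<Rightarrow> 'u" where p: "inj p" using infinite_pairing[OF inf] .
  obtain e :: "'a1 \<Rightarrow> 'u" where e: "inj_on e (Arr C)"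
    using C unfolding small_category_def by blast
  obtain e' :: "'a2 \<Rightarrow> 'u" where e': "inj_on e' (Arr D)"
    using D unfolding small_category_def by blast
  have "inj_on (\<lambda>(x, f, y). p (e f, e' (snd y))) (Arr (comma_cat C D G b))"
  proof (rule inj_onI)
    fix x y assume "x \<in> Arr (comma_cat C D G b)" "y \<in> Arr (comma_cat C D G b)"
      and eq: "(\<lambda>(x, f, y). p (e f, e' (snd y))) x = (\<lambda>(x, f, y). p (e f, e' (snd y))) y"
    moreover obtain a s f a' s' b t g b' t' where xy: "x = ((a, s), f, (a', s'))" "y = ((b, t), g, (b', t'))"
      by (metis prod.exhaust)
    ultimately have h: "f \<in> Arr C" "g \<in> Arr C" "Dom C f = a" "Cod C f = a'" "Dom C g = b" "Cod C g = b'"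
        "s' \<in> Arr D" "t' \<in> Arr D" "s = s' \<cdot>\<^bsub>D\<^esub> farr G f" "t = t' \<cdot>\<^bsub>D\<^esub> farr G g"
      by (simp_all add: Hom_iff)
    have "e f = e g" "e' s' = e' t'" using eq unfolding xy by (simp_all add: inj_eq[OF p])
    then have "f = g" "s' = t'" using h inj_on_eq_iff[OF e] inj_on_eq_iff[OF e'] by simp_all
    then show "x = y" using h by (simp add: xy)
  qed
  then show ?thesis using category_comma_cat[OF G] by (auto simp: small_category_def)
qed

lemma comma_diagram_functor:
  assumes G: "is_functor C D G" and X: "is_functor C M X"
  shows "is_functor (comma_cat C D G b) M (comma_diagram X)"
  unfolding is_functor_def
proof (intro conjI ballI impI)
  show "category (comma_cat C D G b)" "category M"
    using category_comma_cat[OF G] functor_maps(2)[OF X] by auto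
  show "farr (comma_diagram X) x \<in> Hom M (fobj (comma_diagram X) (Dom (comma_cat C D G b) x))
      (fobj (comma_diagram X) (Cod (comma_cat C D G b) x))" if "x \<in> Arr (comma_cat C D G b)" for x
    using that functor_maps(4)[OF X] by (auto simp: comma_diagram_def)
  show "farr (comma_diagram X) (y \<cdot>\<^bsub>comma_cat C D G b\<^esub> x) = farr (comma_diagram X) y \<cdot>\<^bsub>M\<^esub> farr (comma_diagram X) x"
    if "x \<in> Arr (comma_cat C D G b)" "y \<in> Arr (comma_cat C D G b)"
      "Dom (comma_cat C D G b) y = Cod (comma_cat C D G b) x" for x y
    using that functor_maps(7)[OF X] by (cases x; cases y) (auto simp: comma_diagram_def)
qed (use functor_maps[OF X] in \<open>auto simp: comma_diagram_def\<close>)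

lemma comma_cocone_iff:
  assumes G: "is_functor C D G"
  shows "is_cocone (comma_cat C D G b) M (comma_diagram X) K q \<longleftrightarrow> K \<in> Obj M
    \<and> (\<forall>a\<in>Obj C. \<forall>s\<in>Hom D (fobj G a) b. q (a, s) \<in> Hom M (fobj X a) K)
    \<and> (\<forall>a a'. \<forall>f\<in>Hom C a a'. \<forall>s\<in>Hom D (fobj G a') b. q (a', s) \<cdot>\<^bsub>M\<^esub> farr X f = q (a, s \<cdot>\<^bsub>D\<^esub> farr G f))"
  unfolding is_cocone_def comma_diagram_def by auto

text \<open>The left adjoint is the left Kan extension along \<open>G\<close>, whose value at \<open>b\<close> is the colimit of \<open>X\<close> over the comma category
  \<open>G \<down> b\<close>, with injections \<open>\<iota> b a s\<close>.  The unit \<open>e a\<close> is the injection at the identity of \<open>G a\<close>.  It is universal because every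
  injection is the unit followed by the action \<open>k s\<close> of an arrow, so that a transformation out of the extension is determined
  by its composite with the unit.\<close>

theorem precomposition_has_left_adjoint:
  fixes C :: "('oc, 'ac, 'y) reedy_scheme" and D :: "('od, 'ad, 'z) reedy_scheme"
    and M :: "('om, 'am, 'w) model_cat_scheme" (structure)
  assumes inf: "infinite (UNIV :: 'u set)" and C: "small_category TYPE('u) C" and D: "small_category TYPE('u) D"
    and G: "is_functor C D G" and M: "category M" and colim: "has_small_colimits TYPE('u) M"
  shows "has_left_adjoint (reedy_model_structure D M) (reedy_model_structure C M) (precomposition C G)"
proof (rule has_left_adjointI[OF precomposition_functor[OF G M]])
  interpret C: category C using G by (rule functor_maps)
  interpret D: category D using G by (rule functor_maps)
  interpret M: category M by fact
  let ?DM = "reedy_model_structure D M" and ?CM = "reedy_model_structure C M"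
  interpret DM: category ?DM by (rule category_reedy_model_structure) unfold_locales
  interpret CM: category ?CM by (rule category_reedy_model_structure) unfold_locales
  let ?J = "comma_cat C D G"
  fix X assume "X \<in> Obj ?CM"
  then have XF: "X \<in> functors C M" by simp
  note X = functors_functor[OF XF]
  note FX = comma_diagram_functor[OF G X]
  have "\<exists>x. is_colimit (?J b) M (comma_diagram X) (fst x) (snd x)" for b
    using small_colimit_exists[OF colim small_comma_cat[OF inf C D G, of b] FX] by auto
  then obtain c where c: "is_colimit (?J b) M (comma_diagram X) (fst (c b)) (snd (c b))" for b
    by metis
  define L where "L b = fst (c b)" for b
  define \<iota> where "\<iota> b a s = snd (c b) (a, s)" for b a s
  have L: "is_colimit (?J b) M (comma_diagram X) (L b) (\<lambda>(a, s). \<iota> b a s)" for b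
    using c[of b] by (simp add: L_def \<iota>_def)
  have \<iota>: "L b \<in> Obj M" "\<And>a s. a \<in> Obj C \<Longrightarrow> s \<in> Hom D (fobj G a) b \<Longrightarrow> \<iota> b a s \<in> Hom M (fobj X a) (L b)"
      "\<And>a a' f s. f \<in> Hom C a a' \<Longrightarrow> s \<in> Hom D (fobj G a') b \<Longrightarrow> \<iota> b a' s \<cdot> farr X f = \<iota> b a (s \<cdot>\<^bsub>D\<^esub> farr G f)" for b
    using L[of b] unfolding is_colimit_def comma_cocone_iff[OF G] by auto
  have desc: "\<exists>u\<in>Hom M (L b) K. \<forall>a\<in>Obj C. \<forall>s\<in>Hom D (fobj G a) b. u \<cdot> \<iota> b a s = q a s"
    if "K \<in> Obj M" "\<And>a s. a \<in> Obj C \<Longrightarrow> s \<in> Hom D (fobj G a) b \<Longrightarrow> q a s \<in> Hom M (fobj X a) K"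
      "\<And>a a' f s. f \<in> Hom C a a' \<Longrightarrow> s \<in> Hom D (fobj G a') b \<Longrightarrow> q a' s \<cdot> farr X f = q a (s \<cdot>\<^bsub>D\<^esub> farr G f)"
    for b K q
  proof -
    have "is_cocone (?J b) M (comma_diagram X) K (\<lambda>(a, s). q a s)"
      unfolding comma_cocone_iff[OF G] using that by auto
    from colimit_map_exists[OF L this] show ?thesis by fastforce
  qed
  have epic: "u = u'" if "u \<in> Hom M (L b) K" "u' \<in> Hom M (L b) K"
    "\<And>a s. a \<in> Obj C \<Longrightarrow> s \<in> Hom D (fobj G a) b \<Longrightarrow> u \<cdot> \<iota> b a s = u' \<cdot> \<iota> b a s" for u u' b K
    by (rule colimit_jointly_epic[OF M category_comma_cat[OF G] FX L that(1,2)]) (use that(3) in auto)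
  have "\<forall>q\<in>Arr D. \<exists>u. u \<in> Hom M (L (Dom D q)) (L (Cod D q)) \<and>
      (\<forall>a\<in>Obj C. \<forall>s\<in>Hom D (fobj G a) (Dom D q). u \<cdot> \<iota> (Dom D q) a s = \<iota> (Cod D q) a (q \<cdot>\<^bsub>D\<^esub> s))"
  proof
    fix q assume "q \<in> Arr D"
    then have q: "q \<in> Hom D (Dom D q) (Cod D q)" by (rule Arr_Hom)
    have "\<exists>u\<in>Hom M (L (Dom D q)) (L (Cod D q)).
        \<forall>a\<in>Obj C. \<forall>s\<in>Hom D (fobj G a) (Dom D q). u \<cdot> \<iota> (Dom D q) a s = \<iota> (Cod D q) a (q \<cdot>\<^bsub>D\<^esub> s)"
    proof (rule desc)
      fix a a' f s assume f: "f \<in> Hom C a a'" and s: "s \<in> Hom D (fobj G a') (Dom D q)"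
      show "\<iota> (Cod D q) a' (q \<cdot>\<^bsub>D\<^esub> s) \<cdot> farr X f = \<iota> (Cod D q) a (q \<cdot>\<^bsub>D\<^esub> (s \<cdot>\<^bsub>D\<^esub> farr G f))"
        using \<iota>(3)[OF f D.Comp_Hom[OF s q]] D.Comp_assoc[OF functor_maps(4)[OF G f] s q] by simp
    qed (use \<iota> D.Comp_Hom[OF _ q] in auto)
    then show "\<exists>u. u \<in> Hom M (L (Dom D q)) (L (Cod D q)) \<and>
      (\<forall>a\<in>Obj C. \<forall>s\<in>Hom D (fobj G a) (Dom D q). u \<cdot> \<iota> (Dom D q) a s = \<iota> (Cod D q) a (q \<cdot>\<^bsub>D\<^esub> s))"
      by (simp only: Bex_def)
  qed
  then obtain k where k0: "\<forall>q\<in>Arr D. k q \<in> Hom M (L (Dom D q)) (L (Cod D q)) \<and>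
      (\<forall>a\<in>Obj C. \<forall>s\<in>Hom D (fobj G a) (Dom D q). k q \<cdot> \<iota> (Dom D q) a s = \<iota> (Cod D q) a (q \<cdot>\<^bsub>D\<^esub> s))"
    using bchoice[of "Arr D" "\<lambda>q u. u \<in> Hom M (L (Dom D q)) (L (Cod D q)) \<and>
      (\<forall>a\<in>Obj C. \<forall>s\<in>Hom D (fobj G a) (Dom D q). u \<cdot> \<iota> (Dom D q) a s = \<iota> (Cod D q) a (q \<cdot>\<^bsub>D\<^esub> s))"] by auto
  have k: "k q \<in> Hom M (L b) (L b')"
      "\<And>a s. a \<in> Obj C \<Longrightarrow> s \<in> Hom D (fobj G a) b \<Longrightarrow> k q \<cdot> \<iota> b a s = \<iota> b' a (q \<cdot>\<^bsub>D\<^esub> s)"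
    if "q \<in> Hom D b b'" for q b b'
    using bspec[OF k0 HomD(1)[OF that]] HomD(2,3)[OF that] by auto
  define F where "F = \<lparr>fobj = restrict L (Obj D), farr = restrict k (Arr D)\<rparr>"
  have FD: "b \<in> Obj D \<Longrightarrow> fobj F b = L b" "q \<in> Arr D \<Longrightarrow> farr F q = k q" for b q
    by (simp_all add: F_def)
  have "is_functor D M F"
    unfolding is_functor_def
  proof (intro conjI ballI impI)
    show "farr F q \<in> Hom M (fobj F (Dom D q)) (fobj F (Cod D q))" if "q \<in> Arr D" for q
      using k(1)[OF Arr_Hom[OF that]] that by (simp add: FD D.Dom_Obj D.Cod_Obj)
    show "farr F (Ident D b) = Ident M (fobj F b)" if b: "b \<in> Obj D" for b
    proof -
      have "k (Ident D b) = Ident M (L b)"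
      proof (rule epic[OF k(1)[OF D.Ident_Hom[OF b]] M.Ident_Hom[OF \<iota>(1)]])
        fix a s assume "a \<in> Obj C" and s: "s \<in> Hom D (fobj G a) b"
        then show "k (Ident D b) \<cdot> \<iota> b a s = Ident M (L b) \<cdot> \<iota> b a s"
          using k(2)[OF D.Ident_Hom[OF b], of a s] D.Comp_Ident_left[OF s] M.Comp_Ident_left[OF \<iota>(2)] by simp
      qed
      then show ?thesis using D.Ident_Arr[OF b] b by (simp add: FD)
    qed
    show "farr F (r \<cdot>\<^bsub>D\<^esub> q) = farr F r \<cdot> farr F q" if "q \<in> Arr D" "r \<in> Arr D" "Dom D r = Cod D q" for q r
    proof -
      have q: "q \<in> Hom D (Dom D q) (Cod D q)" and r: "r \<in> Hom D (Cod D q) (Cod D r)"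
        using that by (simp_all add: Hom_iff)
      note rq = D.Comp_Hom[OF q r]
      have "k (r \<cdot>\<^bsub>D\<^esub> q) = k r \<cdot> k q"
      proof (rule epic[OF k(1)[OF rq] M.Comp_Hom[OF k(1)[OF q] k(1)[OF r]]])
        fix a s assume a: "a \<in> Obj C" and s: "s \<in> Hom D (fobj G a) (Dom D q)"
        show "k (r \<cdot>\<^bsub>D\<^esub> q) \<cdot> \<iota> (Dom D q) a s = k r \<cdot> k q \<cdot> \<iota> (Dom D q) a s"
          using k(2)[OF rq a s] k(2)[OF q a s] k(2)[OF r a D.Comp_Hom[OF s q]] D.Comp_assoc[OF s q r]
            M.Comp_assoc[OF \<iota>(2)[OF a s] k(1)[OF q] k(1)[OF r]] by simp
      qed
      then show ?thesis using that HomD(1)[OF rq] by (simp add: FD)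
    qed
  qed (use M D.category_axioms \<iota>(1) in \<open>simp_all add: FD\<close>)
  then have FF: "F \<in> functors D M"
    by (simp add: functors_def F_def)
  define e where "e a = \<iota> (fobj G a) a (Ident D (fobj G a))" for a
  define \<eta> where "\<eta> = \<lparr>nsrc = X, ntgt = comp_func C F G, nat_at = restrict e (Obj C)\<rparr>"
  note Gob = functor_maps(3)[OF G]
  have e: "e a \<in> Hom M (fobj X a) (L (fobj G a))" if "a \<in> Obj C" for a
    unfolding e_def using \<iota>(2)[OF that D.Ident_Hom[OF Gob[OF that]]] .
  have k_e: "k s \<cdot> e a = \<iota> b a s" if "a \<in> Obj C" "s \<in> Hom D (fobj G a) b" for a s b
    using k(2)[OF that(2,1) D.Ident_Hom[OF Gob[OF that(1)]]] D.Comp_Ident_right[OF that(2)] by (simp add: e_def)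
  have "e (Cod C f) \<cdot> farr X f = k (farr G f) \<cdot> e (Dom C f)" if f: "f \<in> Arr C" for f
  proof -
    note Gf = functor_maps(5)[OF G f]
    note ob = C.Dom_Obj[OF f] C.Cod_Obj[OF f]
    show ?thesis
      using \<iota>(3)[OF Arr_Hom[OF f] D.Ident_Hom[OF Gob[OF ob(2)]]] D.Comp_Ident_left[OF Gf] k_e[OF ob(1) Gf]
      by (simp add: e_def[of "Cod C f"])
  qed
  then have \<eta>N: "\<eta> \<in> nat_transformations C M"
    using XF comp_func_functors[OF G functors_functor[OF FF]] e HomD(1)[OF functor_maps(5)[OF G]]
    by (simp add: nat_transformations_def \<eta>_def comp_func_simps C.Dom_Obj C.Cod_Obj FD Gob)
  show "\<exists>F\<in>Obj ?DM. \<exists>\<eta>\<in>Hom ?CM X (fobj (precomposition C G) F).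
      \<forall>Y\<in>Obj ?DM. \<forall>g\<in>Hom ?CM X (fobj (precomposition C G) Y).
        \<exists>!f. f \<in> Hom ?DM F Y \<and> farr (precomposition C G) f \<cdot>\<^bsub>?CM\<^esub> \<eta> = g"
  proof (intro bexI ballI)
    show "F \<in> Obj ?DM" using FF by simp
    show \<eta>H: "\<eta> \<in> Hom ?CM X (fobj (precomposition C G) F)"
      using \<eta>N by (simp add: Hom_iff precomposition_simps) (simp add: \<eta>_def)
    fix Y g assume "Y \<in> Obj ?DM" and g: "g \<in> Hom ?CM X (fobj (precomposition C G) Y)"
    then have YF: "Y \<in> functors D M" by simp
    note Y = functors_functor[OF YF]
    have gN: "g \<in> nat_transformations C M" "nsrc g = X" "ntgt g = comp_func C Y G"
      using HomD[OF g] by (simp_all add: precomposition_simps)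
    have g1: "nat_at g a \<in> Hom M (fobj X a) (fobj Y (fobj G a))" if "a \<in> Obj C" for a
      using nat_transformationsD(3)[OF gN(1) that] that by (simp add: gN comp_func_simps)
    have g2: "nat_at g a' \<cdot> farr X f = farr Y (farr G f) \<cdot> nat_at g a" if "f \<in> Hom C a a'" for f a a'
      using nat_transformationsD(4)[OF gN(1) that] HomD(1)[OF that] by (simp add: gN comp_func_simps)
    have eq_iff: "farr (precomposition C G) f \<cdot>\<^bsub>?CM\<^esub> \<eta> = g \<longleftrightarrow> (\<forall>a\<in>Obj C. nat_at f (fobj G a) \<cdot> e a = nat_at g a)"
      if f: "f \<in> Hom ?DM F Y" for f
    proof -
      have at: "nat_at (farr (precomposition C G) f \<cdot>\<^bsub>?CM\<^esub> \<eta>) a = nat_at f (fobj G a) \<cdot> e a" if "a \<in> Obj C" for a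
        using that by (simp add: precomposition_simps) (simp add: \<eta>_def)
      have H: "farr (precomposition C G) f \<cdot>\<^bsub>?CM\<^esub> \<eta> \<in> Hom ?CM X (fobj (precomposition C G) Y)"
        using CM.Comp_Hom[OF \<eta>H functor_maps(4)[OF precomposition_functor[OF G M] f]] .
      show ?thesis
      proof
        assume "\<forall>a\<in>Obj C. nat_at f (fobj G a) \<cdot> e a = nat_at g a"
        then show "farr (precomposition C G) f \<cdot>\<^bsub>?CM\<^esub> \<eta> = g"
          using HomD[OF H] HomD[OF g] at by (intro ntrans_eqI[of _ C M]) (simp_all del: functor_category_simps)
      qed (use at in metis)
    qed
    have "\<forall>b\<in>Obj D. \<exists>u. u \<in> Hom M (L b) (fobj Y b) \<and>
        (\<forall>a\<in>Obj C. \<forall>s\<in>Hom D (fobj G a) b. u \<cdot> \<iota> b a s = farr Y s \<cdot> nat_at g a)"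
    proof
      fix b assume b: "b \<in> Obj D"
      have "\<exists>u\<in>Hom M (L b) (fobj Y b).
          \<forall>a\<in>Obj C. \<forall>s\<in>Hom D (fobj G a) b. u \<cdot> \<iota> b a s = farr Y s \<cdot> nat_at g a"
      proof (rule desc)
        show "fobj Y b \<in> Obj M" using functor_maps(3)[OF Y b] .
        show "farr Y s \<cdot> nat_at g a \<in> Hom M (fobj X a) (fobj Y b)" if "a \<in> Obj C" "s \<in> Hom D (fobj G a) b" for a s
          using M.Comp_Hom[OF g1[OF that(1)] functor_maps(4)[OF Y that(2)]] .
        fix a a' f s assume f: "f \<in> Hom C a a'" and s: "s \<in> Hom D (fobj G a') b"
        note Gf = functor_maps(4)[OF G f]
        note ob = C.Hom_Obj[OF f]
        show "farr Y s \<cdot> nat_at g a' \<cdot> farr X f = farr Y (s \<cdot>\<^bsub>D\<^esub> farr G f) \<cdot> nat_at g a"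
          using M.Comp_assoc[OF functor_maps(4)[OF X f] g1[OF ob(2)] functor_maps(4)[OF Y s]] g2[OF f]
            M.Comp_assoc[OF g1[OF ob(1)] functor_maps(4)[OF Y Gf] functor_maps(4)[OF Y s]]
            functor_maps(7)[OF Y Gf s] by simp
      qed
      then show "\<exists>u. u \<in> Hom M (L b) (fobj Y b) \<and>
          (\<forall>a\<in>Obj C. \<forall>s\<in>Hom D (fobj G a) b. u \<cdot> \<iota> b a s = farr Y s \<cdot> nat_at g a)"
        by (simp only: Bex_def)
    qed
    then obtain u where u0: "\<forall>b\<in>Obj D. u b \<in> Hom M (L b) (fobj Y b) \<and>
        (\<forall>a\<in>Obj C. \<forall>s\<in>Hom D (fobj G a) b. u b \<cdot> \<iota> b a s = farr Y s \<cdot> nat_at g a)"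
      using bchoice[of "Obj D" "\<lambda>b u. u \<in> Hom M (L b) (fobj Y b) \<and>
        (\<forall>a\<in>Obj C. \<forall>s\<in>Hom D (fobj G a) b. u \<cdot> \<iota> b a s = farr Y s \<cdot> nat_at g a)"] by auto
    have u: "u b \<in> Hom M (L b) (fobj Y b)" 
        "\<And>a s. a \<in> Obj C \<Longrightarrow> s \<in> Hom D (fobj G a) b \<Longrightarrow> u b \<cdot> \<iota> b a s = farr Y s \<cdot> nat_at g a"
      if "b \<in> Obj D" for b
      using bspec[OF u0 that] by auto
    define f where "f = \<lparr>nsrc = F, ntgt = Y, nat_at = restrict u (Obj D)\<rparr>"
    have u_nat: "u b' \<cdot> k q = farr Y q \<cdot> u b" if q: "q \<in> Hom D b b'" for q b b'
    proof -
      note ob = D.Hom_Obj[OF q]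
      note Yq = functor_maps(4)[OF Y q]
      show ?thesis
      proof (rule epic[OF M.Comp_Hom[OF k(1)[OF q] u(1)[OF ob(2)]] M.Comp_Hom[OF u(1)[OF ob(1)] Yq]])
        fix a s assume a: "a \<in> Obj C" and s: "s \<in> Hom D (fobj G a) b"
        show "u b' \<cdot> k q \<cdot> \<iota> b a s = farr Y q \<cdot> u b \<cdot> \<iota> b a s"
          using M.Comp_assoc[OF \<iota>(2)[OF a s] k(1)[OF q] u(1)[OF ob(2)]] k(2)[OF q a s] u(2)[OF ob(2) a D.Comp_Hom[OF s q]]
            M.Comp_assoc[OF \<iota>(2)[OF a s] u(1)[OF ob(1)] Yq] u(2)[OF ob(1) a s]
            functor_maps(7)[OF Y s q] M.Comp_assoc[OF g1[OF a] functor_maps(4)[OF Y s] Yq] by simp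
      qed
    qed
    have fN: "f \<in> nat_transformations D M"
      using FF YF u(1) u_nat[OF Arr_Hom] by (simp add: nat_transformations_def f_def FD D.Dom_Obj D.Cod_Obj)
    then have fH: "f \<in> Hom ?DM F Y" by (simp add: Hom_iff) (simp add: f_def)
    show "\<exists>!f. f \<in> Hom ?DM F Y \<and> farr (precomposition C G) f \<cdot>\<^bsub>?CM\<^esub> \<eta> = g"
    proof (rule ex1I[of _ f])
      have "nat_at f (fobj G a) \<cdot> e a = nat_at g a" if a: "a \<in> Obj C" for a
        using u(2)[OF Gob[OF a] a D.Ident_Hom[OF Gob[OF a]]] functor_maps(6)[OF Y Gob[OF a]]
          M.Comp_Ident_left[OF g1[OF a]] Gob[OF a] by (simp add: f_def e_def)
      then show "f \<in> Hom ?DM F Y \<and> farr (precomposition C G) f \<cdot>\<^bsub>?CM\<^esub> \<eta> = g"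
        using eq_iff[OF fH] fH by blast
      fix f' assume f': "f' \<in> Hom ?DM F Y \<and> farr (precomposition C G) f' \<cdot>\<^bsub>?CM\<^esub> \<eta> = g"
      then have f'e: "nat_at f' (fobj G a) \<cdot> e a = nat_at g a" if "a \<in> Obj C" for a
        using eq_iff[of f'] that by blast
      have f'N: "f' \<in> nat_transformations D M" "nsrc f' = F" "ntgt f' = Y"
        using HomD[OF conjunct1[OF f']] by simp_all
      have f'1: "nat_at f' b \<in> Hom M (L b) (fobj Y b)" if "b \<in> Obj D" for b
        using nat_transformationsD(3)[OF f'N(1) that] that by (simp add: f'N FD)
      show "f' = f"
      proof (rule ntrans_eqI[OF f'N(1) fN])
        fix b assume b: "b \<in> Obj D"
        have "nat_at f' b = u b"
        proof (rule epic[OF f'1[OF b] u(1)[OF b]])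
          fix a s assume a: "a \<in> Obj C" and s: "s \<in> Hom D (fobj G a) b"
          have "nat_at f' b \<cdot> k s = farr Y s \<cdot> nat_at f' (fobj G a)"
            using nat_transformationsD(4)[OF f'N(1) s] HomD(1)[OF s] by (simp add: f'N FD)
          then show "nat_at f' b \<cdot> \<iota> b a s = u b \<cdot> \<iota> b a s"
            using k_e[OF a s] M.Comp_assoc[OF e[OF a] k(1)[OF s] f'1[OF b]]
              M.Comp_assoc[OF e[OF a] f'1[OF Gob[OF a]] functor_maps(4)[OF Y s]] f'e[OF a] u(2)[OF b a s] by simp
        qed
        then show "nat_at f' b = nat_at f b" using b by (simp add: f_def)
      qed (simp_all add: f'N f_def)
    qed
  qed
qed

section \<open>Fibering functors are right Quillen\<close>

theorem fibering_right_quillen: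
  assumes inf: "infinite (UNIV :: 'u set)" and C: "reedy_category TYPE('u) C" and D: "reedy_category TYPE('u) D"
    and fib: "fibering_reedy_functor C D G" and M: "model_category TYPE('u) M"
  shows "right_quillen (reedy_model_structure D M) (reedy_model_structure C M) (precomposition C G)"
proof -
  interpret C: category C using C by (rule reedy_category_category)
  have G: "is_functor C D G" using fib by (simp add: fibering_reedy_functor_def reedy_functor_def)
  have catM: "category M" and colim: "has_small_colimits TYPE('u) M" and cof: "Cof M \<subseteq> Arr M"
    using M by (auto simp: model_category_def)
  have fibr: "farr (precomposition C G) t \<in> Fib (reedy_model_structure C M)"
    if t: "t \<in> Fib (reedy_model_structure D M)" for t
  proof -
    have tN: "t \<in> nat_transformations D M" using t by simp
    note lifts = t[unfolded reedy_fibration_iff[OF inf M D tN], rule_format]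
    show ?thesis
      unfolding reedy_fibration_iff[OF inf M C precomposition_nat_transformation[OF G tN]]
    proof (intro ballI)
      fix a i assume a: "a \<in> Obj C" and i: "i \<in> Cof M \<inter> Weq M"
      then have "i \<in> Arr M" using cof by auto
      then show "matching_lifts C M (farr (precomposition C G) t) a i"
        using precomposition_matching_lifts[OF C D fib catM tN _ _ a] lifts i by blast
    qed
  qed
  moreover have "farr (precomposition C G) t \<in> Weq (reedy_model_structure C M)"
    if "t \<in> Weq (reedy_model_structure D M)" for t
    using that precomposition_nat_transformation[OF G, of t M] functor_maps(3)[OF G] by (simp add: precomposition_simps)
  moreover have "has_left_adjoint (reedy_model_structure D M) (reedy_model_structure C M) (precomposition C G)"
    using precomposition_has_left_adjoint[OF inf _ _ G catM colim] C D by (simp add: reedy_category_def)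
  ultimately show ?thesis
    unfolding right_quillen_def using precomposition_functor[OF G catM] by blast
qed


section \<open>A model structure on sets\<close>

text \<open>The category of subsets of \<open>'v\<close> and all functions between them, with objects and arrows encoded in the types \<open>'om\<close> and
  \<open>'am\<close>.  The injections \<open>fam\<close> and \<open>tag\<close> make \<open>'v\<close> large enough for the products and disjoint unions indexed by \<open>'u\<close> from
  which limits and colimits are built.\<close>

locale set_encoding =
  fixes eo :: "'v set \<Rightarrow> 'om" and ea :: "'v set \<times> ('v \<Rightarrow> 'v) \<times> 'v set \<Rightarrow> 'am"
    and fam :: "('u \<Rightarrow> 'v) \<Rightarrow> 'v" and tag :: "'u \<times> 'v \<Rightarrow> 'v"
  assumes inj_eo: "inj eo" and inj_ea: "inj ea" and inj_fam: "inj fam" and inj_tag: "inj tag"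
    and infinite_u: "infinite (UNIV :: 'u set)"
begin

definition El :: "'om \<Rightarrow> 'v set" where "El = inv eo"

definition mk :: "'om \<Rightarrow> ('v \<Rightarrow> 'v) \<Rightarrow> 'om \<Rightarrow> 'am" where
  "mk a f b = ea (El a, restrict f (El a), El b)"

definition app :: "'am \<Rightarrow> 'v \<Rightarrow> 'v" where "app m = fst (snd (inv ea m))"

definition src :: "'am \<Rightarrow> 'om" where "src m = eo (fst (inv ea m))"
definition trg :: "'am \<Rightarrow> 'om" where "trg m = eo (snd (snd (inv ea m)))"

definition maps :: "'am set" where
  "maps = {mk a f b | a f b. a \<in> range eo \<and> b \<in> range eo \<and> f \<in> El a \<rightarrow> El b}"

text \<open>Every map is a weak equivalence, so that the axioms reduce to those of the weak factorization system of injections and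
  surjections.\<close>

definition set_cat :: "('om, 'am) model_cat" where
  "set_cat = \<lparr>Obj = range eo, Arr = maps, Dom = src, Cod = trg, Ident = (\<lambda>a. mk a id a),
     Comp = (\<lambda>n m. mk (src m) (app n \<circ> app m) (trg n)), Weq = maps,
     Cof = {m \<in> maps. inj_on (app m) (El (src m))},
     Fib = {m \<in> maps. app m ` El (src m) = El (trg m)}\<rparr>"

lemma set_cat_simps [simp]:
  "Obj set_cat = range eo" "Arr set_cat = maps" "Dom set_cat = src" "Cod set_cat = trg"
  "Weq set_cat = maps"
  "Cof set_cat = {m \<in> maps. inj_on (app m) (El (src m))}"
  "Fib set_cat = {m \<in> maps. app m ` El (src m) = El (trg m)}"
  by (simp_all add: set_cat_def)

lemma El_eo [simp]: "El (eo A) = A"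
  by (simp add: El_def inj_eo)

lemma app_mk [simp]: "x \<in> El a \<Longrightarrow> app (mk a f b) x = f x"
  by (simp add: app_def mk_def inj_ea)

lemma src_mk [simp]: "a \<in> range eo \<Longrightarrow> src (mk a f b) = a"
  by (auto simp add: src_def mk_def inj_ea)

lemma trg_mk [simp]: "b \<in> range eo \<Longrightarrow> trg (mk a f b) = b"
  by (auto simp add: trg_def mk_def inj_ea)

lemma mk_Hom: "a \<in> range eo \<Longrightarrow> b \<in> range eo \<Longrightarrow> (\<And>x. x \<in> El a \<Longrightarrow> f x \<in> El b) \<Longrightarrow> mk a f b \<in> Hom set_cat a b"
  unfolding Hom_iff by (auto simp: maps_def)

lemma mk_cong: "(\<And>x. x \<in> El a \<Longrightarrow> f x = g x) \<Longrightarrow> mk a f b = mk a g b"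
  by (simp add: mk_def cong: restrict_cong)

lemma set_HomD:
  assumes "m \<in> Hom set_cat a b"
  shows "a \<in> range eo" "b \<in> range eo" "mk a (app m) b = m" "x \<in> El a \<Longrightarrow> app m x \<in> El b"
    "src m = a" "trg m = b" "m \<in> maps"
proof -
  obtain a' f b' where m: "m = mk a' f b'" "a' \<in> range eo" "b' \<in> range eo" "f \<in> El a' \<rightarrow> El b'"
    using assms by (auto simp: Hom_iff maps_def)
  then have ab: "a = a'" "b = b'" using assms by (auto simp: Hom_iff)
  show "a \<in> range eo" "b \<in> range eo" using m by (simp_all add: ab)
  show "mk a (app m) b = m" unfolding ab m(1) by (rule mk_cong) simp
  show "x \<in> El a \<Longrightarrow> app m x \<in> El b" using m by (auto simp: ab)
  show "src m = a" "trg m = b" "m \<in> maps" using assms by (simp_all add: Hom_iff)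
qed

lemma maps_Hom: "m \<in> maps \<Longrightarrow> m \<in> Hom set_cat (src m) (trg m)"
  by (simp add: Hom_iff)

lemma set_Hom_eqI:
  assumes "m \<in> Hom set_cat a b" "n \<in> Hom set_cat a b" "\<And>x. x \<in> El a \<Longrightarrow> app m x = app n x"
  shows "m = n"
proof -
  have "mk a (app m) b = mk a (app n) b" by (rule mk_cong) (rule assms(3))
  then show ?thesis unfolding set_HomD(3)[OF assms(1)] set_HomD(3)[OF assms(2)] .
qed

abbreviation set_comp (infixl "\<bullet>" 70) where "g \<bullet> f \<equiv> g \<cdot>\<^bsub>set_cat\<^esub> f"

lemma app_Comp [simp]: "x \<in> El (src m) \<Longrightarrow> app (n \<bullet> m) x = app n (app m x)"
  by (simp add: set_cat_def)

lemma app_Ident [simp]: "x \<in> El a \<Longrightarrow> app (Ident set_cat a) x = x"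
  by (simp add: set_cat_def)

lemma set_Comp_Hom:
  assumes f: "f \<in> Hom set_cat a b" and g: "g \<in> Hom set_cat b c"
  shows "g \<bullet> f \<in> Hom set_cat a c"
proof -
  have "mk a (app g \<circ> app f) c \<in> Hom set_cat a c"
    by (rule mk_Hom) (use set_HomD[OF f] set_HomD[OF g] in auto)
  then show ?thesis using set_HomD(5)[OF f] set_HomD(6)[OF g] by (simp add: set_cat_def)
qed

lemma set_Ident_Hom: "a \<in> range eo \<Longrightarrow> Ident set_cat a \<in> Hom set_cat a a"
  using mk_Hom[of a a id] by (simp add: set_cat_def)

lemma category_set_cat: "category set_cat"
proof
  show "f \<in> Arr set_cat \<Longrightarrow> Dom set_cat f \<in> Obj set_cat" for f
    using set_HomD(1)[OF maps_Hom] by simp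
  show "f \<in> Arr set_cat \<Longrightarrow> Cod set_cat f \<in> Obj set_cat" for f
    using set_HomD(2)[OF maps_Hom] by simp
  show "a \<in> Obj set_cat \<Longrightarrow> Ident set_cat a \<in> Hom set_cat a a" for a
    using set_Ident_Hom by simp
  show "f \<in> Hom set_cat a b \<Longrightarrow> g \<in> Hom set_cat b c \<Longrightarrow> g \<bullet> f \<in> Hom set_cat a c" for f g a b c
    by (rule set_Comp_Hom)
  show "f \<bullet> Ident set_cat a = f" if f: "f \<in> Hom set_cat a b" for f a b
  proof (rule set_Hom_eqI[OF set_Comp_Hom[OF set_Ident_Hom f] f])
    show "a \<in> range eo" using set_HomD(1)[OF f] .
    then show "app (f \<bullet> Ident set_cat a) x = app f x" if "x \<in> El a" for x
      using that set_HomD(5)[OF set_Ident_Hom] by simp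
  qed
  show "Ident set_cat b \<bullet> f = f" if f: "f \<in> Hom set_cat a b" for f a b
  proof (rule set_Hom_eqI[OF set_Comp_Hom[OF f set_Ident_Hom] f])
    show "b \<in> range eo" using set_HomD(2)[OF f] .
    then show "app (Ident set_cat b \<bullet> f) x = app f x" if "x \<in> El a" for x
      using that set_HomD(4,5)[OF f] by simp
  qed
  show "h \<bullet> (g \<bullet> f) = h \<bullet> g \<bullet> f"
    if f: "f \<in> Hom set_cat a b" and g: "g \<in> Hom set_cat b c" and h: "h \<in> Hom set_cat c d" for f g h a b c d
    using set_HomD[OF f] set_HomD(5)[OF g] set_HomD(5)[OF set_Comp_Hom[OF f g]]
    by (intro set_Hom_eqI[OF set_Comp_Hom[OF set_Comp_Hom[OF f g] h] set_Comp_Hom[OF f set_Comp_Hom[OF g h]]]) simp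
qed

text \<open>The limit is the set of codes of compatible families.\<close>

lemma set_cat_limits: "has_small_limits TYPE('u) set_cat"
  unfolding has_small_limits_def
proof (intro allI impI)
  fix J :: "('u, 'u) cat" and F assume F: "is_functor J set_cat F"
  interpret J: category J using F by (rule functor_maps)
  define S where "S = {x \<in> extensional (Obj J). (\<forall>j\<in>Obj J. x j \<in> El (fobj F j))
      \<and> (\<forall>f\<in>Arr J. app (farr F f) (x (Dom J f)) = x (Cod J f))}"
  define L where "L = eo (fam ` S)"
  define p where "p j = mk L (\<lambda>z. inv fam z j) (fobj F j)" for j
  have L: "L \<in> range eo" "El L = fam ` S" by (simp_all add: L_def)
  have Fob: "fobj F j \<in> range eo" if "j \<in> Obj J" for j using functor_maps(3)[OF F that] by simp
  have p: "p j \<in> Hom set_cat L (fobj F j)" if "j \<in> Obj J" for j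
    unfolding p_def by (rule mk_Hom) (use L Fob that in \<open>auto simp: inj_fam S_def\<close>)
  have app_p: "app (p j) (fam x) = x j" if "x \<in> S" for x j
    using that L by (simp add: p_def inj_fam)
  have cone: "is_cone J set_cat F L p"
    unfolding is_cone_def
  proof (intro conjI ballI)
    fix f assume f: "f \<in> Arr J"
    note ob = J.Dom_Obj[OF f] J.Cod_Obj[OF f]
    show "farr F f \<bullet> p (Dom J f) = p (Cod J f)"
      by (rule set_Hom_eqI[OF set_Comp_Hom[OF p[OF ob(1)] functor_maps(5)[OF F f]] p[OF ob(2)]])
        (use f set_HomD(5)[OF p[OF ob(1)]] in \<open>auto simp: L app_p S_def\<close>)
  qed (use L p in auto)
  moreover have "\<exists>!u. u \<in> Hom set_cat K L \<and> (\<forall>j\<in>Obj J. p j \<bullet> u = q j)" if q: "is_cone J set_cat F K q" for K q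
  proof -
    define x where "x z = restrict (\<lambda>j. app (q j) z) (Obj J)" for z
    have K: "K \<in> range eo" and qj: "\<And>j. j \<in> Obj J \<Longrightarrow> q j \<in> Hom set_cat K (fobj F j)"
      and qf: "\<And>f. f \<in> Arr J \<Longrightarrow> farr F f \<bullet> q (Dom J f) = q (Cod J f)"
      using q by (auto simp: is_cone_def)
    have x: "x z \<in> S" if z: "z \<in> El K" for z
    proof -
      have "app (farr F f) (app (q (Dom J f)) z) = app (q (Cod J f)) z" if f: "f \<in> Arr J" for f
        using qf[OF f] z set_HomD(5)[OF qj[OF J.Dom_Obj[OF f]]] by (metis app_Comp)
      then show ?thesis
        using set_HomD(4)[OF qj z] by (auto simp: S_def x_def J.Dom_Obj J.Cod_Obj)
    qed
    define u where "u = mk K (\<lambda>z. fam (x z)) L"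
    have u: "u \<in> Hom set_cat K L"
      unfolding u_def by (rule mk_Hom) (use K L x in auto)
    have "p j \<bullet> u = q j" if j: "j \<in> Obj J" for j
    proof (rule set_Hom_eqI[OF set_Comp_Hom[OF u p[OF j]] qj[OF j]])
      fix z assume z: "z \<in> El K"
      then have "app (p j \<bullet> u) z = x z j"
        using set_HomD(5)[OF u] app_p[OF x[OF z]] by (simp add: u_def)
      then show "app (p j \<bullet> u) z = app (q j) z" using j by (simp add: x_def)
    qed
    moreover have "u' = u" if u': "u' \<in> Hom set_cat K L" "\<forall>j\<in>Obj J. p j \<bullet> u' = q j" for u'
    proof (rule set_Hom_eqI[OF u'(1) u])
      fix z assume z: "z \<in> El K"
      then have "app u' z \<in> El L" using set_HomD(4)[OF u'(1)] by blast
      then obtain y where y: "app u' z = fam y" "y \<in> S" using L by auto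
      have "y j = app (q j) z" if "j \<in> Obj J" for j
        using u'(2) that z set_HomD(5)[OF u'(1)] y app_p[OF y(2)] by (metis app_Comp)
      then have "y = x z"
        using y(2) by (intro extensionalityI[of _ "Obj J"]) (auto simp: S_def x_def)
      then show "app u' z = app u z" using y z by (simp add: u_def)
    qed
    ultimately show ?thesis using u by (intro ex1I[of _ u] conjI ballI) (elim conjE | blast)+
  qed
  ultimately have "is_limit J set_cat F L p" unfolding is_limit_def by (intro conjI allI impI)
  then show "\<exists>L p. is_limit J set_cat F L p" by (intro exI)
qed

text \<open>The colimit is the quotient of the disjoint union by the equivalence relation that the arrows of the diagram generate; a
  class is represented by a chosen member.\<close>

lemma set_cat_colimits: "has_small_colimits TYPE('u) set_cat"
  unfolding has_small_colimits_def
proof (intro allI impI)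
  fix J :: "('u, 'u) cat" and F assume F: "is_functor J set_cat F"
  interpret J: category J using F by (rule functor_maps)
  define T where "T = (SIGMA j:Obj J. El (fobj F j))"
  define R where "R = {((j, x), (j', x')). \<exists>f\<in>Arr J. Dom J f = j \<and> Cod J f = j' \<and> x \<in> El (fobj F j) \<and> x' = app (farr F f) x}"
  define E where "E = (R \<union> R\<inverse>)\<^sup>*"
  define rep where "rep t = (SOME t'. (t, t') \<in> E)" for t
  have rep: "(t, rep t) \<in> E" for t
    unfolding rep_def by (rule someI[of _ t]) (simp add: E_def)
  have symE: "(t, t') \<in> E \<Longrightarrow> (t', t) \<in> E" for t t'
    unfolding E_def by (metis sym_Un_converse sym_rtrancl symD)
  have rep_eq: "rep t = rep t'" if "(t, t') \<in> E" for t t'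
  proof -
    have "(t, s) \<in> E \<longleftrightarrow> (t', s) \<in> E" for s
      using that symE[OF that] unfolding E_def by (meson rtrancl_trans)
    then show ?thesis by (simp add: rep_def)
  qed
  define L where "L = eo (tag ` rep ` T)"
  define p where "p j = mk (fobj F j) (\<lambda>x. tag (rep (j, x))) L" for j
  have L: "L \<in> range eo" "El L = tag ` rep ` T" by (simp_all add: L_def)
  have Fob: "fobj F j \<in> range eo" if "j \<in> Obj J" for j using functor_maps(3)[OF F that] by simp
  have p: "p j \<in> Hom set_cat (fobj F j) L" if "j \<in> Obj J" for j
    unfolding p_def by (rule mk_Hom) (use L Fob that in \<open>auto simp: T_def\<close>)
  have app_p: "app (p j) x = tag (rep (j, x))" if "x \<in> El (fobj F j)" for x j
    using that by (simp add: p_def)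
  have cocone: "is_cocone J set_cat F L p"
    unfolding is_cocone_def
  proof (intro conjI ballI)
    fix f assume f: "f \<in> Arr J"
    note ob = J.Dom_Obj[OF f] J.Cod_Obj[OF f] and Ff = functor_maps(5)[OF F f]
    show "p (Cod J f) \<bullet> farr F f = p (Dom J f)"
    proof (rule set_Hom_eqI[OF set_Comp_Hom[OF Ff p[OF ob(2)]] p[OF ob(1)]])
      fix x assume x: "x \<in> El (fobj F (Dom J f))"
      then have "((Dom J f, x), (Cod J f, app (farr F f) x)) \<in> R" using f by (auto simp: R_def)
      then have "rep (Dom J f, x) = rep (Cod J f, app (farr F f) x)"
        by (intro rep_eq) (auto simp: E_def)
      then show "app (p (Cod J f) \<bullet> farr F f) x = app (p (Dom J f)) x"
        using x set_HomD(4,5)[OF Ff] by (simp add: app_p)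
    qed
  qed (use L p in auto)
  moreover have "\<exists>!u. u \<in> Hom set_cat L K \<and> (\<forall>j\<in>Obj J. u \<bullet> p j = q j)" if q: "is_cocone J set_cat F K q" for K q
  proof -
    define val where "val t = app (q (fst t)) (snd t)" for t
    have K: "K \<in> range eo" and qj: "\<And>j. j \<in> Obj J \<Longrightarrow> q j \<in> Hom set_cat (fobj F j) K"
      and qf: "\<And>f. f \<in> Arr J \<Longrightarrow> q (Cod J f) \<bullet> farr F f = q (Dom J f)"
      using q by (auto simp: is_cocone_def)
    have val_R: "val t = val t'" if tt: "(t, t') \<in> R" for t t'
    proof -
      obtain f where f: "f \<in> Arr J" "fst t = Dom J f" "fst t' = Cod J f" "snd t \<in> El (fobj F (Dom J f))"
          "snd t' = app (farr F f) (snd t)"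
        using tt by (auto simp: R_def)
      then show ?thesis
        using qf[OF f(1)] set_HomD(5)[OF functor_maps(5)[OF F f(1)]] unfolding val_def by (metis app_Comp)
    qed
    have val: "val (rep t) = val t" for t
      using zigzag_invariant[OF rep[of t, unfolded E_def], of val] val_R by simp
    define u where "u = mk L (\<lambda>z. val (inv tag z)) K"
    have u: "u \<in> Hom set_cat L K"
    proof (unfold u_def, rule mk_Hom[OF L(1) K])
      fix z assume "z \<in> El L"
      then obtain t where "t \<in> T" "z = tag (rep t)" using L by auto
      then show "val (inv tag z) \<in> El K" using set_HomD(4)[OF qj] by (auto simp: inj_tag val) (auto simp: T_def val_def)
    qed
    have app_u: "app u (tag (rep t)) = val t" if "t \<in> T" for t
      using that L by (simp add: u_def inj_tag val)
    have "u \<bullet> p j = q j" if j: "j \<in> Obj J" for j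
      by (rule set_Hom_eqI[OF set_Comp_Hom[OF p[OF j] u] qj[OF j]])
        (use j set_HomD(5)[OF p[OF j]] in \<open>simp add: app_p app_u T_def val_def\<close>)
    moreover have "u' = u" if u': "u' \<in> Hom set_cat L K" "\<forall>j\<in>Obj J. u' \<bullet> p j = q j" for u'
    proof (rule set_Hom_eqI[OF u'(1) u])
      fix z assume "z \<in> El L"
      then obtain j x where z: "z = tag (rep (j, x))" and jx: "(j, x) \<in> T"
        using L by auto
      then have j: "j \<in> Obj J" and x: "x \<in> El (fobj F j)" by (auto simp: T_def)
      have "app u' z = app (u' \<bullet> p j) x" using x set_HomD(5)[OF p[OF j]] by (simp add: z app_p)
      then show "app u' z = app u z" using u'(2) j app_u[OF jx] by (simp add: z val_def)
    qed
    ultimately show ?thesis using u by (intro ex1I[of _ u] conjI ballI) (elim conjE | blast)+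
  qed
  ultimately have "is_colimit J set_cat F L p" unfolding is_colimit_def by (intro conjI allI impI)
  then show "\<exists>L p. is_colimit J set_cat F L p" by (intro exI)
qed

text \<open>A lift is prescribed on the image of the injection, and elsewhere picks preimages under the surjection.\<close>

lemma set_cat_lifting:
  assumes i: "i \<in> Cof set_cat" and p: "p \<in> Fib set_cat"
  shows "has_lifting set_cat i p"
  unfolding has_lifting_def
proof (intro ballI impI)
  fix u v assume u: "u \<in> Hom set_cat (Dom set_cat i) (Dom set_cat p)" and v: "v \<in> Hom set_cat (Cod set_cat i) (Cod set_cat p)"
    and eq: "p \<bullet> u = v \<bullet> i"
  define A where "A = src i"
  define B where "B = trg i"
  define X where "X = src p"
  define Y where "Y = trg p"
  have i': "i \<in> Hom set_cat A B" "inj_on (app i) (El A)" and p': "p \<in> Hom set_cat X Y" "app p ` El X = El Y"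
    using i p by (auto simp: A_def B_def X_def Y_def intro: maps_Hom)
  have u: "u \<in> Hom set_cat A X" and v: "v \<in> Hom set_cat B Y" using u v by (simp_all add: A_def B_def X_def Y_def)
  define f where "f b = (if b \<in> app i ` El A then app u (inv_into (El A) (app i) b) else inv_into (El X) (app p) (app v b))" for b
  have fi: "f (app i x) = app u x" if "x \<in> El A" for x
    using that i' by (simp add: f_def)
  have pf: "f b \<in> El X \<and> app p (f b) = app v b" if b: "b \<in> El B" for b
  proof (cases "b \<in> app i ` El A")
    case True
    then obtain x where x: "x \<in> El A" "b = app i x" by blast
    have "app p (app u x) = app v (app i x)"
      using eq x set_HomD(5)[OF u] set_HomD(5)[OF i'(1)] by (metis app_Comp)
    then show ?thesis using x fi set_HomD(4)[OF u] by simp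
  next
    case False
    then have "f b = inv_into (El X) (app p) (app v b)" by (simp add: f_def)
    moreover have "app v b \<in> app p ` El X" using set_HomD(4)[OF v b] p' by simp
    ultimately show ?thesis using inv_into_into f_inv_into_f by metis
  qed
  define h where "h = mk B f X"
  have h: "h \<in> Hom set_cat B X"
    unfolding h_def by (rule mk_Hom) (use pf set_HomD[OF u] set_HomD[OF v] in auto)
  have "h \<bullet> i = u"
    by (rule set_Hom_eqI[OF set_Comp_Hom[OF i'(1) h] u])
      (use fi set_HomD(4,5)[OF i'(1)] in \<open>simp add: h_def\<close>)
  moreover have "p \<bullet> h = v"
    by (rule set_Hom_eqI[OF set_Comp_Hom[OF h p'(1)] v])
      (use pf set_HomD(5)[OF h] in \<open>simp add: h_def\<close>)
  ultimately show "\<exists>h\<in>Hom set_cat (Cod set_cat i) (Dom set_cat p). h \<bullet> i = u \<and> p \<bullet> h = v"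
    using h by (auto simp: B_def X_def)
qed

text \<open>A map \<open>X \<rightarrow> Y\<close> factors through the disjoint union of \<open>X\<close> and \<open>Y\<close>.\<close>

lemma set_cat_factorization:
  assumes f: "f \<in> maps"
  shows "\<exists>i\<in>Cof set_cat. \<exists>p\<in>Fib set_cat. Dom set_cat p = Cod set_cat i \<and> p \<bullet> i = f"
proof -
  obtain h :: "nat \<Rightarrow> 'u" where "inj h" using infinite_u infinite_countable_subset by blast
  then have ne: "h 0 \<noteq> h 1" by (simp add: inj_eq)
  define a where "a = src f"
  define b where "b = trg f"
  have fH: "f \<in> Hom set_cat a b" using maps_Hom[OF f] by (simp add: a_def b_def)
  define Z where "Z = eo (tag ` ({h 0} \<times> El a \<union> {h 1} \<times> El b))"
  define i where "i = mk a (\<lambda>x. tag (h 0, x)) Z"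
  define p where "p = mk Z (\<lambda>z. if fst (inv tag z) = h 0 then app f (snd (inv tag z)) else snd (inv tag z)) b"
  have Z: "Z \<in> range eo" "El Z = tag ` ({h 0} \<times> El a \<union> {h 1} \<times> El b)" by (simp_all add: Z_def)
  have i: "i \<in> Hom set_cat a Z" unfolding i_def by (rule mk_Hom) (use Z set_HomD[OF fH] in auto)
  have p: "p \<in> Hom set_cat Z b" unfolding p_def by (rule mk_Hom) (use Z ne set_HomD[OF fH] in \<open>auto simp: inj_tag\<close>)
  have "inj_on (app i) (El a)"
    by (rule inj_onI) (simp add: i_def inj_eq[OF inj_tag])
  then have "i \<in> Cof set_cat" using set_HomD[OF i] by simp
  moreover have "y \<in> app p ` El Z" if "y \<in> El b" for y
  proof
    show z: "tag (h 1, y) \<in> El Z" using that Z by auto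
    show "y = app p (tag (h 1, y))" using z ne by (simp add: p_def inj_tag)
  qed
  then have "app p ` El Z = El b" using set_HomD(4)[OF p] by blast
  then have "p \<in> Fib set_cat" using set_HomD[OF p] by simp
  moreover have "p \<bullet> i = f"
  proof (rule set_Hom_eqI[OF set_Comp_Hom[OF i p] fH])
    fix x assume x: "x \<in> El a"
    then have "tag (h 0, x) \<in> El Z" using Z by auto
    then show "app (p \<bullet> i) x = app f x"
      using x set_HomD(5)[OF i] by (simp add: i_def p_def inj_tag)
  qed
  ultimately show ?thesis using set_HomD[OF i] set_HomD[OF p] by (intro bexI[of _ i] bexI[of _ p]) auto
qed

lemma set_cat_retract:
  assumes "is_retract set_cat f g"
  shows "f \<in> maps" "g \<in> Cof set_cat \<Longrightarrow> f \<in> Cof set_cat" "g \<in> Fib set_cat \<Longrightarrow> f \<in> Fib set_cat"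
proof -
  define A where "A = src f"
  define B where "B = trg f"
  define X where "X = src g"
  define Y where "Y = trg g"
  obtain i r j s where fg: "f \<in> maps" "g \<in> maps"
    and i: "i \<in> Hom set_cat A X" and r: "r \<in> Hom set_cat X A"
    and j: "j \<in> Hom set_cat B Y" and s: "s \<in> Hom set_cat Y B"
    and ri: "r \<bullet> i = Ident set_cat A" and sj: "s \<bullet> j = Ident set_cat B"
    and gi: "g \<bullet> i = j \<bullet> f" and fr: "f \<bullet> r = s \<bullet> g"
    using assms unfolding is_retract_def A_def B_def X_def Y_def by auto
  have f: "f \<in> Hom set_cat A B" and g: "g \<in> Hom set_cat X Y"
    using maps_Hom fg by (simp_all add: A_def B_def X_def Y_def)
  note srcs = set_HomD(5)[OF f] set_HomD(5)[OF g] set_HomD(5)[OF i] set_HomD(5)[OF r] set_HomD(5)[OF j]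
  have ri': "app r (app i x) = x" if "x \<in> El A" for x
    using ri srcs that by (metis app_Comp app_Ident)
  have sj': "app s (app j x) = x" if "x \<in> El B" for x
    using sj srcs that by (metis app_Comp app_Ident)
  have gi': "app g (app i x) = app j (app f x)" if "x \<in> El A" for x
    using gi srcs that by (metis app_Comp)
  have fr': "app f (app r x) = app s (app g x)" if "x \<in> El X" for x
    using fr srcs that by (metis app_Comp)
  show "f \<in> maps" by fact
  show "f \<in> Cof set_cat" if "g \<in> Cof set_cat"
  proof -
    have inj: "inj_on (app g) (El X)" using that by (simp add: X_def)
    have "x = y" if "x \<in> El A" "y \<in> El A" "app f x = app f y" for x y
      using that gi' inj_onD[OF inj _ set_HomD(4)[OF i] set_HomD(4)[OF i], of x y] ri' by metis
    then show ?thesis using fg by (simp add: A_def inj_on_def)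
  qed
  show "f \<in> Fib set_cat" if "g \<in> Fib set_cat"
  proof -
    have surj: "app g ` El X = El Y" using that by (simp add: X_def Y_def)
    have "y \<in> app f ` El A" if y: "y \<in> El B" for y
    proof -
      have "app j y \<in> app g ` El X" using set_HomD(4)[OF j y] surj by simp
      then obtain x where x: "x \<in> El X" "app g x = app j y" by auto
      then have "app f (app r x) = y" using fr' sj' y by simp
      then show ?thesis using set_HomD(4)[OF r x(1)] by blast
    qed
    then have "app f ` El A = El B" using set_HomD(4)[OF f] by blast
    then show ?thesis using fg by (simp add: A_def B_def)
  qed
qed

theorem model_category_set_cat: "model_category TYPE('u) set_cat"
proof -
  interpret category set_cat by (rule category_set_cat)
  have "g \<bullet> f \<in> maps" if "f \<in> maps" "g \<in> maps" "src g = trg f" for f g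
    using Comp_Arr(1)[of f g] that by simp
  moreover have "\<exists>i\<in>Cof set_cat \<inter> Weq set_cat. \<exists>p\<in>Fib set_cat. Dom set_cat p = Cod set_cat i \<and> p \<bullet> i = f"
    "\<exists>i\<in>Cof set_cat. \<exists>p\<in>Fib set_cat \<inter> Weq set_cat. Dom set_cat p = Cod set_cat i \<and> p \<bullet> i = f"
    if "f \<in> maps" for f
    using set_cat_factorization[OF that] by auto
  ultimately show ?thesis
    unfolding model_category_def
    using category_set_cat set_cat_limits set_cat_colimits set_cat_lifting set_cat_retract by auto
qed

end


section \<open>Non-fibering functors are not right Quillen\<close>

context set_encoding
begin

text \<open>The diagram of sets \<open>Pow (Hom(d, b))\<close>, on which arrows act by preimage under precomposition.  It is the value at a set with two
  elements of the right adjoint to evaluation at \<open>b\<close>.  The function \<open>enc\<close> encodes sets of arrows.\<close>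

definition subset_diagram ::
  "('o, 'a, 'z) cat_scheme \<Rightarrow> ('a set \<Rightarrow> 'v) \<Rightarrow> 'o \<Rightarrow> ('o, 'a, 'om, 'am) func" where
  "subset_diagram D enc b =
     \<lparr>fobj = restrict (\<lambda>d. eo (enc ` Pow (Hom D d b))) (Obj D),
      farr = restrict (\<lambda>f. mk (eo (enc ` Pow (Hom D (Dom D f) b)))
         (\<lambda>z. enc {g \<in> Hom D (Cod D f) b. g \<cdot>\<^bsub>D\<^esub> f \<in> inv_into (Pow (Arr D)) enc z})
         (eo (enc ` Pow (Hom D (Cod D f) b)))) (Arr D)\<rparr>"

definition point_diagram :: "('o, 'a, 'z) cat_scheme \<Rightarrow> ('o, 'a, 'om, 'am) func" where
  "point_diagram D = \<lparr>fobj = restrict (\<lambda>_. eo {undefined}) (Obj D),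
     farr = restrict (\<lambda>_. Ident set_cat (eo {undefined})) (Arr D)\<rparr>"

definition to_point :: "('o, 'a, 'z) cat_scheme \<Rightarrow> ('o, 'a, 'om, 'am) func \<Rightarrow> ('o, 'a, 'om, 'am) ntrans" where
  "to_point D X = \<lparr>nsrc = X, ntgt = point_diagram D,
     nat_at = restrict (\<lambda>d. mk (fobj X d) (\<lambda>_. undefined) (eo {undefined})) (Obj D)\<rparr>"

lemma Hom_point_eq:
  assumes "m \<in> Hom set_cat a (eo {undefined})" "n \<in> Hom set_cat a (eo {undefined})"
  shows "m = n"
  using set_HomD(4)[OF assms(1)] set_HomD(4)[OF assms(2)] by (intro set_Hom_eqI[OF assms]) auto

lemma point_diagram_functors:
  assumes "category D"
  shows "point_diagram D \<in> functors D set_cat"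
proof -
  interpret D: category D by fact
  note id = set_Ident_Hom[of "eo {undefined}", simplified]
  have "is_functor D set_cat (point_diagram D)"
    unfolding is_functor_def
    using assms category_set_cat id Hom_point_eq[OF id set_Comp_Hom[OF id id]]
    by (auto simp: point_diagram_def D.Dom_Obj D.Cod_Obj D.Ident_Arr D.Comp_Arr)
  then show ?thesis by (simp add: functors_def point_diagram_def)
qed

lemma to_point_nat_transformation:
  assumes D: "category D" and X: "X \<in> functors D set_cat"
  shows "to_point D X \<in> nat_transformations D set_cat"
proof -
  interpret D: category D by fact
  note X' = functors_functor[OF X] and P = functors_functor[OF point_diagram_functors[OF D]]
  let ?t = "\<lambda>d. mk (fobj X d) (\<lambda>_. undefined) (eo {undefined})"
  have t: "?t d \<in> Hom set_cat (fobj X d) (eo {undefined})" if "d \<in> Obj D" for d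
    using functor_maps(3)[OF X' that] by (intro mk_Hom) auto
  have "?t (Cod D f) \<bullet> farr X f = farr (point_diagram D) f \<bullet> ?t (Dom D f)" if f: "f \<in> Arr D" for f
  proof (rule Hom_point_eq)
    note ob = D.Dom_Obj[OF f] D.Cod_Obj[OF f]
    show "?t (Cod D f) \<bullet> farr X f \<in> Hom set_cat (fobj X (Dom D f)) (eo {undefined})"
      using set_Comp_Hom[OF functor_maps(5)[OF X' f] t[OF ob(2)]] .
    show "farr (point_diagram D) f \<bullet> ?t (Dom D f) \<in> Hom set_cat (fobj X (Dom D f)) (eo {undefined})"
      using set_Comp_Hom[OF t[OF ob(1)], of "farr (point_diagram D) f" "eo {undefined}"]
        functor_maps(5)[OF P f] ob by (simp add: point_diagram_def)
  qed
  then show ?thesis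
    using X point_diagram_functors[OF D] t
    by (simp add: nat_transformations_def to_point_def D.Dom_Obj D.Cod_Obj) (simp add: point_diagram_def)
qed

context
  fixes D :: "('od, 'ad, 'z) cat_scheme" (structure) and enc :: "'ad set \<Rightarrow> 'v" and b :: 'od
  assumes D: "category D" and enc: "inj_on enc (Pow (Arr D))"
begin

interpretation D: category D by (rule D)

abbreviation decode :: "'v \<Rightarrow> 'ad set" where "decode \<equiv> inv_into (Pow (Arr D)) enc"

abbreviation Sub :: "('od, 'ad, 'om, 'am) func" where "Sub \<equiv> subset_diagram D enc b"

lemma dec_enc: "T \<subseteq> Hom D d b \<Longrightarrow> decode (enc T) = T"
  using enc by (intro inv_into_f_f) (auto simp: Hom_iff)

lemma El_subset_diagram: "d \<in> Obj D \<Longrightarrow> El (fobj Sub d) = enc ` Pow (Hom D d b)"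
  by (simp add: subset_diagram_def)

lemma El_dec: "d \<in> Obj D \<Longrightarrow> z \<in> El (fobj Sub d) \<Longrightarrow> enc (decode z) = z \<and> decode z \<subseteq> Hom D d b"
  using dec_enc[of _ d] by (auto simp: El_subset_diagram)

lemma dec_El: "d \<in> Obj D \<Longrightarrow> T \<subseteq> Hom D d b \<Longrightarrow> enc T \<in> El (fobj Sub d)"
  by (simp add: El_subset_diagram)

lemma subset_diagram_Hom:
  assumes "f \<in> Hom D d d'"
  shows "farr Sub f \<in> Hom set_cat (fobj Sub d) (fobj Sub d')"
    and "T \<subseteq> Hom D d b \<Longrightarrow> app (farr Sub f) (enc T) = enc {g \<in> Hom D d' b. g \<cdot> f \<in> T}"
proof -
  note f = HomD[OF assms] D.Hom_Obj[OF assms]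
  have Sub: "farr Sub f = mk (fobj Sub d) (\<lambda>z. enc {g \<in> Hom D d' b. g \<cdot> f \<in> decode z}) (fobj Sub d')"
    using f by (simp add: subset_diagram_def)
  show "farr Sub f \<in> Hom set_cat (fobj Sub d) (fobj Sub d')"
    unfolding Sub by (rule mk_Hom) (use f in \<open>auto simp: subset_diagram_def\<close>)
  show "T \<subseteq> Hom D d b \<Longrightarrow> app (farr Sub f) (enc T) = enc {g \<in> Hom D d' b. g \<cdot> f \<in> T}"
    unfolding Sub by (simp add: dec_El f dec_enc)
qed

lemma subset_diagram_functors: "Sub \<in> functors D set_cat"
proof -
  have "is_functor D set_cat Sub"
    unfolding is_functor_def
  proof (intro conjI ballI impI)
    show "farr Sub f \<in> Hom set_cat (fobj Sub (Dom D f)) (fobj Sub (Cod D f))" if "f \<in> Arr D" for f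
      using subset_diagram_Hom(1)[OF Arr_Hom[OF that]] .
    show "farr Sub (Ident D d) = Ident set_cat (fobj Sub d)" if d: "d \<in> Obj D" for d
    proof (rule set_Hom_eqI)
      note id = D.Ident_Hom[OF d]
      show "farr Sub (Ident D d) \<in> Hom set_cat (fobj Sub d) (fobj Sub d)" using subset_diagram_Hom(1)[OF id] .
      then show "Ident set_cat (fobj Sub d) \<in> Hom set_cat (fobj Sub d) (fobj Sub d)" using set_Ident_Hom set_HomD(1) by blast
      fix z assume z: "z \<in> El (fobj Sub d)"
      then obtain T where T: "z = enc T" "T \<subseteq> Hom D d b" using d by (auto simp: El_subset_diagram)
      have "{g \<in> Hom D d b. g \<cdot> Ident D d \<in> T} = T"
        using T(2) D.Comp_Ident_right by auto
      then show "app (farr Sub (Ident D d)) z = app (Ident set_cat (fobj Sub d)) z"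
        using z subset_diagram_Hom(2)[OF id T(2)] by (simp add: T(1))
    qed
    show "farr Sub (g \<cdot> f) = farr Sub g \<bullet> farr Sub f" if "f \<in> Arr D" "g \<in> Arr D" "Dom D g = Cod D f" for f g
    proof -
      have f: "f \<in> Hom D (Dom D f) (Cod D f)" and g: "g \<in> Hom D (Cod D f) (Cod D g)"
        using that by (simp_all add: Hom_iff)
      note gf = D.Comp_Hom[OF f g]
      note Xf = subset_diagram_Hom[OF f] and Xg = subset_diagram_Hom[OF g]
      show ?thesis
      proof (rule set_Hom_eqI[OF subset_diagram_Hom(1)[OF gf] set_Comp_Hom[OF Xf(1) Xg(1)]])
        fix z assume z: "z \<in> El (fobj Sub (Dom D f))"
        then obtain T where T: "z = enc T" "T \<subseteq> Hom D (Dom D f) b"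
          using D.Hom_Obj(1)[OF f] by (auto simp: El_subset_diagram)
        let ?T = "{h \<in> Hom D (Cod D f) b. h \<cdot> f \<in> T}"
        have "{h \<in> Hom D (Cod D g) b. h \<cdot> (g \<cdot> f) \<in> T} = {h \<in> Hom D (Cod D g) b. h \<cdot> g \<in> ?T}"
          using D.Comp_assoc[OF f g] D.Comp_Hom[OF g] by auto
        moreover have "app (farr Sub g \<bullet> farr Sub f) z = app (farr Sub g) (enc ?T)"
          using z set_HomD(5)[OF Xf(1)] Xf(2)[OF T(2)] by (simp add: T(1))
        moreover have "\<dots> = enc {h \<in> Hom D (Cod D g) b. h \<cdot> g \<in> ?T}"
          by (rule Xg(2)) auto
        ultimately show "app (farr Sub (g \<cdot> f)) z = app (farr Sub g \<bullet> farr Sub f) z"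
          using subset_diagram_Hom(2)[OF gf T(2)] by (simp add: T(1))
      qed
    qed
  qed (use D category_set_cat in \<open>auto simp: subset_diagram_def\<close>)
  then show ?thesis by (simp add: functors_def subset_diagram_def)
qed

end

text \<open>The diagram of subsets is Reedy fibrant.  Given a compatible family of subsets
  \<open>W f \<subseteq> Hom(cod f, b)\<close>, for \<open>f\<close> in the matching category of \<open>a\<close>, the lift is the set of all \<open>g \<cdot> f\<close>
  with \<open>g \<in> W f\<close>.  It restricts to the given family because membership of \<open>g\<close> in \<open>W f\<close> depends only on
  \<open>g \<cdot> f\<close>: if \<open>g \<cdot> f = d \<cdot> k\<close> is the Reedy factorization, then it is equivalent to \<open>d \<in> W k\<close>.\<close>

lemma subset_diagram_lifts:
  fixes D :: "('od, 'ad, 'z) reedy_scheme" (structure) and enc :: "'ad set \<Rightarrow> 'v"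
  assumes D: "reedy_category U D" and enc: "inj_on enc (Pow (Arr D))"
    and i: "i \<in> Cof set_cat" and a: "a \<in> Obj D"
  shows "matching_lifts D set_cat (to_point D (subset_diagram D enc b)) a i"
proof -
  interpret D: category D using D by (rule reedy_category_category)
  note catD = D.category_axioms
  note inv = Inverse_closed[OF D]
  let ?X = "subset_diagram D enc b" and ?J = "matching_cat D a"
  let ?dec = "inv_into (Pow (Arr D)) enc"
  note X = functors_functor[OF subset_diagram_functors[OF catD enc, of b]]
  note X_app = subset_diagram_Hom(2)[OF catD enc, where b = b]
  note El_dec = El_dec[OF catD enc, where b = b] and dec_enc = dec_enc[OF catD enc, where b = b]
  define A where "A = src i"
  define B where "B = trg i"
  have iH: "i \<in> Hom set_cat A B" and inj: "inj_on (app i) (El A)"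
    using i maps_Hom by (simp_all add: A_def B_def)
  have point: "fobj (point_diagram D) a = eo {undefined}" using a by (simp add: point_diagram_def)
  show ?thesis
    unfolding matching_lifts_def set_cat_simps A_def[symmetric] B_def[symmetric]
  proof (intro ballI allI impI)
    fix u v w
    assume "u \<in> Hom set_cat A (fobj (nsrc (to_point D ?X)) a)" and "v \<in> Hom set_cat B (fobj (ntgt (to_point D ?X)) a)"
      and "is_cone ?J set_cat (matching_diagram D (nsrc (to_point D ?X))) B w"
      and "nat_at (to_point D ?X) a \<bullet> u = v \<bullet> i"
      and wf: "\<forall>f\<in>Obj ?J. w f \<bullet> i = farr (nsrc (to_point D ?X)) f \<bullet> u
        \<and> nat_at (to_point D ?X) (Cod D f) \<bullet> w f = farr (ntgt (to_point D ?X)) f \<bullet> v"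
    then have u: "u \<in> Hom set_cat A (fobj ?X a)" and v: "v \<in> Hom set_cat B (eo {undefined})"
      and w: "is_cone ?J set_cat (matching_diagram D ?X) B w"
      using point by (simp_all add: to_point_def)
    have wf: "w f \<bullet> i = farr ?X f \<bullet> u" if "f \<in> Obj ?J" for f
      using wf that by (simp add: to_point_def)
    have wH: "w f \<in> Hom set_cat B (fobj ?X (Cod D f))" if "f \<in> Obj ?J" for f
      using w that unfolding matching_cone_iff[OF D] by blast
    have f_Hom: "f \<in> Hom D a (Cod D f)" if "f \<in> Obj ?J" for f
      using that inv(1) by (simp add: Hom_iff)
    define W where "W f z = ?dec (app (w f) z)" for f z
    have W: "enc (W f z) = app (w f) z" "W f z \<subseteq> Hom D (Cod D f) b" if "f \<in> Obj ?J" "z \<in> El B" for f z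
      using El_dec[OF D.Hom_Obj(2)[OF f_Hom[OF that(1)]] set_HomD(4)[OF wH[OF that(1)] that(2)]]
      by (simp_all add: W_def)
    have W_comp: "g \<cdot> h \<in> W f z \<longleftrightarrow> g \<in> W (h \<cdot> f) z"
      if f: "f \<in> Obj ?J" and h: "h \<in> Inverse D" "Dom D h = Cod D f" and hf: "h \<cdot> f \<in> Obj ?J" and z: "z \<in> El B"
        and g: "g \<in> Hom D (Cod D h) b" for f g h z
    proof -
      have hH: "h \<in> Hom D (Cod D f) (Cod D h)" using h inv(1) by (simp add: Hom_iff)
      have "farr ?X h \<bullet> w f = w (h \<cdot> f)"
        using w f h hf unfolding matching_cone_iff[OF D] by blast
      then have "app (w (h \<cdot> f)) z = app (farr ?X h) (app (w f) z)"
        using z set_HomD(5)[OF wH[OF f]] app_Comp by metis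
      also have "\<dots> = enc {g \<in> Hom D (Cod D h) b. g \<cdot> h \<in> W f z}"
        using X_app[OF hH W(2)[OF f z]] W(1)[OF f z] by simp
      finally have "W (h \<cdot> f) z = {g \<in> Hom D (Cod D h) b. g \<cdot> h \<in> W f z}"
        unfolding W_def[of "h \<cdot> f"] using dec_enc[of _ "Cod D h"] by simp
      then show ?thesis using g by simp
    qed
    have factor: "\<exists>k\<in>Obj ?J. d \<cdot> k = g \<cdot> f \<and> k \<in> Inverse D \<and> (g \<in> W f z \<longleftrightarrow> d \<in> W k z) \<and> Dom D d = Cod D k \<and> d \<in> Direct D"
      if f: "f \<in> Obj ?J" and g: "g \<in> Hom D (Cod D f) b" and z: "z \<in> El B"
        and d: "d \<in> Direct D" "e \<in> Inverse D" "Dom D d = Cod D e" "d \<cdot> e = g" for f g z d e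
    proof -
      have dH: "d \<in> Hom D (Cod D e) (Cod D d)" and eH: "e \<in> Hom D (Dom D e) (Cod D e)"
        using d Direct_closed(1)[OF D] inv(1) by (simp_all add: Hom_iff)
      have dom: "Dom D e = Cod D f" "Cod D d = b"
        using HomD[OF D.Comp_Hom[OF eH dH]] d(4) HomD[OF g] by simp_all
      have ef: "e \<cdot> f \<in> Obj ?J"
        using Inverse_Comp_not_Ident[OF D _ _ d(2) dom(1)] inv(3)[OF _ d(2) dom(1)] f
          HomD[OF D.Comp_Hom[OF f_Hom[OF f] eH[unfolded dom(1)]]] by auto
      moreover have "d \<cdot> (e \<cdot> f) = g \<cdot> f"
        using D.Comp_assoc[OF f_Hom[OF f] eH[unfolded dom(1)] dH] d(4) by simp
      moreover have "g \<in> W f z \<longleftrightarrow> d \<in> W (e \<cdot> f) z"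
        using W_comp[OF f d(2) dom(1) ef z, of d] dH dom d(4) by simp
      moreover have "Dom D d = Cod D (e \<cdot> f)"
        using HomD(3)[OF D.Comp_Hom[OF f_Hom[OF f] eH[unfolded dom(1)]]] d(3) by simp
      ultimately show ?thesis using d(1) by (intro bexI[of _ "e \<cdot> f"]) simp_all
    qed
    have W_eq: "g \<in> W f z \<longleftrightarrow> g' \<in> W f' z"
      if f: "f \<in> Obj ?J" "g \<in> Hom D (Cod D f) b" and f': "f' \<in> Obj ?J" "g' \<in> Hom D (Cod D f') b"
        and z: "z \<in> El B" and eq: "g \<cdot> f = g' \<cdot> f'" for f g f' g' z
    proof -
      obtain d e where d: "d \<in> Direct D" "e \<in> Inverse D" "Dom D d = Cod D e" "d \<cdot> e = g"
        using reedy_factorization[OF D HomD(1)[OF f(2)]] .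
      obtain d' e' where d': "d' \<in> Direct D" "e' \<in> Inverse D" "Dom D d' = Cod D e'" "d' \<cdot> e' = g'"
        using reedy_factorization[OF D HomD(1)[OF f'(2)]] .
      obtain k where k: "d \<cdot> k = g \<cdot> f" "k \<in> Inverse D" "g \<in> W f z \<longleftrightarrow> d \<in> W k z" "Dom D d = Cod D k"
        using factor[OF f z d] by auto
      obtain k' where k': "d' \<cdot> k' = g' \<cdot> f'" "k' \<in> Inverse D" "g' \<in> W f' z \<longleftrightarrow> d' \<in> W k' z" "Dom D d' = Cod D k'"
        using factor[OF f' z d'] by auto
      have "d \<cdot> k = d' \<cdot> k'" using k k' eq by simp
      then have "d = d'" "k = k'"
        using reedy_factorization_unique[OF D d(1) k(2,4) d'(1) k'(2,4)] by auto
      then show ?thesis using k k' by simp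
    qed
    define H where "H z = {g \<cdot> f | g f. f \<in> Obj ?J \<and> g \<in> W f z}" for z
    have H_sub: "H z \<subseteq> Hom D a b" if z: "z \<in> El B" for z
    proof
      fix x assume "x \<in> H z"
      then obtain f g where "x = g \<cdot> f" and f: "f \<in> Obj ?J" and "g \<in> W f z" unfolding H_def by auto
      then show "x \<in> Hom D a b" using D.Comp_Hom[OF f_Hom[OF f]] W(2)[OF f z] by auto
    qed
    have H_W: "{g \<in> Hom D (Cod D f) b. g \<cdot> f \<in> H z} = W f z" if f: "f \<in> Obj ?J" and z: "z \<in> El B" for f z
    proof
      show "{g \<in> Hom D (Cod D f) b. g \<cdot> f \<in> H z} \<subseteq> W f z"
      proof
        fix g assume "g \<in> {g \<in> Hom D (Cod D f) b. g \<cdot> f \<in> H z}"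
        then obtain g' f' where g: "g \<in> Hom D (Cod D f) b" and f': "f' \<in> Obj ?J" "g' \<in> W f' z" "g \<cdot> f = g' \<cdot> f'"
          unfolding H_def by auto
        have "g' \<in> Hom D (Cod D f') b" using W(2)[OF f'(1) z] f'(2) by blast
        then show "g \<in> W f z" using W_eq[OF f g f'(1) _ z f'(3)] f'(2) by simp
      qed
      show "W f z \<subseteq> {g \<in> Hom D (Cod D f) b. g \<cdot> f \<in> H z}"
        using W(2)[OF f z] f by (auto simp: H_def)
    qed
    \<comment> \<open>On the image of \<open>i\<close> the lift is prescribed by \<open>u\<close>.\<close>
    define h where "h = mk B (\<lambda>z. if z \<in> app i ` El A then app u (inv_into (El A) (app i) z) else enc (H z)) (fobj ?X a)"
    have h: "h \<in> Hom set_cat B (fobj ?X a)"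
      unfolding h_def
    proof (rule mk_Hom)
      show "B \<in> range eo" "fobj ?X a \<in> range eo" using set_HomD(2)[OF iH] set_HomD(2)[OF u] by auto
      show "(if z \<in> app i ` El A then app u (inv_into (El A) (app i) z) else enc (H z)) \<in> El (fobj ?X a)"
        if z: "z \<in> El B" for z
        using set_HomD(4)[OF u] inj dec_El[OF catD enc a H_sub[OF z]] by auto
    qed
    have hi: "app h (app i y) = app u y" if "y \<in> El A" for y
      using that inj set_HomD(4)[OF iH] by (simp add: h_def)
    have hH: "app h z = enc (H z)" if "z \<in> El B" "z \<notin> app i ` El A" for z
      using that by (simp add: h_def)
    show "\<exists>h\<in>Hom set_cat B (fobj (nsrc (to_point D ?X)) a). h \<bullet> i = u
        \<and> nat_at (to_point D ?X) a \<bullet> h = v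
        \<and> (\<forall>f\<in>Obj ?J. farr (nsrc (to_point D ?X)) f \<bullet> h = w f)"
    proof (intro bexI conjI ballI)
      show "h \<in> Hom set_cat B (fobj (nsrc (to_point D ?X)) a)" using h by (simp add: to_point_def)
      show "h \<bullet> i = u"
        using hi set_HomD(5)[OF iH] by (intro set_Hom_eqI[OF set_Comp_Hom[OF iH h] u]) simp
      have "nat_at (to_point D ?X) a \<in> Hom set_cat (fobj ?X a) (eo {undefined})"
        using nat_transformationsD(3)[OF to_point_nat_transformation[OF catD subset_diagram_functors[OF catD enc, of b]] a] point
        by (simp add: to_point_def)
      then show "nat_at (to_point D ?X) a \<bullet> h = v"
        using Hom_point_eq[OF set_Comp_Hom[OF h] v] by blast
      fix f assume f: "f \<in> Obj ?J"
      note Xf = functor_maps(4)[OF X f_Hom[OF f]]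
      have "farr ?X f \<bullet> h = w f"
      proof (rule set_Hom_eqI[OF set_Comp_Hom[OF h Xf] wH[OF f]])
        fix z assume z: "z \<in> El B"
        have fh: "app (farr ?X f \<bullet> h) z = app (farr ?X f) (app h z)"
          using z set_HomD(5)[OF h] by simp
        show "app (farr ?X f \<bullet> h) z = app (w f) z"
        proof (cases "z \<in> app i ` El A")
          case True
          then obtain y where y: "y \<in> El A" "z = app i y" by blast
          have "app (farr ?X f) (app u y) = app (w f) (app i y)"
            using wf[OF f] y set_HomD(5)[OF u] set_HomD(5)[OF iH] by (metis app_Comp)
          then show ?thesis using fh hi y by simp
        next
          case False
          have "app (farr ?X f) (enc (H z)) = enc (W f z)"
            using X_app[OF f_Hom[OF f] H_sub[OF z]] H_W[OF f z] by simp
          then show ?thesis using fh hH[OF z False] W(1)[OF f z] by simp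
        qed
      qed
      then show "farr (nsrc (to_point D ?X)) f \<bullet> h = w f" by (simp add: to_point_def)
    qed
  qed
qed

text \<open>If the category of factorizations of \<open>s\<close> has an object \<open>x0\<close> that is not joined to every other object, the
  component \<open>P\<close> of \<open>x0\<close> gives a cone of subsets \<open>{\<mu>. (\<nu>, \<mu>) \<in> P}\<close> with no common extension: an extension contains
  \<open>\<mu> \<cdot> G \<nu> = s\<close> if and only if \<open>(\<nu>, \<mu>) \<in> P\<close>, for all factorizations of \<open>s\<close>.\<close>

theorem right_quillen_imp_fibering:
  fixes C :: "('oc, 'ac, 'y) reedy_scheme" (structure) and D :: "('od, 'ad, 'z) reedy_scheme" and enc :: "'ad set \<Rightarrow> 'v"
  assumes C: "reedy_category TYPE('u) C" and D: "reedy_category TYPE('u) D" and rG: "reedy_functor C D G"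
    and enc: "inj_on enc (Pow (Arr D))"
    and rq: "right_quillen (reedy_model_structure D set_cat) (reedy_model_structure C set_cat) (precomposition C G)"
  shows "fibering_reedy_functor C D G"
  unfolding fibering_reedy_functor_def
proof (intro conjI ballI impI rG)
  interpret C: category C using C by (rule reedy_category_category)
  interpret D: category D using D by (rule reedy_category_category)
  note catD = D.category_axioms
  note invC = Inverse_closed[OF C] and invD = Inverse_closed[OF D]
  have G: "is_functor C D G" using rG by (simp add: reedy_functor_def)
  fix a b s assume a: "a \<in> Obj C" and s: "s \<in> Inverse D" and sab: "Dom D s = fobj G a \<and> Cod D s = b"
  let ?F = "fact_cat C D G a s"
  note F = category_fact_cat[OF C D rG, of a s]
  define E where "E = (arrow_graph ?F \<union> (arrow_graph ?F)\<inverse>)\<^sup>*"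
  have "(x0, x1) \<in> E" if x0: "x0 \<in> fact_obj C D G a s" and x1: "x1 \<in> fact_obj C D G a s" for x0 x1
  proof -
    define P where "P = {x \<in> fact_obj C D G a s. (x0, x) \<in> E}"
    have P_arrow: "x \<in> P \<longleftrightarrow> y \<in> P" if xy: "(x, y) \<in> arrow_graph ?F" for x y
    proof -
      interpret F: category ?F by (rule F)
      have "x \<in> fact_obj C D G a s" "y \<in> fact_obj C D G a s"
        using xy F.Dom_Obj F.Cod_Obj by (auto simp: arrow_graph_def simp del: fact_cat_simps(2-4))
      moreover have "(x0, x) \<in> E \<longleftrightarrow> (x0, y) \<in> E"
        using xy unfolding E_def by (meson UnI1 UnI2 converseI rtrancl.rtrancl_into_rtrancl)
      ultimately show ?thesis by (simp add: P_def)
    qed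
    have ob: "\<nu> \<in> Obj (matching_cat C a)" "\<nu> \<in> Inverse C" "\<mu> \<in> Inverse D" "\<mu> \<in> Hom D (fobj G (Cod C \<nu>)) b" "\<mu> \<cdot>\<^bsub>D\<^esub> farr G \<nu> = s"
      if "(\<nu>, \<mu>) \<in> fact_obj C D G a s" for \<nu> \<mu>
      using that invD(1) sab by (auto simp: fact_obj_def Hom_iff)
    define X where "X = subset_diagram D enc b"
    have XF: "X \<in> functors D set_cat" unfolding X_def by (rule subset_diagram_functors[OF catD enc])
    note X = functors_functor[OF XF]
    note X_app = subset_diagram_Hom(2)[OF catD enc, of _ _ _ _ b, folded X_def]
    note El_dec = El_dec[OF catD enc, of _ _ b, folded X_def] and dec_El = dec_El[OF catD enc, of _ _ b, folded X_def]
      and dec_enc = dec_enc[OF catD enc, of _ _ b]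
    define t where "t = to_point D X"
    have tN: "t \<in> nat_transformations D set_cat"
      unfolding t_def by (rule to_point_nat_transformation[OF catD XF])
    have t: "nsrc t = X" "ntgt t = point_diagram D" by (simp_all add: t_def to_point_def)
    define t' where "t' = farr (precomposition C G) t"
    have t'N: "t' \<in> nat_transformations C set_cat"
      unfolding t'_def by (rule precomposition_nat_transformation[OF G tN])
    have "matching_lifts D set_cat t d i" if "d \<in> Obj D" "i \<in> Cof set_cat \<inter> Weq set_cat" for d i
      unfolding t_def X_def by (rule subset_diagram_lifts[OF D enc]) (use that in auto)
    then have "t \<in> Fib (reedy_model_structure D set_cat)"
      unfolding reedy_fibration_iff[OF infinite_u model_category_set_cat D tN] by blast
    then have "t' \<in> Fib (reedy_model_structure C set_cat)"
      using rq unfolding right_quillen_def t'_def by blast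
    then have lifts: "matching_lifts C set_cat t' a i" if "i \<in> Cof set_cat \<inter> Weq set_cat" for i
      using that a unfolding reedy_fibration_iff[OF infinite_u model_category_set_cat C t'N] by blast
    \<comment> \<open>The inclusion of the empty set into a point, which turns the lifting problem into an extension problem.\<close>
    define i where "i = mk (eo {}) id (eo {undefined})"
    have iH: "i \<in> Hom set_cat (eo {}) (eo {undefined})" unfolding i_def by (rule mk_Hom) auto
    have i: "i \<in> Cof set_cat \<inter> Weq set_cat" "src i = eo {}" "trg i = eo {undefined}" using set_HomD[OF iH] by auto
    note Ga = functor_maps(3)[OF G a]
    have Xob: "fobj X d \<in> range eo" if "d \<in> Obj D" for d using functor_maps(3)[OF X that] by simp
    define u where "u = mk (eo {}) id (fobj X (fobj G a))"
    have u: "u \<in> Hom set_cat (eo {}) (fobj X (fobj G a))" unfolding u_def by (rule mk_Hom) (use Xob[OF Ga] in auto)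
    define v where "v = Ident set_cat (eo {undefined})"
    have v: "v \<in> Hom set_cat (eo {undefined}) (eo {undefined})" unfolding v_def by (rule set_Ident_Hom) simp
    define W where "W \<nu> = {\<mu>. (\<nu>, \<mu>) \<in> P}" for \<nu>
    have W_sub: "W \<nu> \<subseteq> Hom D (fobj G (Cod C \<nu>)) b" for \<nu>
      using ob(4) by (auto simp: W_def P_def)
    define w where "w \<nu> = mk (eo {undefined}) (\<lambda>_. enc (W \<nu>)) (fobj X (fobj G (Cod C \<nu>)))" for \<nu>
    have codC: "Cod C \<nu> \<in> Obj C" "fobj G (Cod C \<nu>) \<in> Obj D" "\<nu> \<in> Hom C a (Cod C \<nu>)" if "\<nu> \<in> Obj (matching_cat C a)" for \<nu>
      using that invC(1)[of \<nu>] C.Cod_Obj functor_maps(3)[OF G] by (auto simp: Hom_iff)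
    have w: "w \<nu> \<in> Hom set_cat (eo {undefined}) (fobj X (fobj G (Cod C \<nu>)))" if "\<nu> \<in> Obj (matching_cat C a)" for \<nu>
      unfolding w_def by (rule mk_Hom) (use codC[OF that] Xob dec_El W_sub in auto)
    have app_w: "app (w \<nu>) undefined = enc (W \<nu>)" for \<nu> by (simp add: w_def)
    have cone: "is_cone (matching_cat C a) set_cat (matching_diagram C (comp_func C X G)) (eo {undefined}) w"
      unfolding matching_cone_iff[OF C]
    proof (intro conjI ballI impI)
      show "w \<nu> \<in> Hom set_cat (eo {undefined}) (fobj (comp_func C X G) (Cod C \<nu>))" if "\<nu> \<in> Obj (matching_cat C a)" for \<nu>
        using w[OF that] codC[OF that] by (simp add: comp_func_simps)
      fix \<nu> \<tau> assume \<nu>: "\<nu> \<in> Obj (matching_cat C a)" and \<tau>: "\<tau> \<in> Inverse C" "Dom C \<tau> = Cod C \<nu>"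
        and \<tau>\<nu>: "\<tau> \<cdot> \<nu> \<in> Obj (matching_cat C a)"
      have \<tau>H: "\<tau> \<in> Hom C (Cod C \<nu>) (Cod C \<tau>)" using \<tau> invC(1) by (simp add: Hom_iff)
      note \<nu>H = codC(3)[OF \<nu>]
      have cod: "Cod C (\<tau> \<cdot> \<nu>) = Cod C \<tau>" using HomD(3)[OF C.Comp_Hom[OF \<nu>H \<tau>H]] .
      note GH = functor_maps(4)[OF G \<nu>H] functor_maps(4)[OF G \<tau>H]
      have Ginv: "farr G \<tau> \<in> Inverse D" "farr G \<nu> \<in> Inverse D" using rG \<tau>(1) \<nu> by (auto simp: reedy_functor_def)
      have W_iff: "\<mu> \<cdot>\<^bsub>D\<^esub> farr G \<tau> \<in> W \<nu> \<longleftrightarrow> \<mu> \<in> W (\<tau> \<cdot> \<nu>)" if \<mu>: "\<mu> \<in> Hom D (fobj G (Cod C \<tau>)) b" for \<mu>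
      proof -
        have eq: "\<mu> \<cdot>\<^bsub>D\<^esub> farr G \<tau> \<cdot>\<^bsub>D\<^esub> farr G \<nu> = \<mu> \<cdot>\<^bsub>D\<^esub> farr G (\<tau> \<cdot> \<nu>)"
          using D.Comp_assoc[OF GH \<mu>] functor_maps(7)[OF G \<nu>H \<tau>H] by simp
        have edge: "((\<nu>, \<mu> \<cdot>\<^bsub>D\<^esub> farr G \<tau>), (\<tau> \<cdot> \<nu>, \<mu>)) \<in> arrow_graph ?F"
          if "(\<nu>, \<mu> \<cdot>\<^bsub>D\<^esub> farr G \<tau>) \<in> fact_obj C D G a s" "(\<tau> \<cdot> \<nu>, \<mu>) \<in> fact_obj C D G a s"
          unfolding arrow_graph_def using that \<tau> cod
          by (intro image_eqI[of _ _ "((\<nu>, \<mu> \<cdot>\<^bsub>D\<^esub> farr G \<tau>), \<tau>, (\<tau> \<cdot> \<nu>, \<mu>))"]) simp_all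
        note \<mu>\<tau> = HomD[OF D.Comp_Hom[OF GH(2) \<mu>]]
        have "(\<nu>, \<mu> \<cdot>\<^bsub>D\<^esub> farr G \<tau>) \<in> fact_obj C D G a s \<longleftrightarrow> (\<tau> \<cdot> \<nu>, \<mu>) \<in> fact_obj C D G a s"
        proof
          assume x: "(\<nu>, \<mu> \<cdot>\<^bsub>D\<^esub> farr G \<tau>) \<in> fact_obj C D G a s"
          have "\<mu> \<in> Inverse D"
            using Inverse_cancel_right[OF D HomD(1)[OF \<mu>] Ginv(1) _ ob(3)[OF x]] HomD(2)[OF \<mu>] HomD(3)[OF GH(2)] by simp
          then show "(\<tau> \<cdot> \<nu>, \<mu>) \<in> fact_obj C D G a s"
            using \<tau>\<nu> HomD[OF \<mu>] cod eq ob(5)[OF x] sab by (simp add: fact_obj_def)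
        next
          assume x: "(\<tau> \<cdot> \<nu>, \<mu>) \<in> fact_obj C D G a s"
          have "\<mu> \<cdot>\<^bsub>D\<^esub> farr G \<tau> \<in> Inverse D"
            using invD(3)[OF Ginv(1) ob(3)[OF x]] HomD(2)[OF \<mu>] HomD(3)[OF GH(2)] by simp
          then show "(\<nu>, \<mu> \<cdot>\<^bsub>D\<^esub> farr G \<tau>) \<in> fact_obj C D G a s"
            using \<nu> \<mu>\<tau> eq ob(5)[OF x] sab by (simp add: fact_obj_def)
        qed
        then show ?thesis using edge P_arrow by (auto simp: W_def P_def)
      qed
      note G\<tau> = functor_maps(4)[OF X GH(2)]
      have "farr X (farr G \<tau>) \<bullet> w \<nu> = w (\<tau> \<cdot> \<nu>)"
      proof (rule set_Hom_eqI[OF set_Comp_Hom[OF w[OF \<nu>] G\<tau>] w[OF \<tau>\<nu>, unfolded cod]])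
        fix z assume "z \<in> El (eo {undefined})"
        then have z: "z = undefined" by simp
        have "{\<mu> \<in> Hom D (fobj G (Cod C \<tau>)) b. \<mu> \<cdot>\<^bsub>D\<^esub> farr G \<tau> \<in> W \<nu>} = W (\<tau> \<cdot> \<nu>)"
          using W_iff W_sub[of "\<tau> \<cdot> \<nu>"] cod by auto
        then show "app (farr X (farr G \<tau>) \<bullet> w \<nu>) z = app (w (\<tau> \<cdot> \<nu>)) z"
          using X_app[OF GH(2) W_sub] set_HomD(5)[OF w[OF \<nu>]] by (simp add: z app_w)
      qed
      then show "farr (comp_func C X G) \<tau> \<bullet> w \<nu> = w (\<tau> \<cdot> \<nu>)"
        using invC(1)[OF \<tau>(1)] by (simp add: comp_func_simps)
    qed simp
    have t'at: "nat_at t' c \<in> Hom set_cat (fobj X (fobj G c)) (eo {undefined})" if "c \<in> Obj C" for c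
      using nat_transformationsD(3)[OF tN functor_maps(3)[OF G that]] functor_maps(3)[OF G that] that
      by (simp add: t'_def precomposition_simps t point_diagram_def)
    have point: "fobj (point_diagram D) (fobj G c) = eo {undefined}" if "c \<in> Obj C" for c
      using functor_maps(3)[OF G that] by (simp add: point_diagram_def)
    have pointH: "farr (point_diagram D) (farr G \<nu>) \<in> Hom set_cat (eo {undefined}) (eo {undefined})"
      if "\<nu> \<in> Obj (matching_cat C a)" for \<nu>
      using functor_maps(4)[OF functors_functor[OF point_diagram_functors[OF catD]] functor_maps(4)[OF G codC(3)[OF that]]]
        point[OF a] point[OF codC(1)[OF that]] by simp
    have "\<exists>h \<in> Hom set_cat (eo {undefined}) (fobj (comp_func C X G) a). h \<bullet> i = u \<and> nat_at t' a \<bullet> h = v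
        \<and> (\<forall>f\<in>Obj (matching_cat C a). farr (comp_func C X G) f \<bullet> h = w f)"
    proof (rule lifts[OF i(1), unfolded matching_lifts_def t'_def precomposition_simps t set_cat_simps(3,4) i(2,3),
          folded t'_def, rule_format])
      show "u \<in> Hom set_cat (eo {}) (fobj (comp_func C X G) a)" using u a by (simp add: comp_func_simps)
      show "v \<in> Hom set_cat (eo {undefined}) (fobj (comp_func C (point_diagram D) G) a)"
        using v a point[OF a] by (simp add: comp_func_simps)
      show "is_cone (matching_cat C a) set_cat (matching_diagram C (comp_func C X G)) (eo {undefined}) w" by (rule cone)
      show "nat_at t' a \<bullet> u = v \<bullet> i"
        by (rule Hom_point_eq[OF set_Comp_Hom[OF u t'at[OF a]] set_Comp_Hom[OF iH v]])
      fix \<nu> assume \<nu>: "\<nu> \<in> Obj (matching_cat C a)"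
      have farr: "farr (comp_func C Z G) \<nu> = farr Z (farr G \<nu>)" for Z :: "('od, 'ad, 'om, 'am) func"
        using HomD(1)[OF codC(3)[OF \<nu>]] by (simp add: comp_func_simps)
      note XG = functor_maps(4)[OF X functor_maps(4)[OF G codC(3)[OF \<nu>]]]
      show "w \<nu> \<bullet> i = farr (comp_func C X G) \<nu> \<bullet> u \<and>
          nat_at t' (Cod C \<nu>) \<bullet> w \<nu> = farr (comp_func C (point_diagram D) G) \<nu> \<bullet> v"
        unfolding farr
      proof
        show "w \<nu> \<bullet> i = farr X (farr G \<nu>) \<bullet> u"
          by (rule set_Hom_eqI[OF set_Comp_Hom[OF iH w[OF \<nu>]] set_Comp_Hom[OF u XG]]) simp
        show "nat_at t' (Cod C \<nu>) \<bullet> w \<nu> = farr (point_diagram D) (farr G \<nu>) \<bullet> v"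
          by (rule Hom_point_eq[OF set_Comp_Hom[OF w[OF \<nu>] t'at[OF codC(1)[OF \<nu>]]] set_Comp_Hom[OF v pointH[OF \<nu>]]])
      qed
    qed
    then obtain h where "h \<in> Hom set_cat (eo {undefined}) (fobj (comp_func C X G) a)"
      and hw': "\<forall>\<nu>\<in>Obj (matching_cat C a). farr (comp_func C X G) \<nu> \<bullet> h = w \<nu>" by blast
    then have h: "h \<in> Hom set_cat (eo {undefined}) (fobj X (fobj G a))"
      using a by (simp add: comp_func_simps)
    have hw: "farr X (farr G \<nu>) \<bullet> h = w \<nu>" if "\<nu> \<in> Obj (matching_cat C a)" for \<nu>
      using bspec[OF hw' that] HomD(1)[OF codC(3)[OF that]] by (simp add: comp_func_simps)
    have "app h undefined \<in> El (fobj X (fobj G a))" using set_HomD(4)[OF h] by simp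
    then obtain T where T: "app h undefined = enc T" "T \<subseteq> Hom D (fobj G a) b"
      using El_dec[OF Ga] by metis
    have T_iff: "s \<in> T \<longleftrightarrow> (\<nu>, \<mu>) \<in> P" if x: "(\<nu>, \<mu>) \<in> fact_obj C D G a s" for \<nu> \<mu>
    proof -
      note \<nu> = ob(1)[OF x] and \<mu> = ob(4)[OF x]
      let ?T = "{\<mu> \<in> Hom D (fobj G (Cod C \<nu>)) b. \<mu> \<cdot>\<^bsub>D\<^esub> farr G \<nu> \<in> T}"
      have "app (farr X (farr G \<nu>) \<bullet> h) undefined = enc ?T"
        using X_app[OF functor_maps(4)[OF G codC(3)[OF \<nu>]] T(2)] set_HomD(5)[OF h] by (simp add: T(1))
      then have eq: "enc ?T = enc (W \<nu>)" using hw[OF \<nu>] app_w by simp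
      have "?T \<subseteq> Hom D (fobj G (Cod C \<nu>)) b" by (rule Collect_restrict)
      from dec_enc[OF this] dec_enc[OF W_sub[of \<nu>]] have "?T = W \<nu>"
        unfolding eq by (rule trans[OF sym])
      moreover have "\<mu> \<in> ?T \<longleftrightarrow> s \<in> T" using \<mu> ob(5)[OF x] by simp
      ultimately show ?thesis by (simp add: W_def)
    qed
    have "x0 \<in> P" using x0 by (simp add: P_def E_def)
    then have "x1 \<in> P" using T_iff[of "fst x0" "snd x0"] T_iff[of "fst x1" "snd x1"] x0 x1 by simp
    then show ?thesis by (simp add: P_def)
  qed
  then show "sset_empty (nerve ?F) \<or> sset_connected (nerve ?F)"
    unfolding sset_empty_nerve[OF F] sset_connected_nerve[OF F] E_def by auto
qed

end

section \<open>Precomposition for all model categories\<close>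

text \<open>Pairing functions exist on \<open>'u\<close> and on its iterated powersets, because these are infinite.  A family of subsets of
  \<open>'u\<close> is coded as its disjoint union in \<open>'u \<times> 'u\<close>, and a function on \<open>'u set\<close> as its graph.\<close>

lemma set_encoding_exists:
  assumes inf: "infinite (UNIV :: 'u set)"
    and large_obj: "\<exists>e :: 'u set set \<Rightarrow> 'om. inj e"
    and large_arr: "\<exists>e :: 'u set set \<Rightarrow> 'am. inj e"
  shows "\<exists>eo :: 'u set set \<Rightarrow> 'om. \<exists>ea :: 'u set set \<times> ('u set \<Rightarrow> 'u set) \<times> 'u set set \<Rightarrow> 'am.
    \<exists>fam :: ('u \<Rightarrow> 'u set) \<Rightarrow> 'u set. \<exists>tag :: 'u \<times> 'u set \<Rightarrow> 'u set. set_encoding eo ea fam tag"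
proof -
  have infinite_set: "infinite (UNIV :: 'a set set)" if "infinite (UNIV :: 'a set)"
    using that by (simp flip: Pow_UNIV)
  obtain p1 :: "'u \<times> 'u \<Rightarrow> 'u" where p1: "inj p1"
    using infinite_pairing[OF inf] .
  obtain p2 :: "'u set \<times> 'u set \<Rightarrow> 'u set" where p2: "inj p2"
    using infinite_pairing[OF infinite_set[OF inf]] .
  have "infinite (UNIV :: 'u set set set)" using inf by (simp flip: Pow_UNIV)
  then obtain p3 :: "'u set set \<times> 'u set set \<Rightarrow> 'u set set" where p3: "inj p3"
    using infinite_pairing by blast
  obtain eo :: "'u set set \<Rightarrow> 'om" where eo: "inj eo" using large_obj by blast
  obtain e :: "'u set set \<Rightarrow> 'am" where e: "inj e" using large_arr by blast
  define fam where "fam f = p1 ` Sigma UNIV f" for f :: "'u \<Rightarrow> 'u set"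
  have "inj fam"
  proof (rule injI)
    fix f g assume "fam f = fam g"
    then have "Sigma UNIV f = Sigma UNIV g" unfolding fam_def inj_image_eq_iff[OF p1] .
    then show "f = g" by (auto simp: set_eq_iff fun_eq_iff)
  qed
  define tag where "tag x = p2 ({fst x}, snd x)" for x :: "'u \<times> 'u set"
  have "inj tag"
    by (rule injI) (simp add: tag_def inj_eq[OF p2] prod_eq_iff)
  define ea where "ea x = e (p3 (fst x, p3 (range (\<lambda>z. p2 (z, fst (snd x) z)), snd (snd x))))"
    for x :: "'u set set \<times> ('u set \<Rightarrow> 'u set) \<times> 'u set set"
  have graph: "f = g" if "range (\<lambda>z. p2 (z, f z)) = range (\<lambda>z. p2 (z, g z))" for f g :: "'u set \<Rightarrow> 'u set"
  proof
    fix z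
    have "p2 (z, f z) \<in> range (\<lambda>z. p2 (z, g z))" using that by blast
    then show "f z = g z" by (auto simp: inj_eq[OF p2])
  qed
  have "inj ea"
    by (rule injI) (auto simp: ea_def inj_eq[OF e] inj_eq[OF p3] prod_eq_iff dest: graph)
  have "set_encoding eo ea fam tag"
    by unfold_locales fact+
  then show ?thesis by blast
qed

theorem theorem1p1:
  fixes C :: "('oc, 'ac) reedy" and D :: "('od, 'ad) reedy"
    and G :: "('oc, 'ac, 'od, 'ad) func"
  assumes universe: "infinite (UNIV :: 'u set)"
    and large_obj: "\<exists>e :: 'u set set \<Rightarrow> 'om. inj e"
    and large_arr: "\<exists>e :: 'u set set \<Rightarrow> 'am. inj e"
    and C: "reedy_category TYPE('u) C"
    and D: "reedy_category TYPE('u) D"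
    and G: "reedy_functor C D G"
  shows "(\<forall>M :: ('om, 'am) model_cat. model_category TYPE('u) M \<longrightarrow>
            right_quillen (reedy_model_structure D M) (reedy_model_structure C M) (precomposition C G))
         \<longleftrightarrow> fibering_reedy_functor C D G"
proof
  assume rq: "\<forall>M :: ('om, 'am) model_cat. model_category TYPE('u) M \<longrightarrow>
      right_quillen (reedy_model_structure D M) (reedy_model_structure C M) (precomposition C G)"
  obtain eo :: "'u set set \<Rightarrow> 'om" and ea :: "'u set set \<times> ('u set \<Rightarrow> 'u set) \<times> 'u set set \<Rightarrow> 'am"
    and fam :: "('u \<Rightarrow> 'u set) \<Rightarrow> 'u set" and tag :: "'u \<times> 'u set \<Rightarrow> 'u set" where "set_encoding eo ea fam tag"
    using set_encoding_exists[OF universe large_obj large_arr] by blast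
  then interpret set_encoding eo ea fam tag .
  obtain e :: "'ad \<Rightarrow> 'u" where e: "inj_on e (Arr D)"
    using D unfolding reedy_category_def small_category_def by blast
  have "inj_on ((`) e) (Pow (Arr D))" using e by (rule inj_on_image_Pow)
  then show "fibering_reedy_functor C D G"
    using right_quillen_imp_fibering[OF C D G] rq model_category_set_cat by blast
next
  assume "fibering_reedy_functor C D G"
  then show "\<forall>M :: ('om, 'am) model_cat. model_category TYPE('u) M \<longrightarrow>
      right_quillen (reedy_model_structure D M) (reedy_model_structure C M) (precomposition C G)"
    using fibering_right_quillen[OF universe C D] by blast
qed

end
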